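(* For every real $p\ge 4$, every positive integer $n$, and every nonzero real symmetric matrix $M\in\mathbb{R}^{n\times n}$, let $G\sim N(0,I_n)$ and $g\sim N(0,1)$. Then \[ \bigl\|G^{\mathsf T}MG-\operatorname{tr}M\bigr\|_p\le \|g^2-1\|_p\,\|M\|_{\mathrm F}. \] Equality holds if and only if $M$ has rank one, and the sharp constant is \[ \|g^2-1\|_p=\left[\frac1{\sqrt{2\pi}}\int_0^\infty |x-1|^p x^{-1/2}\exp(-x/2)\,\mathrm{d}x\right]^{1/p}. \]
   Context: For a real random variable $X$, $\|X\|_p=(\mathbb{E}|X|^p)^{1/p}$. For a real symmetric matrix $M$, $\|M\|_{\mathrm F}=\sqrt{\operatorname{tr}(M^2)}$. $N(0,I_n)$ is the standard Gaussian distribution on $\mathbb{R}^n$. *)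

theory Defs
  imports "HOL-Probability.Probability"
begin

text \<open>
  This is a Bochner integral, so the value is \<open>0\<close> rather than infinite when
  \<open>\<bar>X\<bar> powr p\<close> is not integrable; a claim that the norm is finite has to
  assert integrability separately.
\<close>
definition Lp_norm :: "'a measure \<Rightarrow> real \<Rightarrow> ('a \<Rightarrow> real) \<Rightarrow> real" where
  "Lp_norm P p X = (\<integral>\<omega>. \<bar>X \<omega>\<bar> powr p \<partial>P) powr (1 / p)"

definition std_gaussian_density :: "real ^ 'n \<Rightarrow> real" where
  "std_gaussian_density x =
     (2 * pi) powr (- real CARD('n) / 2) * exp (- (norm x)\<^sup>2 / 2)"

text \<open>Intended for symmetric \<open>M\<close>, where the trace is the sum of the squared entries.\<close>
definition frobenius_norm :: "real ^ 'n ^ 'n \<Rightarrow> real" where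
  "frobenius_norm M = sqrt (trace (M ** M))"

end

theory Submission
  imports Defs "HOL-Real_Asymp.Real_Asymp"
begin

text \<open>
  Diagonalising \<open>M\<close> reduces the claim to \<open>S = (\<Sum>i. l i * X i)\<close> with \<open>X i = (g i)\<^sup>2 - 1\<close> for independent
  standard Gaussians \<open>g i\<close> and \<open>l\<close> on the unit sphere. Enlarge the family by unused coordinates and by a
  Gaussian coordinate \<open>sqrt 2 * g z\<close>, and consider a maximiser \<open>l\<close> of \<open>E \<bar>S\<bar> powr p\<close>, which exists by compactness.
  Integration by parts shows that moving squared length into coordinate \<open>i\<close> changes the moment at a rate
  proportional to \<open>u i = E ((g i)\<^sup>2 * \<bar>S\<bar> powr (p - 2))\<close>, and \<open>u i = U (l i)\<close> for the strictly convex function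
  \<open>U t = E (\<bar>S + 2 * t * e\<bar> powr (p - 2))\<close> with an independent standard exponential \<open>e\<close>, because \<open>(g i)\<^sup>2 + 2 * e\<close>
  has the size-biased law of \<open>(g i)\<^sup>2\<close>; for the Gaussian coordinate the rate is \<open>U 0\<close>. Hence at a maximiser \<open>U\<close> takes one
  value, at least \<open>U 0\<close>, at all nonzero \<open>l i\<close>. Strict convexity of \<open>U\<close> then excludes repeated entries, a Gaussian part
  (splitting it into \<open>t\<close> and \<open>-t\<close> gains \<open>U t + U (- t) - 2 * U 0 > 0\<close>), and two entries of the same sign. The remaining case
  \<open>S = a * X i - b * X j\<close> is excluded by a reflection of the squared radius \<open>m\<close> to \<open>4 - m\<close> along rays in the plane.
\<close>

section \<open>One-dimensional Gaussian integrals\<close>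

text \<open>Squared lengths are the right coordinates on the sphere because Gaussian integration by
  parts turns E[X_i sgn(S) |S|^(p-1)] into a multiple of \<open>l i * u i\<close>; the factor
  \<open>l i\<close> is absorbed into the derivative of the square of \<open>l i\<close>, so the
  rate makes sense even where \<open>l i = 0\<close>. At a maximiser the first-order rates often
  tie, for instance between equal entries. Instead of second derivatives, every contradiction uses a
  whole path leaving the maximiser: the rate only has to be positive for all small positive times.
  Convexity cannot exclude opposite signs, since \<open>U\<close> may take equal values on both
  sides of 0. There the rates of the two coordinates are compared directly, after symmetrising in
  them. Along a ray the symmetrised integrand changes sign at squared radius 2, the mean of the sum
  of two squared standard Gaussians, whence the reflection about 2; the part beyond 4 has no mirror
  image and makes the comparison strict. Strict convexity of \<open>U\<close> rests on the exponent
  \<open>p - 2\<close> being greater than 1.\<close>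

abbreviation std_normal :: "real measure" where
  "std_normal \<equiv> density lborel std_normal_density"

text \<open>Powers of 1 + x^2 serve as dominating functions throughout; the binomial expansion
  reduces them to even Gaussian moments.\<close>

lemma integrable_std_normal_one_plus_square_power:
  "integrable std_normal (\<lambda>x. (1 + x\<^sup>2) ^ m)"
  by (subst add.commute, subst binomial_ring)
    (auto intro!: Bochner_Integration.integrable_sum integrable_mult_right
      integrable_std_normal_distribution_moment simp flip: power_mult)

lemma prob_space_std_normal: "prob_space std_normal"
  by (rule prob_space_normal_density) simp

lemma std_normal_decay: "((\<lambda>x. C * (1 + x\<^sup>2) ^ m * std_normal_density x) \<longlongrightarrow> 0) at_top"
  unfolding normal_density_def by real_asymp

text \<open>Stein's identity. The product of \<open>\<phi>\<close> with the Gaussian density has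
  derivative (phi' - x phi) times the density, and polynomial growth makes the boundary terms
  vanish.\<close>

lemma std_normal_integral_by_parts:
  assumes d: "\<And>x. (\<phi> has_real_derivative \<phi>' x) (at x)"
    and c: "continuous_on UNIV \<phi>'"
    and b: "\<And>x. \<bar>\<phi> x\<bar> \<le> C * (1 + x\<^sup>2) ^ m"
    and b': "\<And>x. \<bar>\<phi>' x\<bar> \<le> C * (1 + x\<^sup>2) ^ m"
  shows "(\<integral>x. x * \<phi> x \<partial>std_normal) = (\<integral>x. \<phi>' x \<partial>std_normal)"
proof -
  define F where "F x = \<phi> x * std_normal_density x" for x
  define F' where "F' x = std_normal_density x * \<phi>' x - std_normal_density x * (x * \<phi> x)" for x
  have contphi: "continuous_on UNIV \<phi>"
    using d by (meson DERIV_isCont continuous_at_imp_continuous_on)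
  have [measurable]: "\<phi> \<in> borel_measurable borel" "\<phi>' \<in> borel_measurable borel"
    using c contphi by (auto intro: borel_measurable_continuous_onI)
  have C: "C \<ge> 0" using b[of 0] by simp
  have x1: "\<bar>x\<bar> \<le> 1 + x\<^sup>2" for x :: real
    using sum_squares_ge_zero[of "\<bar>x\<bar> - 1" "x"] by (simp add: power2_eq_square algebra_simps) 
  have i1: "integrable std_normal \<phi>'"
    by (rule Bochner_Integration.integrable_bound[OF integrable_mult_right[OF integrable_std_normal_one_plus_square_power[of m], of C]])
      (use b' C in \<open>auto simp: abs_mult\<close>)
  have "\<bar>x * \<phi> x\<bar> \<le> C * (1 + x\<^sup>2) ^ Suc m" for x
    using mult_mono[OF x1[of x] b[of x]] by (simp add: abs_mult mult_ac)
  then have i2: "integrable std_normal (\<lambda>x. x * \<phi> x)"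
    by (intro Bochner_Integration.integrable_bound[OF integrable_mult_right[OF integrable_std_normal_one_plus_square_power[of "Suc m"], of C]])
      (use C in \<open>auto simp: abs_mult\<close>)
  have j1: "integrable lborel (\<lambda>x. std_normal_density x * \<phi>' x)"
    and j2: "integrable lborel (\<lambda>x. std_normal_density x * (x * \<phi> x))"
    using i1 i2 by (simp_all add: integrable_density)
  have lim: "(F \<longlongrightarrow> 0) at_top"
    by (rule Lim_null_comparison[OF _ std_normal_decay[of C m]])
      (auto simp: F_def abs_mult intro!: always_eventually mult_right_mono b)
  have lim': "((\<lambda>x. F (- x)) \<longlongrightarrow> 0) at_top"
    apply (rule Lim_null_comparison[OF _ std_normal_decay[of C m]])
    using b[of "- x" for x] by (auto simp: F_def abs_mult normal_density_def intro!: always_eventually divide_right_mono mult_right_mono)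
  have "(LBINT x=-\<infinity>..\<infinity>. F' x) = 0 - 0"
  proof (rule interval_integral_FTC_integrable[of _ _ F])
    have n: "(std_normal_density has_real_derivative - x * std_normal_density x) (at x)" for x
      unfolding normal_density_def by (auto intro!: derivative_eq_intros simp: divide_simps)
    show "(F has_vector_derivative F' x) (at x)" for x
      unfolding F_def F'_def has_real_derivative_iff_has_vector_derivative[symmetric]
      by (auto intro!: derivative_eq_intros d n simp: algebra_simps)
    show "isCont F' x" for x
      using c contphi unfolding F'_def normal_density_def
      by (intro continuous_intros) (auto simp: continuous_on_eq_continuous_at)
    show "set_integrable lborel (einterval (- \<infinity>) \<infinity>) F'"
      using j1 j2 by (simp add: set_integrable_def einterval_def F'_def)
    show "((F \<circ> real_of_ereal) \<longlongrightarrow> 0) (at_right (- \<infinity>))"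
      using lim' by (simp add: ereal_tendsto_simps filterlim_at_bot_mirror)
    show "((F \<circ> real_of_ereal) \<longlongrightarrow> 0) (at_left \<infinity>)"
      using lim by (simp add: ereal_tendsto_simps)
  qed auto
  then have "(\<integral>x. F' x \<partial>lborel) = 0"
    by (simp add: interval_lebesgue_integral_def set_lebesgue_integral_def einterval_def)
  then show ?thesis
    using j1 j2 by (simp add: F'_def integral_density)
qed

text \<open>The substitution t = x^2 is made on the intervals from 0 to n and from 0 to n^2, and
  both sides pass to the limit by monotone convergence. Negative values of \<open>\<psi>\<close> are
  allowed, since \<open>ennreal\<close> cuts them to 0 on both sides; positive and negative parts
  can thus be treated by the same rule.\<close>

lemma nn_integral_square_substitution:
  assumes [measurable]: "\<psi> \<in> borel_measurable borel"
  shows "(\<integral>\<^sup>+x. ennreal (\<psi> (x\<^sup>2) * (2 * x) * indicator {0..} x) \<partial>lborel)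
       = (\<integral>\<^sup>+t. ennreal (\<psi> t * indicator {0..} t) \<partial>lborel)"
proof -
  have lim: "(\<integral>\<^sup>+x. ennreal (f x * indicator {0..} x) \<partial>lborel)
      = (SUP n. \<integral>\<^sup>+x. ennreal (f x * indicator {0..b n} x) \<partial>lborel)"
    if [measurable]: "f \<in> borel_measurable borel" and b: "mono b" "filterlim b at_top sequentially"
    for f b :: "_ \<Rightarrow> real"
  proof -
    have "(SUP n. ennreal (f x * indicator {0..b n} x)) = ennreal (f x * indicator {0..} x)" for x
    proof -
      obtain n where n: "b n \<ge> x"
        using b(2) by (metis eventually_at_top_linorder filterlim_at_top order_refl)
      show ?thesis
      proof (intro antisym SUP_least)
        show "ennreal (f x * indicator {0..} x) \<le> (SUP n. ennreal (f x * indicator {0..b n} x))"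
          using n by (intro SUP_upper2[of n]) (auto simp: indicator_def)
      qed (cases "f x \<ge> 0", auto simp: indicator_def ennreal_neg)
    qed
    then have "(\<integral>\<^sup>+x. ennreal (f x * indicator {0..} x) \<partial>lborel)
      = (\<integral>\<^sup>+x. (SUP n. ennreal (f x * indicator {0..b n} x)) \<partial>lborel)"
      by simp
    also have "\<dots> = (SUP n. \<integral>\<^sup>+x. ennreal (f x * indicator {0..b n} x) \<partial>lborel)"
    proof (rule nn_integral_monotone_convergence_SUP)
      have "ennreal (f x * indicator {0..b m} x) \<le> ennreal (f x * indicator {0..b n} x)" if "m \<le> n" for m n x
        using monoD[OF b(1) that] by (cases "f x \<ge> 0") (auto simp: indicator_def ennreal_neg)
      then show "incseq (\<lambda>n x. ennreal (f x * indicator {0..b n} x))"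
        by (auto simp: incseq_def le_fun_def)
    qed measurable
    finally show ?thesis .
  qed
  have sq: "filterlim (\<lambda>n. (real n)\<^sup>2) at_top sequentially" by real_asymp
  have "(\<integral>\<^sup>+t. ennreal (\<psi> t * indicator {0..} t) \<partial>lborel)
      = (SUP n. \<integral>\<^sup>+t. ennreal (\<psi> t * indicator {0\<^sup>2..(real n)\<^sup>2} t) \<partial>lborel)"
    by (subst lim[OF _ _ sq]) (auto intro!: monoI power_mono)
  also have "\<dots> = (SUP n. \<integral>\<^sup>+x. ennreal (\<psi> (x\<^sup>2) * (2 * x) * indicator {0..real n} x) \<partial>lborel)"
    by (subst nn_integral_substitution[where g = "\<lambda>x. x\<^sup>2" and g' = "\<lambda>x. 2 * x"])
      (auto intro!: derivative_eq_intros continuous_intros simp: set_borel_measurable_def)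
  also have "\<dots> = (\<integral>\<^sup>+x. ennreal (\<psi> (x\<^sup>2) * (2 * x) * indicator {0..} x) \<partial>lborel)"
    by (rule lim[symmetric]) (auto intro!: monoI filterlim_real_sequentially)
  finally show ?thesis ..
qed

lemma nn_integral_cmult_ennreal:
  assumes [measurable]: "f \<in> borel_measurable M" and "c \<ge> 0"
  shows "ennreal c * (\<integral>\<^sup>+x. ennreal (f x) \<partial>M) = (\<integral>\<^sup>+x. ennreal (c * f x) \<partial>M)"
  by (simp add: nn_integral_cmult[symmetric] ennreal_mult' assms(2))

lemma nn_integral_even:
  fixes \<phi> :: "real \<Rightarrow> ennreal"
  assumes [measurable]: "\<phi> \<in> borel_measurable borel" and even: "\<And>x. \<phi> (- x) = \<phi> x"
  shows "(\<integral>\<^sup>+x. \<phi> x \<partial>lborel) = 2 * (\<integral>\<^sup>+x. \<phi> x * indicator {0..} x \<partial>lborel)"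
proof -
  have "(\<integral>\<^sup>+x. \<phi> x \<partial>lborel) = (\<integral>\<^sup>+x. \<phi> x * indicator {0..} x + \<phi> x * indicator {..0} x \<partial>lborel)"
    by (intro nn_integral_cong_AE AE_I[of _ _ "{0}"]) (auto simp: indicator_def split: if_splits)
  also have "\<dots> = (\<integral>\<^sup>+x. \<phi> x * indicator {0..} x \<partial>lborel) + (\<integral>\<^sup>+x. \<phi> x * indicator {..0} x \<partial>lborel)"
    by (rule nn_integral_add) auto
  also have "(\<integral>\<^sup>+x. \<phi> x * indicator {..0} x \<partial>lborel) = (\<integral>\<^sup>+x. \<phi> x * indicator {0..} x \<partial>lborel)"
    by (subst nn_integral_real_affine[where c = "-1" and t = 0])
      (auto simp: even indicator_def intro!: nn_integral_cong)
  finally show ?thesis by (simp add: mult_2)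
qed

text \<open>The chi-square density with one degree of freedom; it produces the explicit integral for
  the sharp constant.\<close>

lemma nn_integral_std_normal_square:
  assumes [measurable]: "\<psi> \<in> borel_measurable borel" 
  shows "(\<integral>\<^sup>+x. ennreal (\<psi> (x\<^sup>2)) \<partial>std_normal)
       = (\<integral>\<^sup>+t. ennreal (1 / sqrt (2 * pi) * (\<psi> t * t powr (- 1 / 2) * exp (- t / 2)) * indicator {0<..} t) \<partial>lborel)"
proof -
  have "(\<integral>\<^sup>+x. ennreal (\<psi> (x\<^sup>2)) \<partial>std_normal)
      = (\<integral>\<^sup>+x. ennreal (std_normal_density x * \<psi> (x\<^sup>2)) \<partial>lborel)"
    by (subst nn_integral_density) (auto simp: ennreal_mult'[symmetric])
  also have "\<dots> = 2 * (\<integral>\<^sup>+x. ennreal (std_normal_density x * \<psi> (x\<^sup>2)) * indicator {0..} x \<partial>lborel)"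
    by (rule nn_integral_even) (auto simp: normal_density_def)
  also have "\<dots> = (\<integral>\<^sup>+x. ennreal (2 * (std_normal_density x * \<psi> (x\<^sup>2) * indicator {0..} x)) \<partial>lborel)"
    by (subst nn_integral_cmult[symmetric]) (auto simp: ennreal_mult' indicator_def intro!: nn_integral_cong)
  \<comment> \<open>For \<open>x > 0\<close> the inserted product
    \<open>(x\<^sup>2) powr (- 1 / 2) * (2 * x)\<close> equals 2 and supplies the Jacobian; at the
    null point 0 the two sides may differ.\<close>
  also have "\<dots> = (\<integral>\<^sup>+x. ennreal (1 / sqrt (2 * pi) * (\<psi> (x\<^sup>2) * (x\<^sup>2) powr (- 1 / 2) * exp (- x\<^sup>2 / 2)) * (2 * x) * indicator {0..} x) \<partial>lborel)"
    by (intro nn_integral_cong_AE AE_I[of _ _ "{0}"])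
      (auto simp: indicator_def normal_density_def powr_minus powr_half_sqrt field_simps)
  also have "\<dots> = (\<integral>\<^sup>+t. ennreal (1 / sqrt (2 * pi) * (\<psi> t * t powr (- 1 / 2) * exp (- t / 2)) * indicator {0..} t) \<partial>lborel)"
    by (rule nn_integral_square_substitution) measurable
  also have "\<dots> = (\<integral>\<^sup>+t. ennreal (1 / sqrt (2 * pi) * (\<psi> t * t powr (- 1 / 2) * exp (- t / 2)) * indicator {0<..} t) \<partial>lborel)"
    by (intro nn_integral_cong_AE AE_I[of _ _ "{0}"]) (auto simp: indicator_def)
  finally show ?thesis .
qed

text \<open>For x >= 0 substitute y^2 = x^2 + 2e: the weights exp(-x^2/2) and exp(-e) combine to
  exp(-y^2/2), and de = y dy. After Fubini the integrand is constant in x on the interval from 0 to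
  y, so integrating over x gives a second factor y and hence the weight y^2. In terms of laws:
  Gamma(1/2) plus an exponential is Gamma(3/2).\<close>

lemma std_normal_square_size_bias:
  assumes [measurable]: "\<psi> \<in> borel_measurable borel" and nonneg: "\<And>t. \<psi> t \<ge> (0 :: real)"
  shows "(\<integral>\<^sup>+x. ennreal (x\<^sup>2 * \<psi> (x\<^sup>2)) \<partial>std_normal)
       = (\<integral>\<^sup>+x. \<integral>\<^sup>+e. ennreal (\<psi> (x\<^sup>2 + 2 * e)) \<partial>density lborel (exponential_density 1) \<partial>std_normal)"
proof -
  define k where "k = 1 / sqrt (2 * pi)"
  have k: "k \<ge> 0" by (simp add: k_def)
  have inner: "(\<integral>\<^sup>+e. ennreal (\<psi> (x\<^sup>2 + 2 * e)) \<partial>density lborel (exponential_density 1))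
     = (\<integral>\<^sup>+y. ennreal (exp (x\<^sup>2 / 2) * (\<psi> (y\<^sup>2) * exp (- y\<^sup>2 / 2) * y) * indicator {x..} y) \<partial>lborel)"
    if "x \<ge> 0" for x :: real
  proof -
    have exponent: "- ((t - x\<^sup>2) / 2) = (x\<^sup>2 - t) / 2" for t :: real
      by (simp add: field_simps)
    have "(\<integral>\<^sup>+e. ennreal (\<psi> (x\<^sup>2 + 2 * e)) \<partial>density lborel (exponential_density 1))
        = (\<integral>\<^sup>+e. ennreal (\<psi> (x\<^sup>2 + 2 * e) * exp (- e) * indicator {0..} e) \<partial>lborel)"
      by (subst nn_integral_density)
        (auto simp: ennreal_mult'[symmetric] exponential_density_def indicator_def mult_ac intro!: nn_integral_cong)
    also have "\<dots> = ennreal (1/2) * (\<integral>\<^sup>+t. ennreal (\<psi> t * exp ((x\<^sup>2 - t) / 2) * indicator {x\<^sup>2..} t) \<partial>lborel)"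
      by (subst nn_integral_real_affine[where c = "1/2" and t = "- x\<^sup>2 / 2"])
        (auto simp: indicator_def field_simps exponent intro!: nn_integral_cong arg_cong2[where f = "(*)"])
    also have "(\<integral>\<^sup>+t. ennreal (\<psi> t * exp ((x\<^sup>2 - t) / 2) * indicator {x\<^sup>2..} t) \<partial>lborel)
        = (\<integral>\<^sup>+t. ennreal ((\<psi> t * exp ((x\<^sup>2 - t) / 2) * indicator {x\<^sup>2..} t) * indicator {0..} t) \<partial>lborel)"
      by (intro nn_integral_cong) (auto simp: indicator_def dest: order_trans[OF zero_le_power2])
    also have "\<dots> = (\<integral>\<^sup>+y. ennreal ((\<psi> (y\<^sup>2) * exp ((x\<^sup>2 - y\<^sup>2) / 2) * indicator {x\<^sup>2..} (y\<^sup>2)) * (2 * y) * indicator {0..} y) \<partial>lborel)"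
      by (rule nn_integral_square_substitution[symmetric]) measurable
    also have "ennreal (1/2) * \<dots> = (\<integral>\<^sup>+y. ennreal (1/2 * ((\<psi> (y\<^sup>2) * exp ((x\<^sup>2 - y\<^sup>2) / 2) * indicator {x\<^sup>2..} (y\<^sup>2)) * (2 * y) * indicator {0..} y)) \<partial>lborel)"
      by (rule nn_integral_cmult_ennreal) auto
    also have "\<dots> = (\<integral>\<^sup>+y. ennreal (exp (x\<^sup>2 / 2) * (\<psi> (y\<^sup>2) * exp (- y\<^sup>2 / 2) * y) * indicator {x..} y) \<partial>lborel)"
    proof (intro nn_integral_cong arg_cong[where f = ennreal])
      fix y :: real
      have "(x\<^sup>2 - y\<^sup>2) / 2 = x\<^sup>2 / 2 + (- y\<^sup>2 / 2)" by (simp add: field_simps)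
      then have e: "exp ((x\<^sup>2 - y\<^sup>2) / 2) = exp (x\<^sup>2 / 2) * exp (- y\<^sup>2 / 2)" by (simp only: exp_add)
      have "x\<^sup>2 \<le> y\<^sup>2 \<longleftrightarrow> x \<le> y" if "y \<ge> 0"
        using that \<open>x \<ge> 0\<close> by (simp add: power2_le_iff_abs_le)
      then show "1/2 * ((\<psi> (y\<^sup>2) * exp ((x\<^sup>2 - y\<^sup>2) / 2) * indicator {x\<^sup>2..} (y\<^sup>2)) * (2 * y) * indicator {0..} y)
         = exp (x\<^sup>2 / 2) * (\<psi> (y\<^sup>2) * exp (- y\<^sup>2 / 2) * y) * indicator {x..} y"
        using \<open>x \<ge> 0\<close> unfolding e by (cases "y \<ge> 0") (auto simp: indicator_def)
    qed
    finally show ?thesis .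
  qed
  let ?G = "\<lambda>x. \<integral>\<^sup>+e. ennreal (\<psi> (x\<^sup>2 + 2 * e)) \<partial>density lborel (exponential_density 1)"
  interpret E: prob_space "density lborel (exponential_density 1)"
    by (rule prob_space_exponential_density) simp
  have [measurable]: "Measurable.pred (borel \<Otimes>\<^sub>M borel) (\<lambda>z :: real \<times> real. snd z \<in> {0..fst z})"
    "Measurable.pred (borel \<Otimes>\<^sub>M borel) (\<lambda>z :: real \<times> real. fst z \<in> {0..snd z})"
    unfolding atLeastAtMost_iff by measurable
  have [measurable]: "?G \<in> borel_measurable borel"
    by measurable
  have "(\<integral>\<^sup>+x. ?G x \<partial>std_normal) = (\<integral>\<^sup>+x. ennreal (std_normal_density x) * ?G x \<partial>lborel)"
    by (rule nn_integral_density) auto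
  also have "\<dots> = 2 * (\<integral>\<^sup>+x. ennreal (std_normal_density x) * ?G x * indicator {0..} x \<partial>lborel)"
    by (rule nn_integral_even) (auto simp: normal_density_def)
  also have "(\<integral>\<^sup>+x. ennreal (std_normal_density x) * ?G x * indicator {0..} x \<partial>lborel)
     = (\<integral>\<^sup>+x. \<integral>\<^sup>+y. ennreal (k * (\<psi> (y\<^sup>2) * exp (- y\<^sup>2 / 2) * y) * indicator {0..y} x) \<partial>lborel \<partial>lborel)"
  proof (rule nn_integral_cong)
    fix x :: real
    show "ennreal (std_normal_density x) * ?G x * indicator {0..} x
      = (\<integral>\<^sup>+y. ennreal (k * (\<psi> (y\<^sup>2) * exp (- y\<^sup>2 / 2) * y) * indicator {0..y} x) \<partial>lborel)"
    proof (cases "x \<ge> 0")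
      case True
      have "ennreal (std_normal_density x) * ?G x =
        (\<integral>\<^sup>+y. ennreal (std_normal_density x) * ennreal (exp (x\<^sup>2 / 2) * (\<psi> (y\<^sup>2) * exp (- y\<^sup>2 / 2) * y) * indicator {x..} y) \<partial>lborel)"
        unfolding inner[OF True] by (rule nn_integral_cmult[symmetric]) auto
      also have "\<dots> = (\<integral>\<^sup>+y. ennreal (k * (\<psi> (y\<^sup>2) * exp (- y\<^sup>2 / 2) * y) * indicator {0..y} x) \<partial>lborel)"
        using True by (intro nn_integral_cong)
          (auto simp: ennreal_mult'[symmetric] normal_density_def k_def indicator_def exp_minus field_simps)
      finally show ?thesis using True by simp
    qed (simp add: indicator_def)
  qed
  also have "\<dots> = (\<integral>\<^sup>+y. \<integral>\<^sup>+x. ennreal (k * (\<psi> (y\<^sup>2) * exp (- y\<^sup>2 / 2) * y) * indicator {0..y} x) \<partial>lborel \<partial>lborel)"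
    by (rule lborel_pair.Fubini') measurable
  also have "\<dots> = (\<integral>\<^sup>+y. ennreal (std_normal_density y * (y\<^sup>2 * \<psi> (y\<^sup>2))) * indicator {0..} y \<partial>lborel)"
  proof (rule nn_integral_cong)
    fix y :: real
    have "(\<integral>\<^sup>+x. ennreal (k * (\<psi> (y\<^sup>2) * exp (- y\<^sup>2 / 2) * y) * indicator {0..y} x) \<partial>lborel)
       = (\<integral>\<^sup>+x. ennreal (k * (\<psi> (y\<^sup>2) * exp (- y\<^sup>2 / 2) * y)) * indicator {0..y} x \<partial>lborel)"
      by (intro nn_integral_cong) (auto simp: indicator_def)
    also have "\<dots> = ennreal (k * (\<psi> (y\<^sup>2) * exp (- y\<^sup>2 / 2) * y)) * ennreal (if 0 \<le> y then y else 0)"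
      by (subst nn_integral_cmult_indicator) auto
    also have "\<dots> = ennreal (std_normal_density y * (y\<^sup>2 * \<psi> (y\<^sup>2))) * indicator {0..} y"
    proof (cases "y \<ge> 0")
      case True
      have "k * (\<psi> (y\<^sup>2) * exp (- y\<^sup>2 / 2) * y) * y = std_normal_density y * (y\<^sup>2 * \<psi> (y\<^sup>2))"
        by (simp add: normal_density_def k_def power2_eq_square mult_ac)
      then show ?thesis using True by (simp only: if_True ennreal_mult''[symmetric] indicator_simps atLeast_iff mult_1_right)
    qed simp
    finally show "(\<integral>\<^sup>+x. ennreal (k * (\<psi> (y\<^sup>2) * exp (- y\<^sup>2 / 2) * y) * indicator {0..y} x) \<partial>lborel)
       = ennreal (std_normal_density y * (y\<^sup>2 * \<psi> (y\<^sup>2))) * indicator {0..} y" .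
  qed
  also have "2 * \<dots> = (\<integral>\<^sup>+y. ennreal (std_normal_density y * (y\<^sup>2 * \<psi> (y\<^sup>2))) \<partial>lborel)"
    by (rule nn_integral_even[symmetric]) (auto simp: normal_density_def)
  also have "\<dots> = (\<integral>\<^sup>+x. ennreal (x\<^sup>2 * \<psi> (x\<^sup>2)) \<partial>std_normal)"
    by (subst nn_integral_density) (auto simp: ennreal_mult'[symmetric])
  finally show ?thesis ..
qed

section \<open>Powers of the absolute value and dominated limits\<close>

lemma continuous_on_integral_dominated:
  fixes f :: "'x :: metric_space \<Rightarrow> 'a \<Rightarrow> real"
  assumes cont: "\<And>\<omega>. \<omega> \<in> space M \<Longrightarrow> continuous_on S (\<lambda>x. f x \<omega>)"
    and meas: "\<And>x. x \<in> S \<Longrightarrow> f x \<in> borel_measurable M"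
    and bound: "\<And>x \<omega>. x \<in> S \<Longrightarrow> \<omega> \<in> space M \<Longrightarrow> \<bar>f x \<omega>\<bar> \<le> B \<omega>"
    and int: "integrable M B"
  shows "continuous_on S (\<lambda>x. \<integral>\<omega>. f x \<omega> \<partial>M)"
  unfolding continuous_on_sequentially comp_def
proof (intro allI ballI impI, elim conjE)
  fix u a assume u: "\<forall>n. u n \<in> S" and a: "a \<in> S" and lim: "u \<longlonglongrightarrow> a"
  show "(\<lambda>n. \<integral>\<omega>. f (u n) \<omega> \<partial>M) \<longlonglongrightarrow> (\<integral>\<omega>. f a \<omega> \<partial>M)"
  proof (rule integral_dominated_convergence[where w = B])
    show "AE \<omega> in M. (\<lambda>n. f (u n) \<omega>) \<longlonglongrightarrow> f a \<omega>"
      using continuous_on_tendsto_compose[OF cont lim a] u by (intro AE_I2) auto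
  qed (use u a meas bound int in auto)
qed

lemma has_real_derivative_integral_dominated:
  fixes f f' :: "real \<Rightarrow> 'a \<Rightarrow> real"
  assumes x: "x \<in> {a<..<b}"
    and deriv: "\<And>y \<omega>. y \<in> {a<..<b} \<Longrightarrow> \<omega> \<in> space M \<Longrightarrow> ((\<lambda>y. f y \<omega>) has_real_derivative f' y \<omega>) (at y)"
    and int: "\<And>y. y \<in> {a<..<b} \<Longrightarrow> integrable M (f y)"
    and meas: "f' x \<in> borel_measurable M"
    and bound: "\<And>y \<omega>. y \<in> {a<..<b} \<Longrightarrow> \<omega> \<in> space M \<Longrightarrow> \<bar>f' y \<omega>\<bar> \<le> B \<omega>"
    and B: "integrable M B"
  shows "((\<lambda>y. \<integral>\<omega>. f y \<omega> \<partial>M) has_real_derivative (\<integral>\<omega>. f' x \<omega> \<partial>M)) (at x)"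
  unfolding DERIV_def tendsto_at_iff_sequentially comp_def
proof (intro allI impI)
  fix X :: "nat \<Rightarrow> real" assume X0: "\<forall>i. X i \<in> UNIV - {0}" and X: "X \<longlonglongrightarrow> 0"
  \<comment> \<open>Difference quotients, replaced by the limit itself while \<open>x + X n\<close>
    is still outside the interval, so that the bound \<open>B\<close> holds for every
    \<open>n\<close> and not just eventually.\<close>
  define s where "s n \<omega> = (if x + X n \<in> {a<..<b} then (f (x + X n) \<omega> - f x \<omega>) / X n else f' x \<omega>)" for n \<omega>
  have "(\<lambda>n. x + X n) \<longlonglongrightarrow> x" using tendsto_add[OF tendsto_const X, of x] by simp
  then have ev: "\<forall>\<^sub>F n in sequentially. x + X n \<in> {a<..<b}"
    using x topological_tendstoD[of "\<lambda>n. x + X n" x sequentially "{a<..<b}"] by auto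
  have "(\<lambda>n. \<integral>\<omega>. s n \<omega> \<partial>M) \<longlonglongrightarrow> (\<integral>\<omega>. f' x \<omega> \<partial>M)"
  proof (rule integral_dominated_convergence[where w = B])
    show "AE \<omega> in M. (\<lambda>n. s n \<omega>) \<longlonglongrightarrow> f' x \<omega>"
    proof (rule AE_I2)
      fix \<omega> assume "\<omega> \<in> space M"
      from deriv[OF x this] have "(\<lambda>n. (f (x + X n) \<omega> - f x \<omega>) / X n) \<longlonglongrightarrow> f' x \<omega>"
        using X0 X unfolding DERIV_def tendsto_at_iff_sequentially comp_def by blast
      then show "(\<lambda>n. s n \<omega>) \<longlonglongrightarrow> f' x \<omega>"
        by (rule Lim_transform_eventually) (use ev in eventually_elim, simp add: s_def)
    qed
    show "AE \<omega> in M. norm (s n \<omega>) \<le> B \<omega>" for n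
    proof (rule AE_I2)
      fix \<omega> assume \<omega>: "\<omega> \<in> space M"
      show "norm (s n \<omega>) \<le> B \<omega>"
      proof (cases "x + X n \<in> {a<..<b}")
        case True
        have "norm (f (x + X n) \<omega> - f x \<omega>) \<le> B \<omega> * norm (x + X n - x)"
          using field_differentiable_bound[of "{a<..<b}" "\<lambda>y. f y \<omega>" "\<lambda>y. f' y \<omega>" "B \<omega>" "x + X n" x]
            deriv bound \<omega> x True by (auto intro: DERIV_subset)
        moreover have "X n \<noteq> 0" using X0 by auto
        ultimately show ?thesis using True by (simp add: s_def field_simps)
      next
        case False
        then have "s n \<omega> = f' x \<omega>" by (simp only: s_def if_False)
        then show ?thesis using bound[OF x \<omega>] by simp
      qed
    qed
    show "s n \<in> borel_measurable M" for n
      unfolding s_def using int[OF x] int[of "x + X n"] meas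
      by (cases "x + X n \<in> {a<..<b}") auto
  qed (use B meas in auto)
  then show "(\<lambda>n. ((\<integral>\<omega>. f (x + X n) \<omega> \<partial>M) - (\<integral>\<omega>. f x \<omega> \<partial>M)) / X n) \<longlonglongrightarrow> (\<integral>\<omega>. f' x \<omega> \<partial>M)"
  proof (rule Lim_transform_eventually)
    show "\<forall>\<^sub>F n in sequentially. (\<integral>\<omega>. s n \<omega> \<partial>M) = ((\<integral>\<omega>. f (x + X n) \<omega> \<partial>M) - (\<integral>\<omega>. f x \<omega> \<partial>M)) / X n"
      using ev
    proof eventually_elim
      case (elim n)
      then show ?case using int[OF x] int[OF elim] by (simp add: s_def)
    qed
  qed
qed

lemma has_real_derivative_abs_powr:
  fixes q x :: real assumes q: "q > 1"
  shows "((\<lambda>x. \<bar>x\<bar> powr q) has_real_derivative q * (sgn x * \<bar>x\<bar> powr (q - 1))) (at x)"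
    and "((\<lambda>x. sgn x * \<bar>x\<bar> powr q) has_real_derivative q * \<bar>x\<bar> powr (q - 1)) (at x)"
proof -
  have pos: "((\<lambda>x. x powr q) has_real_derivative q * y powr (q - 1)) (at y)" if "y > 0" for y
    using that by (auto intro!: derivative_eq_intros)
  have pos': "((\<lambda>x. (- x) powr q) has_real_derivative - (q * (- y) powr (q - 1))) (at y)" if "y < 0" for y
    using that by (auto intro!: derivative_eq_intros)
  \<comment> \<open>The origin is the only delicate point; this covers the even and the odd power at
    once, as the difference quotient is bounded by
    \<open>\<bar>h\<bar> powr (q - 1)\<close>.\<close>
  have zero: "(f has_real_derivative 0) (at 0)" if "\<And>x. \<bar>f x\<bar> = \<bar>x\<bar> powr q" for f :: "real \<Rightarrow> real"
  proof -
    have "((\<lambda>h. \<bar>h\<bar> powr (q - 1)) \<longlongrightarrow> 0) (at 0)"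
      using q by (intro tendsto_eq_intros | simp)+
    then have "((\<lambda>h. (f (0 + h) - f 0) / h) \<longlongrightarrow> 0) (at 0)"
    proof (rule Lim_null_comparison[rotated])
      show "\<forall>\<^sub>F h in at 0. norm ((f (0 + h) - f 0) / h) \<le> \<bar>h\<bar> powr (q - 1)"
      proof (intro always_eventually allI)
        have "f 0 = 0" using that[of 0] by simp
        then show "norm ((f (0 + h) - f 0) / h) \<le> \<bar>h\<bar> powr (q - 1)" for h
          by (cases "h = 0") (auto simp: powr_diff that)
      qed
    qed
    then show ?thesis by (simp add: DERIV_def)
  qed
  consider "x > 0" | "x < 0" | "x = 0" by linarith
  then show "((\<lambda>x. \<bar>x\<bar> powr q) has_real_derivative q * (sgn x * \<bar>x\<bar> powr (q - 1))) (at x)"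
  proof cases
    case 1
    from pos[OF this] show ?thesis
      using 1 by (auto intro: has_field_derivative_transform_within_open[OF _ open_greaterThan[of 0]])
  next
    case 2
    from pos'[OF this] show ?thesis
      using 2 by (auto intro: has_field_derivative_transform_within_open[OF _ open_lessThan[of 0]])
  qed (use zero[of "\<lambda>x. \<bar>x\<bar> powr q"] in auto)
  consider "x > 0" | "x < 0" | "x = 0" by linarith
  then show "((\<lambda>x. sgn x * \<bar>x\<bar> powr q) has_real_derivative q * \<bar>x\<bar> powr (q - 1)) (at x)"
  proof cases
    case 1
    from pos[OF this] show ?thesis
      using 1 by (auto intro: has_field_derivative_transform_within_open[OF _ open_greaterThan[of 0]])
  next
    case 2
    from DERIV_minus[OF pos'[OF this]] show ?thesis
      using 2 by (auto intro: has_field_derivative_transform_within_open[OF _ open_lessThan[of 0]])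
  qed (use q zero[of "\<lambda>x. sgn x * \<bar>x\<bar> powr q"] in \<open>auto simp: abs_mult sgn_if\<close>)
qed

lemma sgn_abs_powr_strict_mono:
  fixes q x y :: real assumes "q > 0" "x < y"
  shows "sgn x * \<bar>x\<bar> powr q < sgn y * \<bar>y\<bar> powr q"
  using assms by (auto simp: sgn_if powr_less_mono2 intro: less_trans[of _ 0])

text \<open>The mean value theorem with a strictly increasing derivative.\<close>

lemma abs_powr_tangent_less:
  fixes q x m :: real assumes q: "q > 1" and "x \<noteq> m"
  shows "\<bar>m\<bar> powr q + q * (sgn m * \<bar>m\<bar> powr (q - 1)) * (x - m) < \<bar>x\<bar> powr q"
proof -
  let ?f = "\<lambda>x. \<bar>x\<bar> powr q" and ?d = "\<lambda>x. q * (sgn x * \<bar>x\<bar> powr (q - 1))"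
  have mono: "?d a < ?d b" if "a < b" for a b
    using sgn_abs_powr_strict_mono[of "q - 1" a b] q that by simp
  consider "x < m" | "m < x" using assms by linarith
  then show ?thesis
  proof cases
    case 1
    obtain z where z: "x < z" "z < m" "?f m - ?f x = (m - x) * ?d z"
      using MVT2[OF 1, of ?f ?d] has_real_derivative_abs_powr(1)[OF q] by blast
    have "(m - x) * ?d z < (m - x) * ?d m" using 1 by (intro mult_strict_left_mono[OF mono[OF z(2)]]) auto
    then show ?thesis using z(3) by (simp add: algebra_simps)
  next
    case 2
    obtain z where z: "m < z" "z < x" "?f x - ?f m = (x - m) * ?d z"
      using MVT2[OF 2, of ?f ?d] has_real_derivative_abs_powr(1)[OF q] by blast
    have "(x - m) * ?d m < (x - m) * ?d z" using 2 by (intro mult_strict_left_mono[OF mono[OF z(1)]]) auto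
    then show ?thesis using z(3) by (simp add: algebra_simps)
  qed
qed

text \<open>Two strict tangent inequalities at the intermediate point \<open>m\<close>; their linear
  terms cancel in the weighted sum.\<close>

lemma abs_powr_strict_convex:
  fixes q x y v :: real assumes q: "q > 1" and "x \<noteq> y" "0 < v" "v < 1"
  shows "\<bar>(1 - v) * x + v * y\<bar> powr q < (1 - v) * \<bar>x\<bar> powr q + v * \<bar>y\<bar> powr q"
proof -
  define m where "m = (1 - v) * x + v * y"
  define d where "d = q * (sgn m * \<bar>m\<bar> powr (q - 1))"
  have xm: "x - m = v * (x - y)" and ym: "y - m = (1 - v) * (y - x)" by (simp_all add: m_def algebra_simps)
  have "(1 - v) * (\<bar>m\<bar> powr q + d * (x - m)) < (1 - v) * \<bar>x\<bar> powr q"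
    unfolding d_def using assms xm by (intro mult_strict_left_mono abs_powr_tangent_less) auto
  moreover have "v * (\<bar>m\<bar> powr q + d * (y - m)) < v * \<bar>y\<bar> powr q"
    unfolding d_def using assms ym by (intro mult_strict_left_mono abs_powr_tangent_less) auto
  moreover have "(1 - v) * (\<bar>m\<bar> powr q + d * (x - m)) + v * (\<bar>m\<bar> powr q + d * (y - m)) = \<bar>m\<bar> powr q"
    unfolding xm ym by (simp add: algebra_simps)
  ultimately show ?thesis by (simp add: m_def[symmetric])
qed

text \<open>Symmetric increments of a convex function grow with the centre, because the derivative
  is increasing. This later compares a point of a ray with its reflection.\<close>

lemma abs_powr_increment_mono:
  fixes q c s t :: real assumes q: "q > 1" and c: "c > 0" and "s \<le> t"
  shows "\<bar>s + c\<bar> powr q - \<bar>s - c\<bar> powr q \<le> \<bar>t + c\<bar> powr q - \<bar>t - c\<bar> powr q"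
proof (rule DERIV_nonneg_imp_nondecreasing[OF \<open>s \<le> t\<close>])
  fix x
  have "sgn (x - c) * \<bar>x - c\<bar> powr (q - 1) \<le> sgn (x + c) * \<bar>x + c\<bar> powr (q - 1)"
    using sgn_abs_powr_strict_mono[of "q - 1" "x - c" "x + c"] q c by simp
  moreover have "((\<lambda>x. \<bar>x + c\<bar> powr q - \<bar>x - c\<bar> powr q) has_real_derivative
      q * (sgn (x + c) * \<bar>x + c\<bar> powr (q - 1)) * 1 - q * (sgn (x - c) * \<bar>x - c\<bar> powr (q - 1)) * 1) (at x)"
    by (intro derivative_intros DERIV_chain'[where g = "\<lambda>x. \<bar>x\<bar> powr q"] has_real_derivative_abs_powr q)
      (auto intro!: derivative_eq_intros)
  ultimately show "\<exists>y. ((\<lambda>x. \<bar>x + c\<bar> powr q - \<bar>x - c\<bar> powr q) has_real_derivative y) (at x) \<and> 0 \<le> y"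
    using q by (intro exI conjI) auto
qed

text \<open>Rounds real exponents up to natural ones, for which integrable envelopes are at hand;
  this is why every envelope is kept at least 1.\<close>

lemma powr_le_power_ceiling:
  fixes x R q :: real assumes "\<bar>x\<bar> \<le> R" "1 \<le> R" "0 \<le> q" "q \<le> real m"
  shows "\<bar>x\<bar> powr q \<le> R ^ m"
proof -
  have "\<bar>x\<bar> powr q \<le> R powr q" using assms by (intro powr_mono2) auto
  also have "\<dots> \<le> R powr real m" using assms by (intro powr_mono) auto
  finally show ?thesis using assms by (simp add: powr_realpow)
qed

section \<open>The Gaussian product space\<close>

text \<open>A measure on functions rather than vectors, so that a single coordinate can be
  overwritten by \<open>fun_upd\<close>; \<open>std_gaussian_eq\<close> links it to the density on
  \<open>real^'n\<close>.\<close>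

definition gauss_prod :: "('k::finite \<Rightarrow> real) measure" where
  "gauss_prod = PiM UNIV (\<lambda>_. std_normal)"

interpretation gauss: prob_space std_normal by (rule prob_space_std_normal)
interpretation gauss_prod: prob_space gauss_prod
  unfolding gauss_prod_def by (rule prob_space_PiM) (rule prob_space_std_normal)

lemma space_gauss_prod [simp]: "space gauss_prod = UNIV"
  by (simp add: gauss_prod_def space_PiM)

lemma sets_gauss_prod [measurable_cong]: "sets gauss_prod = sets (PiM UNIV (\<lambda>_. borel))"
  unfolding gauss_prod_def by (intro sets_PiM_cong) auto

lemma measurable_gauss_prod_component [measurable]: "(\<lambda>w. w i) \<in> borel_measurable gauss_prod"
proof -
  have "(\<lambda>w. w i) \<in> measurable (PiM UNIV (\<lambda>_. borel)) borel"
    by (rule measurable_component_singleton) simp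
  then show ?thesis by (simp cong: measurable_cong_sets[OF sets_gauss_prod refl])
qed

lemma measurable_fun_upd_gauss_prod [measurable]:
  "(\<lambda>(w, x). w(i := x)) \<in> measurable (gauss_prod \<Otimes>\<^sub>M std_normal) gauss_prod"
proof -
  have "(\<lambda>z. (fst z)(i := snd z)) \<in> measurable (gauss_prod \<Otimes>\<^sub>M std_normal) (PiM UNIV (\<lambda>_. borel))"
  proof (rule measurable_PiM_single')
    show "(\<lambda>z. ((fst z)(i := snd z)) j) \<in> borel_measurable (gauss_prod \<Otimes>\<^sub>M std_normal)" for j
      by (cases "j = i") simp_all
  qed auto
  then show ?thesis by (simp add: case_prod_beta' cong: measurable_cong_sets[OF refl sets_gauss_prod])
qed

text \<open>Serves as Fubini for one coordinate without splitting the index type: one-dimensional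
  identities can be applied to a fresh sample at \<open>i\<close> with all other coordinates frozen.
  On a rectangle the old coordinate \<open>i\<close> becomes free and contributes mass 1, while the
  fresh sample contributes the factor of \<open>A i\<close>.\<close>

lemma distr_gauss_prod_resample:
  fixes i :: "'k::finite"
  shows "distr (gauss_prod \<Otimes>\<^sub>M std_normal) gauss_prod (\<lambda>(w, x). w(i := x)) = gauss_prod"
proof -
  interpret product_sigma_finite "\<lambda>_. std_normal" by standard
  have "distr (gauss_prod \<Otimes>\<^sub>M std_normal) gauss_prod (\<lambda>(w, x). w(i := x))
     = PiM UNIV (\<lambda>_. std_normal)"
  proof (rule PiM_eqI)
    fix A :: "'k \<Rightarrow> real set" assume A: "\<And>j. j \<in> UNIV \<Longrightarrow> A j \<in> sets std_normal"
    have AP: "Pi\<^sub>E UNIV B \<in> sets gauss_prod" if "\<And>j. B j \<in> sets std_normal" for B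
      unfolding gauss_prod_def using that by (intro sets_PiM_I_finite) auto
    have vim: "(\<lambda>(w, x). w(i := x)) -` Pi\<^sub>E UNIV A \<inter> space (gauss_prod \<Otimes>\<^sub>M std_normal)
       = Pi\<^sub>E UNIV (A(i := UNIV)) \<times> A i"
      by (auto simp: space_pair_measure PiE_iff split: if_splits) 
    have "distr (gauss_prod \<Otimes>\<^sub>M std_normal) gauss_prod (\<lambda>(w, x). w(i := x)) (Pi\<^sub>E UNIV A)
      = emeasure (gauss_prod \<Otimes>\<^sub>M std_normal) (Pi\<^sub>E UNIV (A(i := UNIV)) \<times> A i)"
      using A AP by (subst emeasure_distr) (auto simp: vim)
    also have "\<dots> = emeasure gauss_prod (Pi\<^sub>E UNIV (A(i := UNIV))) * emeasure std_normal (A i)"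
      using A by (intro gauss.emeasure_pair_measure_Times AP) auto
    also have "emeasure gauss_prod (Pi\<^sub>E UNIV (A(i := UNIV)))
       = (\<Prod>j\<in>UNIV. emeasure std_normal ((A(i := UNIV)) j))"
      unfolding gauss_prod_def using A by (intro emeasure_PiM) auto
    also have "\<dots> = (\<Prod>j\<in>UNIV - {i}. emeasure std_normal (A j))"
      using gauss.emeasure_space_1 by (subst prod.remove[of _ i]) (auto intro!: prod.cong)
    also have "\<dots> * emeasure std_normal (A i) = (\<Prod>j\<in>UNIV. emeasure std_normal (A j))"
      by (subst (2) prod.remove[of _ i]) (auto simp: mult.commute)
    finally show "distr (gauss_prod \<Otimes>\<^sub>M std_normal) gauss_prod (\<lambda>(w, x). w(i := x)) (Pi\<^sub>E UNIV A)
      = (\<Prod>j\<in>UNIV. emeasure std_normal (A j))" .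
  qed (auto simp: gauss_prod_def)
  then show ?thesis by (simp add: gauss_prod_def)
qed

interpretation gauss_pair: pair_sigma_finite gauss_prod std_normal ..

lemma nn_integral_gauss_prod_resample:
  assumes [measurable]: "\<phi> \<in> borel_measurable gauss_prod"
  shows "(\<integral>\<^sup>+w. \<phi> w \<partial>gauss_prod) = (\<integral>\<^sup>+w. \<integral>\<^sup>+x. \<phi> (w(i := x)) \<partial>std_normal \<partial>gauss_prod)"
proof -
  have "(\<integral>\<^sup>+w. \<phi> w \<partial>gauss_prod)
     = (\<integral>\<^sup>+z. \<phi> ((\<lambda>(w, x). w(i := x)) z) \<partial>(gauss_prod \<Otimes>\<^sub>M std_normal))"
    by (subst distr_gauss_prod_resample[of i, symmetric], rule nn_integral_distr) measurable
  also have "\<dots> = (\<integral>\<^sup>+w. \<integral>\<^sup>+x. \<phi> (w(i := x)) \<partial>std_normal \<partial>gauss_prod)"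
    by (subst gauss.nn_integral_fst[symmetric]) auto
  finally show ?thesis .
qed

lemma integral_gauss_prod_resample:
  fixes \<phi> :: "_ \<Rightarrow> real"
  assumes \<phi>: "integrable gauss_prod \<phi>"
  shows "integrable (gauss_prod \<Otimes>\<^sub>M std_normal) (\<lambda>(w, x). \<phi> (w(i := x)))"
    and "(\<integral>w. \<phi> w \<partial>gauss_prod) = (\<integral>w. \<integral>x. \<phi> (w(i := x)) \<partial>std_normal \<partial>gauss_prod)"
proof -
  have [measurable]: "\<phi> \<in> borel_measurable gauss_prod" using \<phi> by auto
  have \<phi>': "integrable (distr (gauss_prod \<Otimes>\<^sub>M std_normal) gauss_prod (\<lambda>(w, x). w(i := x))) \<phi>"
    using \<phi> by (simp add: distr_gauss_prod_resample)
  show *: "integrable (gauss_prod \<Otimes>\<^sub>M std_normal) (\<lambda>(w, x). \<phi> (w(i := x)))"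
    using integrable_distr[OF measurable_fun_upd_gauss_prod \<phi>'] by (simp add: case_prod_beta')
  have "(\<integral>w. \<phi> w \<partial>gauss_prod)
     = (\<integral>z. \<phi> ((\<lambda>(w, x). w(i := x)) z) \<partial>(gauss_prod \<Otimes>\<^sub>M std_normal))"
    by (subst distr_gauss_prod_resample[of i, symmetric], rule integral_distr) measurable
  also have "\<dots> = (\<integral>z. (\<lambda>(w, x). \<phi> (w(i := x))) z \<partial>(gauss_prod \<Otimes>\<^sub>M std_normal))"
    by (simp add: case_prod_beta')
  also have "\<dots> = (\<integral>w. \<integral>x. \<phi> (w(i := x)) \<partial>std_normal \<partial>gauss_prod)"
    using gauss_pair.integral_fst'[OF *] by simp
  finally show "(\<integral>w. \<phi> w \<partial>gauss_prod) = (\<integral>w. \<integral>x. \<phi> (w(i := x)) \<partial>std_normal \<partial>gauss_prod)" .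
qed

lemma integrable_gauss_prod_component:
  fixes f :: "real \<Rightarrow> real" and i :: "'k::finite"
  assumes "integrable std_normal f"
  shows "integrable gauss_prod (\<lambda>w. f (w i))" and "(\<integral>w. f (w i) \<partial>gauss_prod) = (\<integral>x. f x \<partial>std_normal)"
proof -
  have [measurable]: "f \<in> borel_measurable borel" using assms by auto
  have "(\<integral>\<^sup>+w. ennreal (norm (f (w i))) \<partial>gauss_prod) = (\<integral>\<^sup>+w. \<integral>\<^sup>+x. ennreal (norm (f x)) \<partial>std_normal \<partial>(gauss_prod :: ('k \<Rightarrow> real) measure))"
    by (subst nn_integral_gauss_prod_resample[of _ i]) auto
  also have "\<dots> < \<infinity>" using assms by (simp add: integrable_iff_bounded gauss_prod.emeasure_space_1[simplified])
  finally show *: "integrable gauss_prod (\<lambda>w. f (w i))" by (auto simp: integrable_iff_bounded)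
  show "(\<integral>w. f (w i) \<partial>gauss_prod) = (\<integral>x. f x \<partial>std_normal)"
    by (subst integral_gauss_prod_resample[OF *, of i]) (simp add: gauss_prod.prob_space[simplified])
qed

section \<open>Quadratic chaos with a Gaussian coordinate\<close>

text \<open>One distinguished coordinate \<open>z\<close> carries the Gaussian limit \<open>sqrt 2 * g\<close> of sums of many small
  multiples of \<open>g\<^sup>2 - 1\<close>; all coordinates have variance \<open>2\<close>.\<close>

definition chaos_var :: "'k \<Rightarrow> 'k \<Rightarrow> real \<Rightarrow> real" where
  "chaos_var z i x = (if i = z then sqrt 2 * x else x\<^sup>2 - 1)"

text \<open>Half the Stein kernel of X = \<open>chaos_var z i\<close>, evaluated at the Gaussian
  variable: E[X h(X)] is twice the expectation of this weight times h'(X).\<close>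

definition chaos_weight :: "'k \<Rightarrow> 'k \<Rightarrow> real \<Rightarrow> real" where
  "chaos_weight z i x = (if i = z then 1 else x\<^sup>2)"

definition chaos_sum :: "'k::finite \<Rightarrow> real^'k \<Rightarrow> ('k \<Rightarrow> real) \<Rightarrow> real" where
  "chaos_sum z l w = (\<Sum>i\<in>UNIV. l $ i * chaos_var z i (w i))"

text \<open>One envelope for all dominated-convergence arguments: it is at least 1, has moments of
  every order, and dominates each variable, each weight and each \<open>chaos_sum\<close> whose
  coefficients are at most 1 in absolute value.\<close>

definition chaos_bound :: "('k::finite \<Rightarrow> real) \<Rightarrow> real" where
  "chaos_bound w = (\<Sum>i\<in>UNIV. 1 + (w i)\<^sup>2)"

lemma measurable_chaos [measurable]:
  "chaos_var z i \<in> borel_measurable borel" "chaos_weight z i \<in> borel_measurable borel"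
  "chaos_sum z l \<in> borel_measurable gauss_prod" "chaos_bound \<in> borel_measurable gauss_prod"
proof -
  show m: "chaos_var z i \<in> borel_measurable borel" "chaos_weight z i \<in> borel_measurable borel" for i
    unfolding chaos_var_def chaos_weight_def by measurable
  show "chaos_sum z l \<in> borel_measurable gauss_prod" "chaos_bound \<in> borel_measurable gauss_prod"
    unfolding chaos_sum_def[abs_def] chaos_bound_def[abs_def] using m by measurable
qed

lemma abs_chaos_var_le: "\<bar>chaos_var z i x\<bar> \<le> 1 + x\<^sup>2"
proof -
  have "0 \<le> (\<bar>x\<bar> - 1)\<^sup>2" by simp
  then have "2 * \<bar>x\<bar> \<le> 1 + x\<^sup>2" by (simp add: power2_diff)
  moreover have "sqrt 2 * \<bar>x\<bar> \<le> 2 * \<bar>x\<bar>" by (intro mult_right_mono) (auto simp: real_le_lsqrt real_sqrt_le_iff sqrt2_less_2 less_imp_le)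
  moreover have "\<bar>x\<^sup>2 - 1\<bar> \<le> 1 + x\<^sup>2" by (simp add: abs_le_iff)
  ultimately show ?thesis by (auto simp: chaos_var_def abs_mult)
qed

lemma chaos_weight_le: "0 \<le> chaos_weight z i x" "chaos_weight z i x \<le> 1 + x\<^sup>2"
  by (auto simp: chaos_weight_def)

lemma one_plus_square_le_chaos_bound: "1 + (w i)\<^sup>2 \<le> chaos_bound w"
  unfolding chaos_bound_def by (rule member_le_sum) auto

lemma one_le_chaos_bound: "1 \<le> chaos_bound w"
  using one_plus_square_le_chaos_bound[of w undefined] zero_le_power2[of "w undefined"] by linarith

lemma abs_chaos_sum_le:
  assumes "\<And>i. \<bar>l $ i\<bar> \<le> c"
  shows "\<bar>chaos_sum z l w\<bar> \<le> c * chaos_bound w"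
proof -
  have "\<bar>chaos_sum z l w\<bar> \<le> (\<Sum>i\<in>UNIV. \<bar>l $ i\<bar> * \<bar>chaos_var z i (w i)\<bar>)"
    unfolding chaos_sum_def by (rule order_trans[OF sum_abs]) (simp add: abs_mult)
  also have "\<dots> \<le> (\<Sum>i\<in>UNIV. c * (1 + (w i)\<^sup>2))"
    using assms by (intro sum_mono mult_mono abs_chaos_var_le) (auto intro: order_trans[OF abs_ge_zero])
  finally show ?thesis by (simp add: chaos_bound_def sum_distrib_left)
qed

text \<open>The sum is at most \<open>CARD('k)\<close> times its largest term, and the power of the
  largest term is bounded by the sum of all the powers, which are integrable one coordinate at a
  time.\<close>

lemma integrable_chaos_bound_power: "integrable (gauss_prod :: ('k::finite \<Rightarrow> real) measure) (\<lambda>w. chaos_bound w ^ m)"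
proof (rule Bochner_Integration.integrable_bound)
  show "integrable (gauss_prod :: ('k \<Rightarrow> real) measure) (\<lambda>w. \<Sum>i\<in>UNIV. real CARD('k) ^ m * (1 + (w i)\<^sup>2) ^ m)"
    by (intro Bochner_Integration.integrable_sum integrable_mult_right
        integrable_gauss_prod_component(1)[OF integrable_std_normal_one_plus_square_power])
  have *: "chaos_bound w ^ m \<le> (\<Sum>i\<in>UNIV. real CARD('k) ^ m * (1 + (w i)\<^sup>2) ^ m)" for w :: "'k \<Rightarrow> real"
  proof -
    define a where "a i = 1 + (w i)\<^sup>2" for i
    have "Max (range a) \<in> range a" by (rule Max_in) auto
    then obtain k where k: "Max (range a) = a k" by (rule rangeE)
    have j: "a i \<le> a k" for i unfolding k[symmetric] by (rule Max_ge) auto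
    have "chaos_bound w \<le> real CARD('k) * a k"
      unfolding chaos_bound_def a_def[symmetric] using j by (intro sum_bounded_above[THEN order_trans]) auto
    moreover have "0 \<le> chaos_bound w" using one_le_chaos_bound[of w] by simp
    ultimately have "chaos_bound w ^ m \<le> (real CARD('k) * a k) ^ m" by (rule power_mono)
    also have "\<dots> = real CARD('k) ^ m * a k ^ m" by (rule power_mult_distrib)
    also have "\<dots> \<le> (\<Sum>i\<in>UNIV. real CARD('k) ^ m * a i ^ m)"
      by (rule member_le_sum) (auto simp: a_def)
    finally show ?thesis by (simp add: a_def)
  qed
  show "AE w in (gauss_prod :: ('k \<Rightarrow> real) measure). norm (chaos_bound w ^ m) \<le> norm (\<Sum>i\<in>UNIV. real CARD('k) ^ m * (1 + (w i)\<^sup>2) ^ m)"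
  proof (intro AE_I2)
    fix w :: "'k \<Rightarrow> real"
    have "\<bar>chaos_bound w\<bar> = chaos_bound w" using one_le_chaos_bound[of w] by simp
    then show "norm (chaos_bound w ^ m) \<le> norm (\<Sum>i\<in>UNIV. real CARD('k) ^ m * (1 + (w i)\<^sup>2) ^ m)"
      using *[of w] by (simp add: power_abs)
  qed
qed measurable

lemma integrable_chaos_bounded:
  fixes \<phi> :: "('k::finite \<Rightarrow> real) \<Rightarrow> real"
  assumes "\<phi> \<in> borel_measurable gauss_prod" "\<And>w. \<bar>\<phi> w\<bar> \<le> C * chaos_bound w ^ m"
  shows "integrable gauss_prod \<phi>"
proof (rule Bochner_Integration.integrable_bound[OF integrable_mult_right[OF integrable_chaos_bound_power[of m], of C]])
  show "AE w in gauss_prod. norm (\<phi> w) \<le> norm (C * chaos_bound w ^ m)"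
    using assms(2) by (intro AE_I2) (auto intro: order_trans[OF _ abs_ge_self])
qed (use assms in auto)

lemma chaos_sum_fun_upd:
  "chaos_sum z l (w(i := x)) = l $ i * chaos_var z i x + (\<Sum>j\<in>UNIV - {i}. l $ j * chaos_var z j (w j))"
  unfolding chaos_sum_def by (subst sum.remove[of _ i]) (auto intro!: sum.cong)

lemma std_normal_chaos_by_parts:
  fixes q l c :: real assumes q: "q > 1"
  shows "(\<integral>x. chaos_var z i x * (sgn (l * chaos_var z i x + c) * \<bar>l * chaos_var z i x + c\<bar> powr q) \<partial>std_normal)
     = 2 * l * q * (\<integral>x. chaos_weight z i x * \<bar>l * chaos_var z i x + c\<bar> powr (q - 1) \<partial>std_normal)"
proof -
  define Y where "Y x = l * chaos_var z i x + c" for x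
  define h where "h y = sgn y * \<bar>y\<bar> powr q" for y :: real
  define h' where "h' y = q * \<bar>y\<bar> powr (q - 1)" for y :: real
  \<comment> \<open>Chosen so that \<open>Y x\<close> is bounded by
    \<open>K * (1 + x\<^sup>2)\<close>, and at least 1 so that exponents may be rounded up to
    \<open>m\<close>.\<close>
  define K where "K = \<bar>l\<bar> + \<bar>c\<bar> + 1"
  define m where "m = nat \<lceil>q\<rceil>"
  have m: "q \<le> real m" unfolding m_def using q by linarith
  have K: "K \<ge> 1" by (simp add: K_def)
  have "\<bar>Y x\<bar> \<le> \<bar>l\<bar> * (1 + x\<^sup>2) + \<bar>c\<bar> * (1 + x\<^sup>2)" for x
    unfolding Y_def using abs_chaos_var_le[of z i x]
    by (intro order_trans[OF abs_triangle_ineq] add_mono) (auto simp: abs_mult intro: mult_left_mono order_trans[OF _ mult_left_mono[of 1]])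
  then have Yb: "\<bar>Y x\<bar> \<le> K * (1 + x\<^sup>2)" for x
    by (rule order_trans) (auto simp: K_def algebra_simps)
  have K1: "1 \<le> K * (1 + x\<^sup>2)" for x using mult_mono[of 1 K 1 "1 + x\<^sup>2"] K by auto
  have hb: "\<bar>h (Y x)\<bar> \<le> K ^ m * (1 + x\<^sup>2) ^ m" for x
  proof -
    have "\<bar>h (Y x)\<bar> \<le> \<bar>Y x\<bar> powr q" by (auto simp: h_def abs_mult sgn_if)
    also have "\<dots> \<le> (K * (1 + x\<^sup>2)) ^ m" using powr_le_power_ceiling[OF Yb K1 _ m] q by simp
    finally show ?thesis by (simp add: power_mult_distrib)
  qed
  have hb1: "\<bar>h' (Y x)\<bar> \<le> q * K ^ m * (1 + x\<^sup>2) ^ m" for x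
  proof -
    have "\<bar>Y x\<bar> powr (q - 1) \<le> (K * (1 + x\<^sup>2)) ^ m" using powr_le_power_ceiling[OF Yb K1, of "q - 1" m] q m by simp
    then have "q * \<bar>Y x\<bar> powr (q - 1) \<le> q * (K * (1 + x\<^sup>2)) ^ m" using q by (intro mult_left_mono) auto
    then show ?thesis using q by (simp add: power_mult_distrib h'_def abs_mult)
  qed
  have dY: "(Y has_real_derivative l * (if i = z then sqrt 2 else 2 * x)) (at x)" for x
    unfolding Y_def chaos_var_def by (auto intro!: derivative_eq_intros)
  have dh: "(h has_real_derivative h' y) (at y)" for y
    unfolding h_def h'_def by (rule has_real_derivative_abs_powr(2)[OF q])
  have dhY: "((\<lambda>x. h (Y x)) has_real_derivative h' (Y x) * (l * (if i = z then sqrt 2 else 2 * x))) (at x)" for x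
    using DERIV_chain'[OF dY dh] by (simp add: mult.commute)
  have contY: "continuous_on UNIV Y"
    using dY by (meson DERIV_isCont continuous_at_imp_continuous_on)
  have conth: "continuous_on UNIV (\<lambda>x. h (Y x))"
    using dhY by (meson DERIV_isCont continuous_at_imp_continuous_on)
  have conth': "continuous_on UNIV (\<lambda>x. h' (Y x))"
    unfolding h'_def using q by (intro continuous_on_mult_left continuous_on_powr' continuous_intros contY) auto
  have [measurable]: "Y \<in> borel_measurable borel" "(\<lambda>x. h (Y x)) \<in> borel_measurable borel" "(\<lambda>x. h' (Y x)) \<in> borel_measurable borel"
    using contY conth conth' by (auto intro: borel_measurable_continuous_onI)
  have int: "integrable std_normal \<phi>"
    if [measurable]: "\<phi> \<in> borel_measurable borel" and "\<And>x. \<bar>\<phi> x\<bar> \<le> C * (1 + x\<^sup>2) ^ k" for \<phi> :: "real \<Rightarrow> real" and C k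
  proof (rule Bochner_Integration.integrable_bound[OF integrable_mult_right[OF integrable_std_normal_one_plus_square_power[of k], of C]])
    show "AE x in std_normal. norm (\<phi> x) \<le> norm (C * (1 + x\<^sup>2) ^ k)"
      using that(2) by (intro AE_I2) (auto intro: order_trans[OF _ abs_ge_self])
  qed simp
  have x1: "\<bar>x\<bar> \<le> 1 + x\<^sup>2" and s2: "sqrt 2 \<le> 2 * (1 + x\<^sup>2)" for x :: real
  proof -
    have "0 \<le> (\<bar>x\<bar> - 1)\<^sup>2" by simp
    then show "\<bar>x\<bar> \<le> 1 + x\<^sup>2" using abs_ge_zero[of x] by (simp add: power2_diff)
    show "sqrt 2 \<le> 2 * (1 + x\<^sup>2)" by (rule order_trans[OF less_imp_le[OF sqrt2_less_2]]) simp
  qed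
  have up: "a * (1 + x\<^sup>2) ^ m \<le> a * (1 + x\<^sup>2) ^ Suc m" if "a \<ge> 0" for a x :: real
    using that by (intro mult_left_mono power_increasing) auto
  \<comment> \<open>Generous enough to bound both the function and its derivative in either case
    below.\<close>
  define C where "C = 2 * K ^ m + 4 * \<bar>l\<bar> * (q * K ^ m)"
  have main: "(\<integral>x. chaos_var z i x * h (Y x) \<partial>std_normal)
     = 2 * l * (\<integral>x. chaos_weight z i x * h' (Y x) \<partial>std_normal)"
  proof (cases "i = z")
    case True
    have "(\<integral>x. x * (sqrt 2 * h (Y x)) \<partial>std_normal)
      = (\<integral>x. sqrt 2 * (h' (Y x) * (l * sqrt 2)) \<partial>std_normal)"
    proof (rule std_normal_integral_by_parts[where C = C and m = m])
      show "((\<lambda>x. sqrt 2 * h (Y x)) has_real_derivative sqrt 2 * (h' (Y x) * (l * sqrt 2))) (at x)" for x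
        using DERIV_cmult[OF dhY, of "sqrt 2"] True by simp
      show "continuous_on UNIV (\<lambda>x. sqrt 2 * (h' (Y x) * (l * sqrt 2)))"
        by (intro continuous_intros conth')
      fix x
      have "\<bar>sqrt 2 * h (Y x)\<bar> \<le> 2 * (K ^ m * (1 + x\<^sup>2) ^ m)"
        unfolding abs_mult using hb[of x] sqrt2_less_2 by (intro mult_mono) auto
      also have "\<dots> \<le> C * (1 + x\<^sup>2) ^ m" using K q by (simp add: C_def mult_right_mono algebra_simps)
      finally show "\<bar>sqrt 2 * h (Y x)\<bar> \<le> C * (1 + x\<^sup>2) ^ m" .
      have "\<bar>sqrt 2 * (h' (Y x) * (l * sqrt 2))\<bar> = 2 * \<bar>l\<bar> * \<bar>h' (Y x)\<bar>"
        by (simp add: abs_mult mult_ac)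
      also have "\<dots> \<le> 2 * \<bar>l\<bar> * (q * K ^ m * (1 + x\<^sup>2) ^ m)" by (intro mult_left_mono hb1) auto
      also have "\<dots> \<le> C * (1 + x\<^sup>2) ^ m" using K q by (simp add: C_def algebra_simps)
      finally show "\<bar>sqrt 2 * (h' (Y x) * (l * sqrt 2))\<bar> \<le> C * (1 + x\<^sup>2) ^ m" .
    qed
    then show ?thesis using True by (simp add: chaos_var_def chaos_weight_def mult_ac)
  next
    case False
    have b1: "\<bar>h (Y x)\<bar> \<le> C * (1 + x\<^sup>2) ^ Suc m" for x
    proof -
      have "\<bar>h (Y x)\<bar> \<le> K ^ m * (1 + x\<^sup>2) ^ Suc m" using order_trans[OF hb up] K by simp
      also have "\<dots> \<le> C * (1 + x\<^sup>2) ^ Suc m" using K q by (intro mult_right_mono) (auto simp: C_def)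
      finally show ?thesis .
    qed
    have b2: "\<bar>x\<^sup>2 * h' (Y x)\<bar> \<le> q * K ^ m * (1 + x\<^sup>2) ^ Suc m" for x
      using mult_mono[of "\<bar>x\<^sup>2\<bar>" "1 + x\<^sup>2" "\<bar>h' (Y x)\<bar>", OF _ hb1] by (simp add: abs_mult mult_ac)
    have b3: "\<bar>x * h (Y x)\<bar> \<le> K ^ m * (1 + x\<^sup>2) ^ Suc m" for x
      using mult_mono[OF x1 hb, of x x] by (simp add: abs_mult mult_ac)
    have i1: "integrable std_normal (\<lambda>x. h (Y x))" by (rule int[OF _ hb]) simp
    have i2: "integrable std_normal (\<lambda>x. x\<^sup>2 * h' (Y x))" by (rule int[OF _ b2]) simp
    have i3: "integrable std_normal (\<lambda>x. x\<^sup>2 * h (Y x))"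
    proof (rule int)
      show "\<bar>x\<^sup>2 * h (Y x)\<bar> \<le> K ^ m * (1 + x\<^sup>2) ^ Suc m" for x
        using mult_mono[of "\<bar>x\<^sup>2\<bar>" "1 + x\<^sup>2" "\<bar>h (Y x)\<bar>", OF _ hb] by (simp add: abs_mult mult_ac)
    qed simp
    have "(\<integral>x. x * (x * h (Y x)) \<partial>std_normal)
      = (\<integral>x. h (Y x) + 2 * l * (x\<^sup>2 * h' (Y x)) \<partial>std_normal)"
    proof (rule std_normal_integral_by_parts[where C = C and m = "Suc m"])
      show "((\<lambda>x. x * h (Y x)) has_real_derivative h (Y x) + 2 * l * (x\<^sup>2 * h' (Y x))) (at x)" for x
        using DERIV_mult[OF DERIV_ident dhY, of x] False by (simp add: power2_eq_square algebra_simps)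
      show "continuous_on UNIV (\<lambda>x. h (Y x) + 2 * l * (x\<^sup>2 * h' (Y x)))"
        by (intro continuous_intros conth conth')
      fix x
      have "K ^ m \<le> C" using K q by (simp add: C_def)
      then show "\<bar>x * h (Y x)\<bar> \<le> C * (1 + x\<^sup>2) ^ Suc m"
        by (intro order_trans[OF b3] mult_right_mono) auto
      have "\<bar>h (Y x) + 2 * l * (x\<^sup>2 * h' (Y x))\<bar> \<le> \<bar>h (Y x)\<bar> + 2 * \<bar>l\<bar> * \<bar>x\<^sup>2 * h' (Y x)\<bar>"
        by (rule order_trans[OF abs_triangle_ineq]) (simp add: abs_mult)
      also have "\<dots> \<le> K ^ m * (1 + x\<^sup>2) ^ Suc m + 2 * \<bar>l\<bar> * (q * K ^ m * (1 + x\<^sup>2) ^ Suc m)"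
        using K by (intro add_mono mult_left_mono b2 order_trans[OF hb up]) auto
      also have "\<dots> = (K ^ m + 2 * \<bar>l\<bar> * (q * K ^ m)) * (1 + x\<^sup>2) ^ Suc m" by (simp only: distrib_right mult.assoc)
      also have "\<dots> \<le> C * (1 + x\<^sup>2) ^ Suc m" using K q by (intro mult_right_mono) (auto simp: C_def)
      finally show "\<bar>h (Y x) + 2 * l * (x\<^sup>2 * h' (Y x))\<bar> \<le> C * (1 + x\<^sup>2) ^ Suc m" .
    qed
    then have "(\<integral>x. x\<^sup>2 * h (Y x) \<partial>std_normal)
      = (\<integral>x. h (Y x) \<partial>std_normal) + 2 * l * (\<integral>x. x\<^sup>2 * h' (Y x) \<partial>std_normal)"
      using i1 i2 by (simp add: power2_eq_square mult.assoc)
    moreover have "(\<integral>x. (x\<^sup>2 - 1) * h (Y x) \<partial>std_normal)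
      = (\<integral>x. x\<^sup>2 * h (Y x) \<partial>std_normal) - (\<integral>x. h (Y x) \<partial>std_normal)"
      using i1 i3 by (simp add: left_diff_distrib)
    ultimately show ?thesis using False by (simp add: chaos_var_def chaos_weight_def)
  qed
  have "(\<integral>x. chaos_weight z i x * h' (Y x) \<partial>std_normal)
    = q * (\<integral>x. chaos_weight z i x * \<bar>Y x\<bar> powr (q - 1) \<partial>std_normal)"
    unfolding h'_def by (simp add: mult.left_commute[of _ q])
  with main show ?thesis unfolding h_def Y_def by simp
qed

section \<open>Moments of the chaos and their derivatives along paths of coefficients\<close>

definition chaos_moment :: "real \<Rightarrow> 'k::finite \<Rightarrow> real^'k \<Rightarrow> real" where
  "chaos_moment p z l = (\<integral>w. \<bar>chaos_sum z l w\<bar> powr p \<partial>gauss_prod)"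

definition chaos_weighted :: "real \<Rightarrow> 'k::finite \<Rightarrow> 'k \<Rightarrow> real^'k \<Rightarrow> real" where
  "chaos_weighted r z i l = (\<integral>w. chaos_weight z i (w i) * \<bar>chaos_sum z l w\<bar> powr r \<partial>gauss_prod)"

lemma abs_chaos_sum_powr_le:
  assumes "\<And>i. \<bar>l $ i\<bar> \<le> 1" "0 \<le> q" "q \<le> real m"
  shows "\<bar>chaos_sum z l w\<bar> powr q \<le> chaos_bound w ^ m"
  using powr_le_power_ceiling[OF _ one_le_chaos_bound assms(2,3)] abs_chaos_sum_le[of l 1 z w] assms(1) by simp

lemma chaos_bound_power_mult:
  assumes "\<bar>a\<bar> \<le> C * chaos_bound w" "\<bar>b\<bar> \<le> chaos_bound w ^ m"
  shows "\<bar>a * b\<bar> \<le> C * chaos_bound w ^ Suc m"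
  using mult_mono[OF assms] assms(1) by (simp add: abs_mult mult_ac order_trans[OF abs_ge_zero])

lemma abs_chaos_var_le_bound: "\<bar>chaos_var z i (w i)\<bar> \<le> 1 * chaos_bound w"
  using abs_chaos_var_le[of z i "w i"] one_plus_square_le_chaos_bound[of w i] by simp

lemma abs_chaos_weight_le_bound: "\<bar>chaos_weight z i (w i)\<bar> \<le> 1 * chaos_bound w"
  using chaos_weight_le[of z i "w i"] one_plus_square_le_chaos_bound[of w i] by simp

lemma chaos_integrable:
  assumes l: "\<And>i. \<bar>l $ i\<bar> \<le> 1" and q: "0 \<le> q"
  shows "integrable gauss_prod (\<lambda>w. \<bar>chaos_sum z l w\<bar> powr q)"
    and "integrable gauss_prod (\<lambda>w. chaos_weight z i (w i) * \<bar>chaos_sum z l w\<bar> powr q)"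
    and "integrable gauss_prod (\<lambda>w. chaos_var z i (w i) * (sgn (chaos_sum z l w) * \<bar>chaos_sum z l w\<bar> powr q))"
proof -
  obtain m :: nat where m: "q \<le> real m" using real_arch_simple by blast
  note b = abs_chaos_sum_powr_le[OF l q m, of z]
  show "integrable gauss_prod (\<lambda>w. \<bar>chaos_sum z l w\<bar> powr q)"
    by (rule integrable_chaos_bounded[of _ 1 m]) (use b in auto)
  show "integrable gauss_prod (\<lambda>w. chaos_weight z i (w i) * \<bar>chaos_sum z l w\<bar> powr q)"
    by (rule integrable_chaos_bounded[of _ 1 "Suc m"], measurable,
        rule chaos_bound_power_mult[OF abs_chaos_weight_le_bound]) (use b in auto)
  have "\<bar>sgn (chaos_sum z l w) * \<bar>chaos_sum z l w\<bar> powr q\<bar> \<le> chaos_bound w ^ m" for w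
    using b[of w] by (auto simp: abs_mult sgn_if)
  then show "integrable gauss_prod (\<lambda>w. chaos_var z i (w i) * (sgn (chaos_sum z l w) * \<bar>chaos_sum z l w\<bar> powr q))"
    by (intro integrable_chaos_bounded[of _ 1 "Suc m"] chaos_bound_power_mult[OF abs_chaos_var_le_bound]) measurable
qed

text \<open>The one-dimensional identity is applied to a resampled coordinate \<open>i\<close>, and
  resampling is then undone on the right-hand side.\<close>

lemma chaos_by_parts:
  assumes l: "\<And>i. \<bar>l $ i\<bar> \<le> 1" and q: "q > 1"
  shows "(\<integral>w. chaos_var z i (w i) * (sgn (chaos_sum z l w) * \<bar>chaos_sum z l w\<bar> powr q) \<partial>gauss_prod)
    = 2 * (l $ i) * q * chaos_weighted (q - 1) z i l"
proof -
  have i1: "integrable gauss_prod (\<lambda>w. chaos_var z i (w i) * (sgn (chaos_sum z l w) * \<bar>chaos_sum z l w\<bar> powr q))"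
    and i2: "integrable gauss_prod (\<lambda>w. chaos_weight z i (w i) * \<bar>chaos_sum z l w\<bar> powr (q - 1))"
    using q by (auto intro!: chaos_integrable l)
  have "(\<integral>w. chaos_var z i (w i) * (sgn (chaos_sum z l w) * \<bar>chaos_sum z l w\<bar> powr q) \<partial>gauss_prod)
     = (\<integral>w. 2 * (l $ i) * q * (\<integral>x. chaos_weight z i x * \<bar>chaos_sum z l (w(i := x))\<bar> powr (q - 1) \<partial>std_normal) \<partial>gauss_prod)"
    by (subst integral_gauss_prod_resample(2)[OF i1, of i])
      (simp only: chaos_sum_fun_upd std_normal_chaos_by_parts[OF q] fun_upd_same)
  also have "\<dots> = 2 * (l $ i) * q * chaos_weighted (q - 1) z i l"
    unfolding chaos_weighted_def
    by (subst integral_gauss_prod_resample(2)[OF i2, of i]) simp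
  finally show ?thesis .
qed

lemma chaos_sum_path_derivative:
  assumes "\<And>i. ((\<lambda>t. \<gamma> t $ i) has_real_derivative \<gamma>' i) (at t)"
  shows "((\<lambda>t. chaos_sum z (\<gamma> t) w) has_real_derivative (\<Sum>i\<in>UNIV. \<gamma>' i * chaos_var z i (w i))) (at t)"
  unfolding chaos_sum_def by (intro DERIV_sum DERIV_cmult_right assms)

text \<open>Differentiation under the integral gives p E[sgn(S) |S|^(p-1) S'] with S' a linear
  combination of the variables; integration by parts in each of them produces the coefficient and
  lowers the exponent to \<open>p - 2\<close>. The latter needs \<open>p - 1 > 1\<close>.\<close>

lemma chaos_moment_path_derivative:
  fixes \<gamma> :: "real \<Rightarrow> real^'k::finite" and \<gamma>' :: "real \<Rightarrow> 'k \<Rightarrow> real"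
  assumes p: "p > 2" and t: "t \<in> {a<..<b}"
    and le1: "\<And>t i. t \<in> {a<..<b} \<Longrightarrow> \<bar>\<gamma> t $ i\<bar> \<le> 1"
    and deriv: "\<And>t i. t \<in> {a<..<b} \<Longrightarrow> ((\<lambda>t. \<gamma> t $ i) has_real_derivative \<gamma>' t i) (at t)"
    and bound: "\<And>t i. t \<in> {a<..<b} \<Longrightarrow> \<bar>\<gamma>' t i\<bar> \<le> D"
  shows "((\<lambda>t. chaos_moment p z (\<gamma> t)) has_real_derivative
    p * (p - 1) * (\<Sum>i\<in>UNIV. 2 * (\<gamma> t $ i) * \<gamma>' t i * chaos_weighted (p - 2) z i (\<gamma> t))) (at t)"
proof -
  define S where "S t w = chaos_sum z (\<gamma> t) w" for t w
  define f' where "f' t w = p * (sgn (S t w) * \<bar>S t w\<bar> powr (p - 1)) * (\<Sum>i\<in>UNIV. \<gamma>' t i * chaos_var z i (w i))" for t w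
  obtain m :: nat where m: "p \<le> real m" using real_arch_simple by blast
  have [measurable]: "S t \<in> borel_measurable gauss_prod" for t
    unfolding S_def by measurable
  have "((\<lambda>t. chaos_moment p z (\<gamma> t)) has_real_derivative (\<integral>w. f' t w \<partial>gauss_prod)) (at t)"
    unfolding chaos_moment_def S_def[symmetric]
  proof (rule has_real_derivative_integral_dominated[OF t, where B = "\<lambda>w. p * D * chaos_bound w ^ Suc m"])
    fix y w assume y: "y \<in> {a<..<b}"
    have "((\<lambda>y. S y w) has_real_derivative (\<Sum>i\<in>UNIV. \<gamma>' y i * chaos_var z i (w i))) (at y)"
      unfolding S_def by (rule chaos_sum_path_derivative[OF deriv[OF y]])
    from DERIV_chain'[OF this has_real_derivative_abs_powr(1)] p
    show "((\<lambda>y. \<bar>S y w\<bar> powr p) has_real_derivative f' y w) (at y)"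
      by (simp add: f'_def mult_ac)
    have 1: "\<bar>\<Sum>i\<in>UNIV. \<gamma>' y i * chaos_var z i (w i)\<bar> \<le> D * chaos_bound w"
      using abs_chaos_sum_le[of "\<chi> i. \<gamma>' y i" D z w] bound[OF y] by (simp add: chaos_sum_def)
    have 2: "\<bar>sgn (S y w) * \<bar>S y w\<bar> powr (p - 1)\<bar> \<le> chaos_bound w ^ m"
      using abs_chaos_sum_powr_le[OF le1[OF y], of "p - 1" m z w] p m by (auto simp: S_def abs_mult sgn_if)
    have "\<bar>f' y w\<bar> = p * \<bar>(\<Sum>i\<in>UNIV. \<gamma>' y i * chaos_var z i (w i)) * (sgn (S y w) * \<bar>S y w\<bar> powr (p - 1))\<bar>"
      using p by (simp add: f'_def abs_mult mult_ac)
    also have "\<dots> \<le> p * (D * chaos_bound w ^ Suc m)"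
      using p by (intro mult_left_mono chaos_bound_power_mult[OF 1 2]) auto
    finally show "\<bar>f' y w\<bar> \<le> p * D * chaos_bound w ^ Suc m" by (simp add: mult_ac)
  next
    fix y assume y: "y \<in> {a<..<b}"
    show "integrable gauss_prod (\<lambda>w. \<bar>S y w\<bar> powr p)"
      unfolding S_def using le1[OF y] p by (intro chaos_integrable) auto
  next
    show "f' t \<in> borel_measurable gauss_prod" unfolding f'_def by measurable
    show "integrable gauss_prod (\<lambda>w. p * D * chaos_bound w ^ Suc m)"
      by (intro integrable_mult_right integrable_chaos_bound_power)
  qed
  also have "(\<integral>w. f' t w \<partial>gauss_prod) = (\<integral>w. (\<Sum>i\<in>UNIV. p * \<gamma>' t i * (chaos_var z i (w i) * (sgn (S t w) * \<bar>S t w\<bar> powr (p - 1)))) \<partial>gauss_prod)"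
    unfolding f'_def sum_distrib_left by (intro Bochner_Integration.integral_cong sum.cong) (auto simp: mult_ac)
  also have "\<dots> = (\<Sum>i\<in>UNIV. p * \<gamma>' t i * (\<integral>w. chaos_var z i (w i) * (sgn (S t w) * \<bar>S t w\<bar> powr (p - 1)) \<partial>gauss_prod))"
    unfolding S_def using chaos_integrable(3)[OF le1[OF t], of "p - 1" z] p
    by (subst Bochner_Integration.integral_sum) auto
  also have "\<dots> = (\<Sum>i\<in>UNIV. p * \<gamma>' t i * (2 * (\<gamma> t $ i) * (p - 1) * chaos_weighted (p - 2) z i (\<gamma> t)))"
    unfolding S_def using chaos_by_parts[OF le1[OF t], of "p - 1" z] p by simp
  also have "\<dots> = p * (p - 1) * (\<Sum>i\<in>UNIV. 2 * (\<gamma> t $ i) * \<gamma>' t i * chaos_weighted (p - 2) z i (\<gamma> t))"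
    unfolding sum_distrib_left by (intro sum.cong) (auto simp: mult_ac)
  finally show ?thesis .
qed

lemma continuous_on_chaos_sum [continuous_intros]:
  "continuous_on A L \<Longrightarrow> continuous_on A (\<lambda>x. chaos_sum z (L x) w)"
  unfolding chaos_sum_def by (intro continuous_intros)

lemma continuous_on_chaos_moment:
  fixes L :: "'x::metric_space \<Rightarrow> real^'k::finite"
  assumes "continuous_on A L" and "\<And>x i. x \<in> A \<Longrightarrow> \<bar>L x $ i\<bar> \<le> 1" and "q > 0"
  shows "continuous_on A (\<lambda>x. chaos_moment q z (L x))"
proof -
  obtain m :: nat where m: "q \<le> real m" using real_arch_simple by blast
  show ?thesis unfolding chaos_moment_def
  proof (rule continuous_on_integral_dominated[where B = "\<lambda>w. chaos_bound w ^ m"])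
    show "continuous_on A (\<lambda>x. \<bar>chaos_sum z (L x) w\<bar> powr q)" for w
      using assms by (intro continuous_on_powr' continuous_intros) auto
    show "\<bar>\<bar>chaos_sum z (L x) w\<bar> powr q\<bar> \<le> chaos_bound w ^ m" if "x \<in> A" for x w
      using abs_chaos_sum_powr_le[OF assms(2)[OF that] _ m] assms(3) by simp
  qed (auto intro: integrable_chaos_bound_power)
qed

lemma continuous_on_chaos_weighted:
  fixes L :: "'x::metric_space \<Rightarrow> real^'k::finite"
  assumes "continuous_on A L" and "\<And>x i. x \<in> A \<Longrightarrow> \<bar>L x $ i\<bar> \<le> 1" and "q > 0"
  shows "continuous_on A (\<lambda>x. chaos_weighted q z i (L x))"
proof -
  obtain m :: nat where m: "q \<le> real m" using real_arch_simple by blast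
  show ?thesis unfolding chaos_weighted_def
  proof (rule continuous_on_integral_dominated[where B = "\<lambda>w. 1 * chaos_bound w ^ Suc m"])
    show "continuous_on A (\<lambda>x. chaos_weight z i (w i) * \<bar>chaos_sum z (L x) w\<bar> powr q)" for w
      using assms by (intro continuous_on_mult_left continuous_on_powr' continuous_intros) auto
    show "\<bar>chaos_weight z i (w i) * \<bar>chaos_sum z (L x) w\<bar> powr q\<bar> \<le> 1 * chaos_bound w ^ Suc m" if "x \<in> A" for x w
      using abs_chaos_sum_powr_le[OF assms(2)[OF that] _ m] assms(3)
      by (intro chaos_bound_power_mult[OF abs_chaos_weight_le_bound]) auto
  qed (auto intro: integrable_chaos_bound_power simp del: power_Suc)
qed

text \<open>Moving \<open>c i\<close> units of squared length per unit of time into coordinate \<open>i\<close> changes the moment at the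
  rate \<open>p (p - 1) \<Sum>i. c i * chaos_weighted (p - 2) z i\<close>; the signs \<open>s\<close> matter where \<open>l\<close> vanishes.\<close>

definition transport :: "('k \<Rightarrow> real) \<Rightarrow> ('k \<Rightarrow> real) \<Rightarrow> real^'k \<Rightarrow> real \<Rightarrow> real^'k" where
  "transport s c l t = (\<chi> i. s i * sqrt ((l $ i)\<^sup>2 + c i * t))"

lemma transport_0: "(\<And>i. s i * \<bar>l $ i\<bar> = l $ i) \<Longrightarrow> transport s c l 0 = l"
  by (simp add: transport_def vec_eq_iff)

lemma norm_transport:
  assumes "\<And>i. \<bar>s i\<bar> = 1" "sum c UNIV = 0" "\<And>i. (l $ i)\<^sup>2 + c i * t \<ge> 0"
  shows "norm (transport s c l t) = norm l"
proof -
  have "(s i * sqrt ((l $ i)\<^sup>2 + c i * t))\<^sup>2 = (l $ i)\<^sup>2 + c i * t" for i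
    using assms(1)[of i] assms(3)[of i] by (simp add: power_mult_distrib power2_eq_1_iff abs_if split: if_splits)
  then have "(norm (transport s c l t))\<^sup>2 = (\<Sum>i\<in>UNIV. (l $ i)\<^sup>2 + c i * t)"
    by (simp add: norm_vec_def L2_set_def transport_def sum_nonneg assms(3))
  also have "\<dots> = (\<Sum>i\<in>UNIV. (l $ i)\<^sup>2)" using assms(2) by (simp add: sum.distrib sum_distrib_right[symmetric])
  also have "\<dots> = (norm l)\<^sup>2" by (simp add: norm_vec_def L2_set_def sum_nonneg)
  finally show ?thesis by simp
qed

lemma continuous_on_transport: "continuous_on A (transport s c l)"
  unfolding transport_def by (intro continuous_intros continuous_on_vec_lambda)

lemma abs_component_le_1: "norm (l :: real^'k) = 1 \<Longrightarrow> \<bar>l $ i\<bar> \<le> 1"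
  using component_le_norm_cart[of l i] by simp

text \<open>A coordinate that starts at 0 moves like a square root, so the path need not be
  differentiable at time 0. The moment is therefore differentiated only at interior times and
  continuity handles the ends; this is also why \<open>gain\<close> is asked for positive times
  only, which lets a tie at time 0 be broken later.\<close>

lemma chaos_moment_transport_less:
  fixes l :: "real^'k::finite"
  assumes p: "p > 2" and l: "norm l = 1" and s: "\<And>i. \<bar>s i\<bar> = 1" "\<And>i. s i * \<bar>l $ i\<bar> = l $ i"
    and c: "sum c UNIV = 0" and d: "d > 0"
    and pos: "\<And>i t. c i \<noteq> 0 \<Longrightarrow> 0 < t \<Longrightarrow> t \<le> d \<Longrightarrow> (l $ i)\<^sup>2 + c i * t > 0"
    and gain: "\<And>t. 0 < t \<Longrightarrow> t < d \<Longrightarrow> (\<Sum>i\<in>UNIV. c i * chaos_weighted (p - 2) z i (transport s c l t)) > 0"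
  shows "chaos_moment p z l < chaos_moment p z (transport s c l d)"
proof -
  let ?\<gamma> = "transport s c l"
  define \<gamma>' where "\<gamma>' t i = s i * (c i / (2 * sqrt ((l $ i)\<^sup>2 + c i * t)))" for t i
  have nonneg: "(l $ i)\<^sup>2 + c i * t \<ge> 0" if "0 \<le> t" "t \<le> d" for i t
    using pos[of i t] that by (cases "c i = 0"; cases "t = 0") auto
  have n1: "norm (?\<gamma> t) = 1" if "0 \<le> t" "t \<le> d" for t
    using norm_transport[OF s(1) c nonneg[OF that]] l by simp
  have "chaos_moment p z (?\<gamma> 0) < chaos_moment p z (?\<gamma> d)"
  proof (rule DERIV_pos_imp_increasing_open[OF d])
    show "continuous_on {0..d} (\<lambda>t. chaos_moment p z (?\<gamma> t))"
      using n1 p by (intro continuous_on_chaos_moment continuous_on_transport abs_component_le_1) auto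
    fix t assume t: "0 < t" "t < d"
    \<comment> \<open>A compact neighbourhood of \<open>t\<close> away from time 0, on which the
      velocities are bounded, as differentiation under the integral requires.\<close>
    define a b where "a = t / 2" and "b = (t + d) / 2"
    have ab: "0 < a" "a < t" "t < b" "b < d" using t by (auto simp: a_def b_def)
    have dpos: "(l $ i)\<^sup>2 + c i * y > 0" if "c i \<noteq> 0" "y \<in> {a..b}" for i y
      using pos[OF that(1)] that(2) ab by auto
    have "\<exists>D. \<forall>y\<in>{a..b}. \<bar>\<gamma>' y i\<bar> \<le> D" for i
    proof (cases "c i = 0")
      case False
      have "continuous_on {a..b} (\<lambda>y. \<gamma>' y i)"
        unfolding \<gamma>'_def using dpos[OF False] by (intro continuous_intros) (auto simp: less_imp_neq[THEN not_sym])
      then have "bounded ((\<lambda>y. \<gamma>' y i) ` {a..b})"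
        by (intro compact_imp_bounded compact_continuous_image) auto
      then show ?thesis by (auto simp: bounded_iff)
    qed (auto simp: \<gamma>'_def intro: exI[of _ 0])
    then obtain D where D: "\<And>i y. y \<in> {a..b} \<Longrightarrow> \<bar>\<gamma>' y i\<bar> \<le> D i" by metis
    have Ds: "\<bar>\<gamma>' y i\<bar> \<le> (\<Sum>i\<in>UNIV. D i)" if "y \<in> {a..b}" for y i
    proof -
      have "D i \<le> (\<Sum>i\<in>UNIV. D i)"
        using order_trans[OF abs_ge_zero D[OF that]] by (intro member_le_sum) auto
      with D[OF that, of i] show ?thesis by linarith
    qed
    \<comment> \<open>The left side is the derivative of the squared coordinate, so the coefficient
      left by integration by parts disappears.\<close>
    have sq: "2 * (?\<gamma> t $ i) * \<gamma>' t i = c i" for i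
    proof (cases "c i = 0")
      case False
      have "s i * s i = 1" using s(1)[of i] by (metis abs_mult_self_eq mult_1)
      then show ?thesis using dpos[OF False, of t] ab by (simp add: transport_def \<gamma>'_def field_simps)
    qed (simp add: \<gamma>'_def)
    have "((\<lambda>t. chaos_moment p z (?\<gamma> t)) has_real_derivative
      p * (p - 1) * (\<Sum>i\<in>UNIV. 2 * (?\<gamma> t $ i) * \<gamma>' t i * chaos_weighted (p - 2) z i (?\<gamma> t))) (at t)"
    proof (rule chaos_moment_path_derivative[OF p, where a = a and b = b])
      fix y i assume y: "y \<in> {a<..<b}"
      show "\<bar>?\<gamma> y $ i\<bar> \<le> 1" using y ab by (intro abs_component_le_1 n1) auto
      show "((\<lambda>t. ?\<gamma> t $ i) has_real_derivative \<gamma>' y i) (at y)"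
      proof (cases "c i = 0")
        case False
        then show ?thesis unfolding transport_def \<gamma>'_def vec_lambda_beta
          using dpos[OF False, of y] y by (auto intro!: derivative_eq_intros simp: field_simps)
      qed (simp add: transport_def \<gamma>'_def)
      show "\<bar>\<gamma>' y i\<bar> \<le> (\<Sum>i\<in>UNIV. D i)" using y by (intro Ds) auto
    qed (use ab in auto)
    then show "\<exists>y. ((\<lambda>t. chaos_moment p z (?\<gamma> t)) has_real_derivative y) (at t) \<and> 0 < y"
      using gain[OF t] p unfolding sq
      by (intro exI[of _ "p * (p - 1) * (\<Sum>i\<in>UNIV. c i * chaos_weighted (p - 2) z i (?\<gamma> t))"] conjI) simp_all
  qed
  then show ?thesis using transport_0[OF s(2)] by simp
qed

section \<open>Strict convexity in an exponential shift\<close>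

abbreviation std_exponential :: "real measure" where
  "std_exponential \<equiv> density lborel (\<lambda>x. ennreal (exponential_density 1 x))"

interpretation expo: prob_space std_exponential
  by (rule prob_space_exponential_density) simp

interpretation gauss_expo: pair_prob_space gauss_prod std_exponential ..

text \<open>The shift \<open>t\<close> is decoupled from the coefficients \<open>l\<close>, so that
  for a fixed law of the sum all coordinates are compared through one function of a real
  variable.\<close>

definition chaos_shifted :: "real \<Rightarrow> 'k::finite \<Rightarrow> real^'k \<Rightarrow> real \<Rightarrow> real" where
  "chaos_shifted r z l t = (\<integral>x. \<bar>chaos_sum z l (fst x) + 2 * t * snd x\<bar> powr r \<partial>(gauss_prod \<Otimes>\<^sub>M std_exponential))"

lemma integrable_std_exponential_power:
  "integrable std_exponential (\<lambda>e. (1 + 2 * \<bar>e\<bar>) ^ m)"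
proof -
  have "integrable std_exponential (\<lambda>e. \<bar>e\<bar> ^ k)" for k
  proof (rule integrableI_bounded)
    have "(\<integral>\<^sup>+e. ennreal (norm (\<bar>e\<bar> ^ k)) \<partial>std_exponential)
        = (\<integral>\<^sup>+e. ennreal (erlang_density 0 1 e * e ^ k) \<partial>lborel)"
      by (subst nn_integral_density)
        (auto simp: ennreal_mult'[symmetric] exponential_density_def erlang_density_def intro!: nn_integral_cong)
    also have "\<dots> < \<infinity>" by (subst nn_integral_erlang_ith_moment) auto
    finally show "(\<integral>\<^sup>+e. ennreal (norm (\<bar>e\<bar> ^ k)) \<partial>std_exponential) < \<infinity>" .
  qed simp
  then show ?thesis
    by (subst add.commute, subst binomial_ring)
      (auto intro!: Bochner_Integration.integrable_sum integrable_mult_right simp: power_mult_distrib)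
qed

lemma integrable_gauss_expo_bound:
  "integrable (gauss_prod \<Otimes>\<^sub>M std_exponential) (\<lambda>x. chaos_bound (fst x) ^ m * (1 + 2 * \<bar>snd x\<bar>) ^ m)"
proof (rule gauss_expo.Fubini_integrable)
  have "chaos_bound w \<ge> 0" for w :: "'a \<Rightarrow> real" using one_le_chaos_bound[of w] by simp
  then show "integrable gauss_prod (\<lambda>x. \<integral>y. norm (chaos_bound (fst (x, y)) ^ m * (1 + 2 * \<bar>snd (x, y)\<bar>) ^ m) \<partial>std_exponential)"
    by (simp add: abs_mult integrable_chaos_bound_power)
  show "AE x in gauss_prod. integrable std_exponential (\<lambda>y. chaos_bound (fst (x, y)) ^ m * (1 + 2 * \<bar>snd (x, y)\<bar>) ^ m)"
    by (simp add: integrable_std_exponential_power)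
qed measurable

lemma chaos_shifted_integrand_le:
  assumes "\<And>i. \<bar>l $ i\<bar> \<le> 1" "\<bar>t\<bar> \<le> 1" "0 \<le> r" "r \<le> real m"
  shows "\<bar>chaos_sum z l w + 2 * t * e\<bar> powr r \<le> chaos_bound w ^ m * (1 + 2 * \<bar>e\<bar>) ^ m"
proof -
  have B: "1 \<le> chaos_bound w" by (rule one_le_chaos_bound)
  have "\<bar>t\<bar> * \<bar>e\<bar> \<le> 1 * \<bar>e\<bar>" by (rule mult_right_mono) (use assms in auto)
  also have "\<dots> \<le> chaos_bound w * \<bar>e\<bar>" using B by (intro mult_right_mono) auto
  finally have te: "\<bar>t * e\<bar> \<le> chaos_bound w * \<bar>e\<bar>" by (simp add: abs_mult)
  have "\<bar>chaos_sum z l w\<bar> \<le> chaos_bound w" using abs_chaos_sum_le[of l 1 z w] assms(1) by simp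
  then have "\<bar>chaos_sum z l w + 2 * t * e\<bar> \<le> chaos_bound w + 2 * (chaos_bound w * \<bar>e\<bar>)"
    using te abs_triangle_ineq[of "chaos_sum z l w" "2 * (t * e)"] by (simp add: abs_mult mult.assoc)
  then have "\<bar>chaos_sum z l w + 2 * t * e\<bar> \<le> chaos_bound w * (1 + 2 * \<bar>e\<bar>)"
    by (simp add: algebra_simps)
  moreover have "1 \<le> chaos_bound w * (1 + 2 * \<bar>e\<bar>)"
    using mult_mono[of 1 "chaos_bound w" 1 "1 + 2 * \<bar>e\<bar>"] B by auto
  ultimately show ?thesis
    unfolding power_mult_distrib[symmetric] by (intro powr_le_power_ceiling assms(3,4))
qed

lemma chaos_shifted_integrable:
  assumes "\<And>i. \<bar>l $ i\<bar> \<le> 1" "\<bar>t\<bar> \<le> 1" "0 \<le> r"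
  shows "integrable (gauss_prod \<Otimes>\<^sub>M std_exponential) (\<lambda>x. \<bar>chaos_sum z l (fst x) + 2 * t * snd x\<bar> powr r)"
proof -
  obtain m :: nat where m: "r \<le> real m" using real_arch_simple by blast
  show ?thesis
    by (rule Bochner_Integration.integrable_bound[OF integrable_gauss_expo_bound[of m]])
      (use chaos_shifted_integrand_le[OF assms m] in \<open>auto intro!: AE_I2 order_trans[OF _ abs_ge_self]\<close>)
qed

lemma chaos_shifted_0:
  assumes "\<And>i. \<bar>l $ i\<bar> \<le> 1" "0 \<le> r"
  shows "chaos_shifted r z l 0 = chaos_weighted r z z l"
proof -
  have "chaos_shifted r z l 0 = (\<integral>w. \<integral>e. \<bar>chaos_sum z l w\<bar> powr r \<partial>std_exponential \<partial>gauss_prod)"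
    unfolding chaos_shifted_def
    using gauss_expo.integral_fst'[OF chaos_shifted_integrable[OF assms(1) _ assms(2), of 0 z]] by simp
  then show ?thesis using expo.prob_space by (simp add: chaos_weighted_def chaos_weight_def)
qed

text \<open>Resample coordinate \<open>i\<close> and size-bias its square: replacing x^2 by x^2 + 2e
  turns the sum into itself plus \<open>2 * (l $ i) * e\<close>, after which the resampling is
  undone. Nonnegative integrals make every exchange of order free of integrability
  conditions.\<close>

lemma chaos_weighted_eq_shifted:
  assumes l: "\<And>i. \<bar>l $ i\<bar> \<le> 1" and r: "0 \<le> r" and i: "i \<noteq> z"
  shows "chaos_weighted r z i l = chaos_shifted r z l (l $ i)"
proof -
  define c where "c w = (\<Sum>j\<in>UNIV - {i}. l $ j * chaos_var z j (w j))" for w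
  have upd: "chaos_sum z l (w(i := x)) = l $ i * (x\<^sup>2 - 1) + c w" for w x
    using i by (simp add: chaos_sum_fun_upd c_def chaos_var_def)
  have [measurable]: "(\<lambda>w. chaos_weight z i (w i)) \<in> borel_measurable gauss_prod" by measurable
  have "(\<integral>\<^sup>+w. ennreal (chaos_weight z i (w i) * \<bar>chaos_sum z l w\<bar> powr r) \<partial>gauss_prod)
     = (\<integral>\<^sup>+w. \<integral>\<^sup>+x. ennreal (x\<^sup>2 * \<bar>l $ i * (x\<^sup>2 - 1) + c w\<bar> powr r) \<partial>std_normal \<partial>gauss_prod)"
    by (subst nn_integral_gauss_prod_resample[of _ i]) (use i in \<open>simp_all add: upd chaos_weight_def\<close>)
  also have "\<dots> = (\<integral>\<^sup>+w. \<integral>\<^sup>+x. \<integral>\<^sup>+e. ennreal (\<bar>l $ i * ((x\<^sup>2 + 2 * e) - 1) + c w\<bar> powr r) \<partial>std_exponential \<partial>std_normal \<partial>gauss_prod)"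
    by (intro nn_integral_cong std_normal_square_size_bias[of "\<lambda>t. \<bar>l $ i * (t - 1) + _\<bar> powr r"]) auto
  also have "\<dots> = (\<integral>\<^sup>+w. \<integral>\<^sup>+x. \<integral>\<^sup>+e. ennreal (\<bar>chaos_sum z l (w(i := x)) + 2 * (l $ i) * e\<bar> powr r) \<partial>std_exponential \<partial>std_normal \<partial>gauss_prod)"
    by (intro nn_integral_cong arg_cong[where f = ennreal] arg_cong[where f = "\<lambda>x. \<bar>x\<bar> powr r"]) (simp add: upd algebra_simps)
  also have "\<dots> = (\<integral>\<^sup>+w. \<integral>\<^sup>+e. ennreal (\<bar>chaos_sum z l w + 2 * (l $ i) * e\<bar> powr r) \<partial>std_exponential \<partial>gauss_prod)"
    by (rule nn_integral_gauss_prod_resample[symmetric]) measurable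
  also have "\<dots> = (\<integral>\<^sup>+x. ennreal (\<bar>chaos_sum z l (fst x) + 2 * (l $ i) * snd x\<bar> powr r) \<partial>(gauss_prod \<Otimes>\<^sub>M std_exponential))"
    by (subst expo.nn_integral_fst[symmetric]) auto
  finally have "(\<integral>\<^sup>+w. ennreal (chaos_weight z i (w i) * \<bar>chaos_sum z l w\<bar> powr r) \<partial>gauss_prod)
     = (\<integral>\<^sup>+x. ennreal (\<bar>chaos_sum z l (fst x) + 2 * (l $ i) * snd x\<bar> powr r) \<partial>(gauss_prod \<Otimes>\<^sub>M std_exponential))" .
  then show ?thesis
    unfolding chaos_weighted_def chaos_shifted_def
    by (subst (1 2) integral_eq_nn_integral) (auto simp: chaos_weight_le(1))
qed

lemma AE_std_exponential_nonzero: "AE x in gauss_prod \<Otimes>\<^sub>M std_exponential. snd x \<noteq> 0"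
proof (rule gauss_expo.AE_pair_measure)
  have "AE e in std_exponential. e \<noteq> 0"
    by (subst AE_density) (simp, rule AE_mp[OF AE_lborel_singleton[of "0 :: real"]], simp)
  then show "AE x in gauss_prod. AE y in std_exponential. snd (x, y) \<noteq> 0" by simp
qed measurable

text \<open>The integrand is a strictly convex function of an affine function of the shift with
  slope twice the exponential variable, and that variable is almost surely nonzero.\<close>

lemma chaos_shifted_strict_convex:
  assumes l: "\<And>i. \<bar>l $ i\<bar> \<le> 1" and t: "\<bar>s\<bar> \<le> 1" "\<bar>t\<bar> \<le> 1" "s \<noteq> t" and v: "0 < v" "v < 1" and r: "r > 1"
  shows "chaos_shifted r z l ((1 - v) * s + v * t) < (1 - v) * chaos_shifted r z l s + v * chaos_shifted r z l t"
proof -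
  let ?P = "gauss_prod \<Otimes>\<^sub>M std_exponential"
  define g where "g t x = \<bar>chaos_sum z l (fst x) + 2 * t * snd x\<bar> powr r" for t x
  have int: "integrable ?P (g u)" if "\<bar>u\<bar> \<le> 1" for u
    unfolding g_def using r by (intro chaos_shifted_integrable l that) auto
  have u: "\<bar>(1 - v) * s + v * t\<bar> \<le> 1"
  proof -
    have "\<bar>(1 - v) * s + v * t\<bar> \<le> (1 - v) * \<bar>s\<bar> + v * \<bar>t\<bar>"
      using v by (intro order_trans[OF abs_triangle_ineq]) (simp add: abs_mult)
    also have "\<dots> \<le> (1 - v) * 1 + v * 1" using v t by (intro add_mono mult_left_mono) auto
    finally show ?thesis by simp
  qed
  have less: "g ((1 - v) * s + v * t) x < (1 - v) * g s x + v * g t x" if "snd x \<noteq> 0" for x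
  proof -
    have eq: "chaos_sum z l (fst x) + 2 * ((1 - v) * s + v * t) * snd x
      = (1 - v) * (chaos_sum z l (fst x) + 2 * s * snd x) + v * (chaos_sum z l (fst x) + 2 * t * snd x)"
      by (simp add: algebra_simps)
    have "chaos_sum z l (fst x) + 2 * s * snd x \<noteq> chaos_sum z l (fst x) + 2 * t * snd x"
      using that t(3) by simp
    from abs_powr_strict_convex[OF r this v] show ?thesis unfolding g_def eq .
  qed
  have "(\<integral>x. g ((1 - v) * s + v * t) x \<partial>?P) < (\<integral>x. (1 - v) * g s x + v * g t x \<partial>?P)"
  proof (rule gauss_expo.integral_less_AE_space)
    show "integrable ?P (g ((1 - v) * s + v * t))" by (rule int[OF u])
    show "integrable ?P (\<lambda>x. (1 - v) * g s x + v * g t x)" using int t by auto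
    show "AE x in ?P. g ((1 - v) * s + v * t) x < (1 - v) * g s x + v * g t x"
      using AE_std_exponential_nonzero by eventually_elim (rule less)
    show "emeasure ?P (space ?P) \<noteq> 0" by (simp add: gauss_expo.emeasure_space_1)
  qed
  also have "\<dots> = (1 - v) * (\<integral>x. g s x \<partial>?P) + v * (\<integral>x. g t x \<partial>?P)"
    using int t by simp
  finally show ?thesis unfolding chaos_shifted_def g_def .
qed

text \<open>Coefficients and shift vary together, so that a strict inequality between values at two
  shifts survives along a short path.\<close>

lemma continuous_on_chaos_shifted:
  fixes L :: "'x::metric_space \<Rightarrow> real^'k::finite"
  assumes "continuous_on A L" "continuous_on A T" and "\<And>x i. x \<in> A \<Longrightarrow> \<bar>L x $ i\<bar> \<le> 1" "\<And>x. x \<in> A \<Longrightarrow> \<bar>T x\<bar> \<le> 1" and "r > 0"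
  shows "continuous_on A (\<lambda>x. chaos_shifted r z (L x) (T x))"
proof -
  obtain m :: nat where m: "r \<le> real m" using real_arch_simple by blast
  show ?thesis unfolding chaos_shifted_def
  proof (rule continuous_on_integral_dominated[OF _ _ _ integrable_gauss_expo_bound[of m]])
    show "continuous_on A (\<lambda>x. \<bar>chaos_sum z (L x) (fst w) + 2 * T x * snd w\<bar> powr r)" for w
      using assms by (intro continuous_on_powr' continuous_intros) auto
    show "\<bar>\<bar>chaos_sum z (L x) (fst w) + 2 * T x * snd w\<bar> powr r\<bar> \<le> chaos_bound (fst w) ^ m * (1 + 2 * \<bar>snd w\<bar>) ^ m" if "x \<in> A" for x w
      using chaos_shifted_integrand_le[OF assms(3)[OF that] assms(4)[OF that] _ m] assms(5) by simp
  qed measurable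
qed

section \<open>Two coefficients of opposite sign\<close>

text \<open>Polar coordinates with slope in place of angle: y = x s has Jacobian |x|, and after
  exchanging the integrals t = x^2 absorbs that Jacobian.\<close>

lemma nn_integral_slope_coordinates:
  fixes \<phi> :: "real \<Rightarrow> real \<Rightarrow> real"
  assumes [measurable]: "case_prod \<phi> \<in> borel_measurable (borel \<Otimes>\<^sub>M borel)"
  shows "(\<integral>\<^sup>+x. \<integral>\<^sup>+y. ennreal (\<phi> (x\<^sup>2) (y\<^sup>2)) \<partial>lborel \<partial>lborel)
     = (\<integral>\<^sup>+s. \<integral>\<^sup>+t. ennreal (\<phi> t (t * s\<^sup>2) * indicator {0..} t) \<partial>lborel \<partial>lborel)"
proof -
  have "(\<integral>\<^sup>+x. \<integral>\<^sup>+y. ennreal (\<phi> (x\<^sup>2) (y\<^sup>2)) \<partial>lborel \<partial>lborel)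
     = (\<integral>\<^sup>+x. \<integral>\<^sup>+s. ennreal (\<bar>x\<bar> * \<phi> (x\<^sup>2) (x\<^sup>2 * s\<^sup>2)) \<partial>lborel \<partial>lborel)"
  proof (intro nn_integral_cong_AE AE_I[of _ _ "{0}"], safe)
    fix x :: real
    assume "(\<integral>\<^sup>+y. ennreal (\<phi> (x\<^sup>2) (y\<^sup>2)) \<partial>lborel) \<noteq> (\<integral>\<^sup>+s. ennreal (\<bar>x\<bar> * \<phi> (x\<^sup>2) (x\<^sup>2 * s\<^sup>2)) \<partial>lborel)"
    moreover have "(\<integral>\<^sup>+y. ennreal (\<phi> (x\<^sup>2) (y\<^sup>2)) \<partial>lborel) = (\<integral>\<^sup>+s. ennreal (\<bar>x\<bar> * \<phi> (x\<^sup>2) (x\<^sup>2 * s\<^sup>2)) \<partial>lborel)"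
      if "x \<noteq> 0"
      by (subst nn_integral_real_affine[where c = x and t = 0])
        (use that in \<open>auto simp: nn_integral_cmult_ennreal power_mult_distrib\<close>)
    ultimately show "x = 0" by blast
  qed auto
  also have "\<dots> = (\<integral>\<^sup>+s. \<integral>\<^sup>+x. ennreal (\<bar>x\<bar> * \<phi> (x\<^sup>2) (x\<^sup>2 * s\<^sup>2)) \<partial>lborel \<partial>lborel)"
    by (rule lborel_pair.Fubini') measurable
  also have "\<dots> = (\<integral>\<^sup>+s. \<integral>\<^sup>+t. ennreal (\<phi> t (t * s\<^sup>2) * indicator {0..} t) \<partial>lborel \<partial>lborel)"
  proof (rule nn_integral_cong)
    fix s :: real
    have "(\<integral>\<^sup>+x. ennreal (\<bar>x\<bar> * \<phi> (x\<^sup>2) (x\<^sup>2 * s\<^sup>2)) \<partial>lborel)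
      = 2 * (\<integral>\<^sup>+x. ennreal (\<bar>x\<bar> * \<phi> (x\<^sup>2) (x\<^sup>2 * s\<^sup>2)) * indicator {0..} x \<partial>lborel)"
      by (rule nn_integral_even) auto
    also have "\<dots> = (\<integral>\<^sup>+x. 2 * (ennreal (\<bar>x\<bar> * \<phi> (x\<^sup>2) (x\<^sup>2 * s\<^sup>2)) * indicator {0..} x) \<partial>lborel)"
      by (rule nn_integral_cmult[symmetric]) auto
    also have "\<dots> = (\<integral>\<^sup>+x. ennreal (\<phi> (x\<^sup>2) (x\<^sup>2 * s\<^sup>2) * (2 * x) * indicator {0..} x) \<partial>lborel)"
    proof (rule nn_integral_cong)
      fix x :: real
      have "2 * ennreal (x * y) = ennreal (y * (2 * x))" for y
        by (simp add: ennreal_mult'[of 2, simplified, symmetric] mult_ac)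
      then show "2 * (ennreal (\<bar>x\<bar> * \<phi> (x\<^sup>2) (x\<^sup>2 * s\<^sup>2)) * indicator {0..} x) = ennreal (\<phi> (x\<^sup>2) (x\<^sup>2 * s\<^sup>2) * (2 * x) * indicator {0..} x)"
        by (simp add: indicator_def)
    qed
    also have "\<dots> = (\<integral>\<^sup>+t. ennreal (\<phi> t (t * s\<^sup>2) * indicator {0..} t) \<partial>lborel)"
      by (rule nn_integral_square_substitution[of "\<lambda>t. \<phi> t (t * s\<^sup>2)"]) measurable
    finally show "(\<integral>\<^sup>+x. ennreal (\<bar>x\<bar> * \<phi> (x\<^sup>2) (x\<^sup>2 * s\<^sup>2)) \<partial>lborel) = (\<integral>\<^sup>+t. ennreal (\<phi> t (t * s\<^sup>2) * indicator {0..} t) \<partial>lborel)" .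
  qed
  finally show ?thesis .
qed

text \<open>Up to a common factor these are the values of \<open>m * exp (- m / 2)\<close> at the
  mirror points \<open>2 - 2 * h\<close> and \<open>2 + 2 * h\<close>. The difference vanishes at 0
  and has a nonnegative derivative.\<close>

lemma one_plus_exp_reflection:
  fixes h :: real assumes "0 \<le> h"
  shows "(1 - h) * exp h \<le> (1 + h) * exp (- h)"
proof -
  have "(\<lambda>h. (1 + h) * exp (- h) - (1 - h) * exp h) 0 \<le> (\<lambda>h. (1 + h) * exp (- h) - (1 - h) * exp h) h"
  proof (rule DERIV_nonneg_imp_nondecreasing[OF assms])
    fix x :: real assume x: "0 \<le> x" "x \<le> h"
    have "((\<lambda>h. (1 + h) * exp (- h) - (1 - h) * exp h) has_real_derivative x * (exp x - exp (- x))) (at x)"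
      by (auto intro!: derivative_eq_intros simp: algebra_simps)
    moreover have "0 \<le> x * (exp x - exp (- x))" using x by simp
    ultimately show "\<exists>y. ((\<lambda>h. (1 + h) * exp (- h) - (1 - h) * exp h) has_real_derivative y) (at x) \<and> 0 \<le> y" by blast
  qed
  then show ?thesis by simp
qed

text \<open>Reflection about 2 pairs the negative mass on the interval from 0 to 2 with positive
  mass between 2 and 4. What lies beyond 4 is left over and is kept as an explicit surplus for
  strictness.\<close>

lemma nn_integral_reflection:
  fixes P :: "real \<Rightarrow> real"
  assumes [measurable]: "P \<in> borel_measurable borel"
    and neg: "\<And>m. 0 \<le> m \<Longrightarrow> m \<le> 2 \<Longrightarrow> P m \<le> 0"
    and refl: "\<And>m. 0 \<le> m \<Longrightarrow> m \<le> 2 \<Longrightarrow> - P m \<le> P (4 - m)"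
    and pos: "\<And>m. 4 < m \<Longrightarrow> 0 \<le> P m"
  shows "(\<integral>\<^sup>+m. ennreal (- P m) * indicator {0..} m \<partial>lborel) + (\<integral>\<^sup>+m. ennreal (P m) * indicator {4<..} m \<partial>lborel)
    \<le> (\<integral>\<^sup>+m. ennreal (P m) * indicator {0..} m \<partial>lborel)"
proof -
  \<comment> \<open>Between 2 and 4 the mirror point lies where \<open>P\<close> is nonpositive, so
    \<open>refl\<close> forces nonnegativity here.\<close>
  have pos2: "0 \<le> P m" if "2 < m" for m
    using pos[of m] refl[of "4 - m"] neg[of "4 - m"] that by (cases "4 < m") auto
  have "(\<integral>\<^sup>+m. ennreal (- P m) * indicator {0..} m \<partial>lborel) \<le> (\<integral>\<^sup>+m. ennreal (P (4 - m)) * indicator {0..2} m \<partial>lborel)"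
    using pos2 refl by (intro nn_integral_mono) (auto simp: indicator_def ennreal_neg intro!: ennreal_leI)
  also have "\<dots> = (\<integral>\<^sup>+m. ennreal (P m) * indicator {2..4} m \<partial>lborel)"
    by (subst nn_integral_real_affine[where c = "-1" and t = 4]) (auto simp: indicator_def intro!: nn_integral_cong)
  finally have "(\<integral>\<^sup>+m. ennreal (- P m) * indicator {0..} m \<partial>lborel) + (\<integral>\<^sup>+m. ennreal (P m) * indicator {4<..} m \<partial>lborel)
    \<le> (\<integral>\<^sup>+m. ennreal (P m) * indicator {2..4} m \<partial>lborel) + (\<integral>\<^sup>+m. ennreal (P m) * indicator {4<..} m \<partial>lborel)"
    by (rule add_right_mono)
  also have "\<dots> = (\<integral>\<^sup>+m. ennreal (P m) * indicator {2..4} m + ennreal (P m) * indicator {4<..} m \<partial>lborel)"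
    by (rule nn_integral_add[symmetric]) auto
  also have "\<dots> \<le> (\<integral>\<^sup>+m. ennreal (P m) * indicator {0..} m \<partial>lborel)"
    by (intro nn_integral_mono) (auto simp: indicator_def)
  finally show ?thesis .
qed

text \<open>The density of the symmetrised integrand along the ray of slope \<open>s\<close>, where \<open>c = (1 - s\<^sup>2) / (1 + s\<^sup>2)\<close>
  is the cosine of twice the angle and \<open>m\<close> the squared radius.\<close>

definition ray_density :: "real \<Rightarrow> real \<Rightarrow> real \<Rightarrow> real \<Rightarrow> real \<Rightarrow> real" where
  "ray_density r A B c m = m * c * (\<bar>B * (c * m) + A * (m - 2)\<bar> powr r - \<bar>B * (c * m) - A * (m - 2)\<bar> powr r) * exp (- m / 2)"

text \<open>Changing the sign of \<open>c\<close> replaces the slope by its reciprocal, that is,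
  exchanges the two coordinates; symmetrisation makes the density invariant, so \<open>c\<close> may
  be taken nonnegative.\<close>

lemma ray_density_uminus: "ray_density r A B (- c) m = ray_density r A B c m"
proof -
  have "\<bar>- x + y\<bar> = \<bar>x - y\<bar>" "\<bar>- x - y\<bar> = \<bar>x + y\<bar>" for x y :: real by linarith+
  then show ?thesis by (simp add: ray_density_def algebra_simps)
qed

text \<open>For nonnegative \<open>c\<close> the sign is that of \<open>A * (m - 2)\<close>. Passing
  from \<open>m\<close> to \<open>4 - m\<close> only reverses the sign of
  \<open>A * (m - 2)\<close>, while it raises the centre \<open>B * (c * m)\<close>, so the
  increment grows in absolute value, and also raises the factor
  \<open>m * exp (- m / 2)\<close>.\<close>

lemma ray_density_sign_and_reflection:
  assumes r: "r > 1" and A: "A > 0" and B: "B > 0"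
  shows "0 \<le> m \<Longrightarrow> m \<le> 2 \<Longrightarrow> ray_density r A B c m \<le> 0"
    and "0 \<le> m \<Longrightarrow> m \<le> 2 \<Longrightarrow> - ray_density r A B c m \<le> ray_density r A B c (4 - m)"
    and "2 < m \<Longrightarrow> c \<noteq> 0 \<Longrightarrow> 0 < ray_density r A B c m"
proof -
  define K where "K c m = \<bar>B * (c * m) + A * (m - 2)\<bar> powr r - \<bar>B * (c * m) - A * (m - 2)\<bar> powr r" for c m
  have ray: "ray_density r A B c m = m * c * K c m * exp (- m / 2)" for c m
    by (simp add: ray_density_def K_def)
  have abs_c: "ray_density r A B c m = ray_density r A B \<bar>c\<bar> m" for c m
    by (cases "c \<ge> 0") (auto simp: ray_density_uminus)
  show "ray_density r A B c m \<le> 0" if "0 \<le> m" "m \<le> 2"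
  proof -
    have "K \<bar>c\<bar> m \<le> 0"
    proof -
      have "0 \<le> B * (\<bar>c\<bar> * m)" "A * (m - 2) \<le> 0" using that A B by (auto simp: mult_nonneg_nonpos)
      then show ?thesis unfolding K_def using r by (auto intro!: powr_mono2)
    qed
    then have "m * \<bar>c\<bar> * K \<bar>c\<bar> m \<le> 0" using that by (simp add: mult_nonneg_nonpos)
    then show ?thesis unfolding abs_c[of c] unfolding ray by (rule mult_nonpos_nonneg) simp
  qed
  show "0 < ray_density r A B c m" if "2 < m" "c \<noteq> 0"
  proof -
    have "0 < K \<bar>c\<bar> m"
    proof -
      have "0 < B * (\<bar>c\<bar> * m)" "0 < A * (m - 2)" using that A B by auto
      then show ?thesis unfolding K_def using r by (auto intro!: powr_less_mono2)
    qed
    then show ?thesis unfolding abs_c[of c] unfolding ray using that by auto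
  qed
  show "- ray_density r A B c m \<le> ray_density r A B c (4 - m)" if "0 \<le> m" "m \<le> 2"
  proof (cases "m = 2")
    case True
    then show ?thesis by (simp add: ray_density_def)
  next
    case False
    \<comment> \<open>Half the distance from \<open>m\<close> to the mirror at 2; \<open>C\<close>
      below is the common half-width of both increments and \<open>T\<close>, \<open>T'\<close> are
      their centres.\<close>
    define h where "h = 1 - m / 2"
    have h: "m = 2 - 2 * h" "4 - m = 2 + 2 * h" "0 < h" "h \<le> 1" using that False by (auto simp: h_def)
    define C where "C = A * (2 * h)"
    have C: "C > 0" using A h by (simp add: C_def)
    define T where "T = B * (\<bar>c\<bar> * (2 - 2 * h))"
    define T' where "T' = B * (\<bar>c\<bar> * (2 + 2 * h))"
    have TT': "0 \<le> T" "T \<le> T'" using B h by (auto simp: T_def T'_def intro!: mult_left_mono)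
    have K1: "K \<bar>c\<bar> m = - (\<bar>T + C\<bar> powr r - \<bar>T - C\<bar> powr r)"
      unfolding K_def h(1) by (simp add: T_def C_def algebra_simps)
    have K2: "K \<bar>c\<bar> (4 - m) = \<bar>T' + C\<bar> powr r - \<bar>T' - C\<bar> powr r"
      unfolding K_def h(2) by (simp add: T'_def C_def algebra_simps)
    have inc: "\<bar>T + C\<bar> powr r - \<bar>T - C\<bar> powr r \<le> \<bar>T' + C\<bar> powr r - \<bar>T' - C\<bar> powr r"
      by (rule abs_powr_increment_mono[OF r C TT'(2)])
    have nn: "0 \<le> \<bar>T + C\<bar> powr r - \<bar>T - C\<bar> powr r"
      using abs_powr_increment_mono[OF r C TT'(1)] by simp
    have e: "m * exp (- m / 2) \<le> (4 - m) * exp (- (4 - m) / 2)"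
    proof -
      have "m * exp (- m / 2) = 2 * exp (- 1) * ((1 - h) * exp h)"
      proof -
        have "- (2 - 2 * h) / 2 = - 1 + h" by simp
        then have e1: "exp (- (2 - 2 * h) / 2) = exp (- 1) * exp h" by (simp only: exp_add)
        show ?thesis unfolding h(1) e1 by (simp only: left_diff_distrib right_diff_distrib mult_1_left mult_ac)
      qed
      also have "\<dots> \<le> 2 * exp (- 1) * ((1 + h) * exp (- h))"
        using one_plus_exp_reflection[of h] h by (intro mult_left_mono) auto
      also have "\<dots> = (4 - m) * exp (- (4 - m) / 2)"
      proof -
        have "- (2 + 2 * h) / 2 = - 1 + - h" by simp
        then have e2: "exp (- (2 + 2 * h) / 2) = exp (- 1) * exp (- h)" by (simp only: exp_add)
        show ?thesis unfolding h(2) e2 by (simp only: distrib_left distrib_right mult_1_left mult_ac)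
      qed
      finally show ?thesis .
    qed
    have "- ray_density r A B c m = \<bar>c\<bar> * ((m * exp (- m / 2)) * (\<bar>T + C\<bar> powr r - \<bar>T - C\<bar> powr r))"
      unfolding abs_c[of c] unfolding ray K1 by (simp only: mult_minus_left mult_minus_right minus_minus mult_ac)
    also have "\<dots> \<le> \<bar>c\<bar> * (((4 - m) * exp (- (4 - m) / 2)) * (\<bar>T' + C\<bar> powr r - \<bar>T' - C\<bar> powr r))"
      by (rule mult_left_mono[OF mult_mono[OF e inc _ nn]]) (use that in auto)
    also have "\<dots> = ray_density r A B c (4 - m)"
      unfolding abs_c[of c] unfolding ray K2 by (simp add: mult_ac)
    finally show ?thesis .
  qed
qed

text \<open>Ray by ray, the positive part exceeds the negative part by at least the surplus beyond
  squared radius 4. This surplus is positive for every slope other than 1 and -1, so its integral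
  over the slopes is positive; \<open>fin\<close> allows the negative part to be cancelled, which
  makes the inequality strict.\<close>

lemma symmetrised_pair_integral_less:
  fixes r A B :: real
  defines "\<psi> \<equiv> \<lambda>u v. (u - v) * (\<bar>B * (u - v) + A * (u + v - 2)\<bar> powr r - \<bar>B * (u - v) - A * (u + v - 2)\<bar> powr r) * exp (- (u + v) / 2)"
  assumes r: "r > 1" and A: "A > 0" and B: "B > 0"
    and fin: "(\<integral>\<^sup>+x. \<integral>\<^sup>+y. ennreal (- \<psi> (x\<^sup>2) (y\<^sup>2)) \<partial>lborel \<partial>lborel) < \<infinity>"
  shows "(\<integral>\<^sup>+x. \<integral>\<^sup>+y. ennreal (- \<psi> (x\<^sup>2) (y\<^sup>2)) \<partial>lborel \<partial>lborel) < (\<integral>\<^sup>+x. \<integral>\<^sup>+y. ennreal (\<psi> (x\<^sup>2) (y\<^sup>2)) \<partial>lborel \<partial>lborel)" (is "?neg < ?pos")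
proof -
  define \<kappa> where "\<kappa> s = 1 + s\<^sup>2" for s :: real
  define c where "c s = (1 - s\<^sup>2) / \<kappa> s" for s
  have \<kappa>: "\<kappa> s \<ge> 1" for s by (simp add: \<kappa>_def)
  have [measurable]: "\<kappa> \<in> borel_measurable borel" "c \<in> borel_measurable borel"
    unfolding \<kappa>_def c_def by measurable
  have \<psi>m [measurable]: "case_prod \<psi> \<in> borel_measurable (borel \<Otimes>\<^sub>M borel)"
    "(\<lambda>(u, v). - \<psi> u v) \<in> borel_measurable (borel \<Otimes>\<^sub>M borel)"
    unfolding \<psi>_def by measurable
  define R where "R s m = ray_density r A B (c s) m" for s m
  have Rm [measurable]: "case_prod R \<in> borel_measurable (borel \<Otimes>\<^sub>M borel)"
    unfolding R_def ray_density_def by measurable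
  \<comment> \<open>With squared radius \<open>m\<close> on the ray of slope \<open>s\<close>, the
    squared coordinates have sum \<open>m\<close> and difference \<open>c s * m\<close>.\<close>
  have \<psi>R: "\<psi> (m / \<kappa> s) (m / \<kappa> s * s\<^sup>2) = R s m" for s m
  proof -
    have 1: "m / \<kappa> s - m / \<kappa> s * s\<^sup>2 = c s * m" and 2: "m / \<kappa> s + m / \<kappa> s * s\<^sup>2 = m"
    proof -
      have "m / \<kappa> s + m / \<kappa> s * s\<^sup>2 = m / \<kappa> s * \<kappa> s" unfolding \<kappa>_def by (simp only: distrib_left mult_1_right)
      then show "m / \<kappa> s + m / \<kappa> s * s\<^sup>2 = m" using \<kappa>[of s] by simp
      show "m / \<kappa> s - m / \<kappa> s * s\<^sup>2 = c s * m" by (simp add: c_def diff_divide_distrib algebra_simps)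
    qed
    show ?thesis unfolding \<psi>_def R_def ray_density_def 1 2 by (simp add: mult_ac)
  qed
  have ray: "(\<integral>\<^sup>+t. ennreal (\<sigma> * \<psi> t (t * s\<^sup>2) * indicator {0..} t) \<partial>lborel)
    = ennreal (1 / \<kappa> s) * (\<integral>\<^sup>+m. ennreal (\<sigma> * R s m) * indicator {0..} m \<partial>lborel)" for s \<sigma>
  proof (subst nn_integral_real_affine[where c = "1 / \<kappa> s" and t = 0])
    show "ennreal \<bar>1 / \<kappa> s\<bar> * (\<integral>\<^sup>+x. ennreal (\<sigma> * \<psi> (0 + 1 / \<kappa> s * x) ((0 + 1 / \<kappa> s * x) * s\<^sup>2) * indicator {0..} (0 + 1 / \<kappa> s * x)) \<partial>lborel)
      = ennreal (1 / \<kappa> s) * (\<integral>\<^sup>+m. ennreal (\<sigma> * R s m) * indicator {0..} m \<partial>lborel)"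
      using \<kappa>[of s] \<psi>R[of _ s]
      by (intro arg_cong2[where f = "(*)"] nn_integral_cong) (auto simp: indicator_def zero_le_divide_iff)
  qed (use \<kappa>[of s] in auto)
  \<comment> \<open>The surplus of the ray of slope \<open>s\<close>; \<open>N\<close> is its
    negative mass, both with the Jacobian of rescaling \<open>t\<close> to the squared
    radius.\<close>
  define X where "X s = ennreal (1 / \<kappa> s) * (\<integral>\<^sup>+m. ennreal (R s m) * indicator {4<..} m \<partial>lborel)" for s
  define N where "N s = ennreal (1 / \<kappa> s) * (\<integral>\<^sup>+m. ennreal (- R s m) * indicator {0..} m \<partial>lborel)" for s
  have [measurable]: "X \<in> borel_measurable borel" "N \<in> borel_measurable borel"
    unfolding X_def[abs_def] N_def[abs_def] by measurable
  have "N s + X s \<le> ennreal (1 / \<kappa> s) * (\<integral>\<^sup>+m. ennreal (R s m) * indicator {0..} m \<partial>lborel)" for s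
    unfolding N_def X_def distrib_left[symmetric]
  proof (rule mult_left_mono[OF nn_integral_reflection])
    fix m :: real
    show "R s m \<le> 0" "- R s m \<le> R s (4 - m)" if "0 \<le> m" "m \<le> 2"
      using ray_density_sign_and_reflection(1,2)[OF r A B that] by (auto simp: R_def)
    show "0 \<le> R s m" if "4 < m"
      using ray_density_sign_and_reflection(3)[OF r A B, of m "c s"] that by (cases "c s = 0") (auto simp: R_def ray_density_def)
  qed (auto simp: R_def ray_density_def[abs_def])
  then have "(\<integral>\<^sup>+s. N s + X s \<partial>lborel) \<le> (\<integral>\<^sup>+s. ennreal (1 / \<kappa> s) * (\<integral>\<^sup>+m. ennreal (R s m) * indicator {0..} m \<partial>lborel) \<partial>lborel)"
    by (rule nn_integral_mono)
  also have "\<dots> = ?pos"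
    unfolding nn_integral_slope_coordinates[OF \<psi>m(1)] using ray[of 1] by simp
  also have "(\<integral>\<^sup>+s. N s + X s \<partial>lborel) = (\<integral>\<^sup>+s. N s \<partial>lborel) + (\<integral>\<^sup>+s. X s \<partial>lborel)"
    by (rule nn_integral_add) auto
  also have "(\<integral>\<^sup>+s. N s \<partial>lborel) = ?neg"
    using nn_integral_slope_coordinates[OF \<psi>m(2)] ray[of "-1"] by (simp add: N_def)
  finally have le: "?neg + (\<integral>\<^sup>+s. X s \<partial>lborel)
    \<le> ?pos" .
  \<comment> \<open>On the two diagonals \<open>c s = 0\<close> and the ray density is identically
    zero; elsewhere it is strictly positive beyond 4.\<close>
  have Xpos: "X s \<noteq> 0" if s: "s \<notin> {1, -1}" for s
  proof
    assume "X s = 0"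
    then have "(\<integral>\<^sup>+m. ennreal (R s m) * indicator {4<..} m \<partial>lborel) = 0"
      using \<kappa>[of s] by (auto simp: X_def)
    then have ae: "AE m in lborel. ennreal (R s m) * indicator {4<..} m = 0"
      by (subst (asm) nn_integral_0_iff_AE) (auto simp: R_def ray_density_def[abs_def])
    have "1 - s\<^sup>2 \<noteq> 0" using s by (auto simp: power2_eq_1_iff)
    moreover have "\<kappa> s \<noteq> 0" using \<kappa>[of s] by linarith
    ultimately have "c s \<noteq> 0" by (simp add: c_def)
    then have pos: "R s m > 0" if "m > 4" for m using ray_density_sign_and_reflection(3)[OF r A B, of m "c s"] that by (simp add: R_def)
    have imp: "m \<notin> {4<..<5}" if "ennreal (R s m) * indicator {4<..} m = 0" for m
    proof
      assume "m \<in> {4<..<5}"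
      then have "4 < m" by simp
      with that have "ennreal (R s m) = 0" by simp
      then have "R s m \<le> 0" by (simp only: ennreal_eq_0_iff)
      with pos[OF \<open>4 < m\<close>] show False by linarith
    qed
    from ae have "AE m in lborel. m \<notin> {4<..<5 :: real}"
      by eventually_elim (rule imp)
    then have "emeasure lborel {4<..<5 :: real} = 0" by (subst (asm) AE_iff_null_sets[symmetric]) auto
    then show False by simp
  qed
  have "(\<integral>\<^sup>+s. X s \<partial>lborel) \<noteq> 0"
  proof
    assume "(\<integral>\<^sup>+s. X s \<partial>lborel) = 0"
    then have ae: "AE s in lborel. X s = 0" by (subst (asm) nn_integral_0_iff_AE) auto
    \<comment> \<open>Any interval of slopes avoiding 1 and -1 would serve as a set of positive
      measure.\<close>
    have imp: "s \<notin> {2<..<3 :: real}" if "X s = 0" for s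
      using Xpos[of s] that by fastforce
    from ae have "AE s in lborel. s \<notin> {2<..<3 :: real}"
      by eventually_elim (rule imp)
    then have "emeasure lborel {2<..<3 :: real} = 0" by (subst (asm) AE_iff_null_sets[symmetric]) auto
    then show False by simp
  qed
  then have "?neg + 0 <
    ?neg + (\<integral>\<^sup>+s. X s \<partial>lborel)"
    using fin by (subst ennreal_add_left_cancel_less) (simp add: zero_less_iff_neq_zero)
  also note le
  finally show ?thesis by simp
qed

section \<open>From plane integrals back to two Gaussian coordinates\<close>

lemma nn_integral_gauss_prod_pair:
  fixes f :: "real \<Rightarrow> real \<Rightarrow> ennreal" and i j :: "'k::finite"
  assumes [measurable]: "case_prod f \<in> borel_measurable (borel \<Otimes>\<^sub>M borel)" and ij: "i \<noteq> j"
  shows "(\<integral>\<^sup>+w. f (w i) (w j) \<partial>gauss_prod) = (\<integral>\<^sup>+x. \<integral>\<^sup>+y. f x y \<partial>std_normal \<partial>std_normal)"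
proof -
  let ?G = "gauss_prod :: ('k \<Rightarrow> real) measure"
  have "(\<integral>\<^sup>+w. f (w i) (w j) \<partial>gauss_prod) = (\<integral>\<^sup>+w. \<integral>\<^sup>+y. f (w i) y \<partial>std_normal \<partial>?G)"
    by (subst nn_integral_gauss_prod_resample[of _ j]) (use ij in auto)
  also have "\<dots> = (\<integral>\<^sup>+w. \<integral>\<^sup>+x. \<integral>\<^sup>+y. f x y \<partial>std_normal \<partial>std_normal \<partial>?G)"
    by (subst nn_integral_gauss_prod_resample[of _ i]) auto
  also have "\<dots> = (\<integral>\<^sup>+x. \<integral>\<^sup>+y. f x y \<partial>std_normal \<partial>std_normal)"
    by (simp add: gauss_prod.emeasure_space_1[simplified])
  finally show ?thesis .
qed

lemma gauss_prod_pair_swap: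
  fixes f :: "real \<Rightarrow> real \<Rightarrow> real" and i j :: "'k::finite"
  assumes m [measurable]: "case_prod f \<in> borel_measurable (borel \<Otimes>\<^sub>M borel)" and ij: "i \<noteq> j"
    and int: "integrable gauss_prod (\<lambda>w :: 'k \<Rightarrow> real. f (w i) (w j))"
  shows "integrable gauss_prod (\<lambda>w :: 'k \<Rightarrow> real. f (w j) (w i))"
    and "(\<integral>w. f (w j) (w i) \<partial>(gauss_prod :: ('k \<Rightarrow> real) measure)) = (\<integral>w. f (w i) (w j) \<partial>(gauss_prod :: ('k \<Rightarrow> real) measure))"
proof -
  let ?G = "gauss_prod :: ('k \<Rightarrow> real) measure"
  interpret N: pair_sigma_finite std_normal std_normal ..
  have swap: "(\<integral>\<^sup>+w. h (w j) (w i) \<partial>?G) = (\<integral>\<^sup>+w. h (w i) (w j) \<partial>?G)"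
    if [measurable]: "case_prod h \<in> borel_measurable (borel \<Otimes>\<^sub>M borel)" for h :: "real \<Rightarrow> real \<Rightarrow> ennreal"
  proof -
    have "(\<integral>\<^sup>+w. h (w j) (w i) \<partial>?G)
      = (\<integral>\<^sup>+x. \<integral>\<^sup>+y. h x y \<partial>std_normal \<partial>std_normal)"
      using ij by (intro nn_integral_gauss_prod_pair that) auto
    also have "\<dots> = (\<integral>\<^sup>+w. h (w i) (w j) \<partial>?G)"
      using ij by (intro nn_integral_gauss_prod_pair[symmetric] that)
    finally show ?thesis .
  qed
  have [measurable]: "(\<lambda>w. f (w i) (w j)) \<in> borel_measurable ?G"
    "(\<lambda>w. f (w j) (w i)) \<in> borel_measurable ?G" by measurable
  show int': "integrable gauss_prod (\<lambda>w :: 'k \<Rightarrow> real. f (w j) (w i))"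
    using int swap[of "\<lambda>x y. ennreal (norm (f x y))"] by (simp add: integrable_iff_bounded)
  show "(\<integral>w. f (w j) (w i) \<partial>?G) = (\<integral>w. f (w i) (w j) \<partial>?G)"
    unfolding real_lebesgue_integral_def[OF int] real_lebesgue_integral_def[OF int']
    using swap[of "\<lambda>x y. ennreal (f x y)"] swap[of "\<lambda>x y. ennreal (- f x y)"] by simp
qed

lemma nn_integral_std_normal_pair:
  assumes [measurable]: "case_prod f \<in> borel_measurable (borel \<Otimes>\<^sub>M borel)"
  shows "(\<integral>\<^sup>+x. \<integral>\<^sup>+y. ennreal (f x y * exp (x\<^sup>2 / 2) * exp (y\<^sup>2 / 2)) \<partial>std_normal \<partial>std_normal)
    = ennreal (1 / (2 * pi)) * (\<integral>\<^sup>+x. \<integral>\<^sup>+y. ennreal (f x y) \<partial>lborel \<partial>lborel)"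
proof -
  have prod3: "ennreal a * (ennreal b * ennreal c) = ennreal (a * (b * c))" if "0 \<le> a" "0 \<le> b" for a b c
    using that by (simp add: ennreal_mult')
  have twopi: "0 \<le> 1 / (2 * pi)" by simp
  have "(\<integral>\<^sup>+x. \<integral>\<^sup>+y. ennreal (f x y * exp (x\<^sup>2 / 2) * exp (y\<^sup>2 / 2)) \<partial>std_normal \<partial>std_normal)
    = (\<integral>\<^sup>+x. ennreal (std_normal_density x) * (\<integral>\<^sup>+y. ennreal (std_normal_density y) * ennreal (f x y * exp (x\<^sup>2 / 2) * exp (y\<^sup>2 / 2)) \<partial>lborel) \<partial>lborel)"
  proof -
    have inner: "(\<integral>\<^sup>+y. ennreal (f x y * exp (x\<^sup>2 / 2) * exp (y\<^sup>2 / 2)) \<partial>std_normal)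
      = (\<integral>\<^sup>+y. ennreal (std_normal_density y) * ennreal (f x y * exp (x\<^sup>2 / 2) * exp (y\<^sup>2 / 2)) \<partial>lborel)" for x
      by (rule nn_integral_density) auto
    show ?thesis unfolding inner by (rule nn_integral_density) auto
  qed
  also have "\<dots> = (\<integral>\<^sup>+x. \<integral>\<^sup>+y. ennreal (1 / (2 * pi)) * ennreal (f x y) \<partial>lborel \<partial>lborel)"
  proof (intro nn_integral_cong)
    fix x :: real
    have "ennreal (std_normal_density x) * (\<integral>\<^sup>+y. ennreal (std_normal_density y) * ennreal (f x y * exp (x\<^sup>2 / 2) * exp (y\<^sup>2 / 2)) \<partial>lborel)
      = (\<integral>\<^sup>+y. ennreal (std_normal_density x) * (ennreal (std_normal_density y) * ennreal (f x y * exp (x\<^sup>2 / 2) * exp (y\<^sup>2 / 2))) \<partial>lborel)"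
      by (rule nn_integral_cmult[symmetric]) auto
    also have "\<dots> = (\<integral>\<^sup>+y. ennreal (1 / (2 * pi)) * ennreal (f x y) \<partial>lborel)"
    proof (intro nn_integral_cong)
      fix y :: real
      have "std_normal_density x * (std_normal_density y * (f x y * exp (x\<^sup>2 / 2) * exp (y\<^sup>2 / 2))) = 1 / (2 * pi) * f x y"
        by (simp add: normal_density_def exp_minus divide_simps)
      then show "ennreal (std_normal_density x) * (ennreal (std_normal_density y) * ennreal (f x y * exp (x\<^sup>2 / 2) * exp (y\<^sup>2 / 2)))
        = ennreal (1 / (2 * pi)) * ennreal (f x y)"
        by (simp only: prod3[OF normal_density_nonneg normal_density_nonneg] ennreal_mult'[OF twopi])
    qed
    finally show "ennreal (std_normal_density x) * (\<integral>\<^sup>+y. ennreal (std_normal_density y) * ennreal (f x y * exp (x\<^sup>2 / 2) * exp (y\<^sup>2 / 2)) \<partial>lborel)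
      = (\<integral>\<^sup>+y. ennreal (1 / (2 * pi)) * ennreal (f x y) \<partial>lborel)" .
  qed
  also have "\<dots> = (\<integral>\<^sup>+x. ennreal (1 / (2 * pi)) * (\<integral>\<^sup>+y. ennreal (f x y) \<partial>lborel) \<partial>lborel)"
    by (intro nn_integral_cong nn_integral_cmult) auto
  also have "\<dots> = ennreal (1 / (2 * pi)) * (\<integral>\<^sup>+x. \<integral>\<^sup>+y. ennreal (f x y) \<partial>lborel \<partial>lborel)"
    by (intro nn_integral_cmult) auto
  finally show ?thesis .
qed

text \<open>Symmetrising in the two coordinates reduces the comparison to
  a comparison along rays.\<close>

lemma chaos_weighted_less_mixed:
  fixes l :: "real^'k::finite"
  assumes r: "r > 1" and le1: "\<And>k. \<bar>l $ k\<bar> \<le> 1" and ij: "i \<noteq> j" "i \<noteq> z" "j \<noteq> z"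
    and zero: "\<And>k. k \<noteq> i \<Longrightarrow> k \<noteq> j \<Longrightarrow> l $ k = 0" and neg: "l $ i * l $ j < 0" and less: "\<bar>l $ j\<bar> < \<bar>l $ i\<bar>"
  shows "chaos_weighted r z j l < chaos_weighted r z i l"
proof -
  let ?G = "gauss_prod :: ('k \<Rightarrow> real) measure"
  \<comment> \<open>Half difference and half sum turn |l_i|(u - 1) - |l_j|(v - 1) into B(u - v) +
    A(u + v - 2): the first term is odd and the second even under exchanging u and v.\<close>
  define A where "A = (\<bar>l $ i\<bar> - \<bar>l $ j\<bar>) / 2"
  define B where "B = (\<bar>l $ i\<bar> + \<bar>l $ j\<bar>) / 2"
  have A: "A > 0" and B: "B > 0" using less by (auto simp: A_def B_def)
  define H where "H d m = \<bar>B * d + A * (m - 2)\<bar> powr r" for d m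
  define \<phi> where "\<phi> x y = (x\<^sup>2 - y\<^sup>2) * H (x\<^sup>2 - y\<^sup>2) (x\<^sup>2 + y\<^sup>2)" for x y
  define \<psi> where "\<psi> u v = (u - v) * (\<bar>B * (u - v) + A * (u + v - 2)\<bar> powr r - \<bar>B * (u - v) - A * (u + v - 2)\<bar> powr r) * exp (- (u + v) / 2)" for u v
  have [measurable]: "case_prod \<phi> \<in> borel_measurable (borel \<Otimes>\<^sub>M borel)"
    "case_prod \<psi> \<in> borel_measurable (borel \<Otimes>\<^sub>M borel)"
    unfolding \<phi>_def \<psi>_def H_def by measurable
  have sum: "chaos_sum z l w = l $ i * ((w i)\<^sup>2 - 1) + l $ j * ((w j)\<^sup>2 - 1)" for w
  proof -
    have "chaos_sum z l w = (\<Sum>k\<in>{i, j}. l $ k * chaos_var z k (w k))"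
      unfolding chaos_sum_def by (rule sum.mono_neutral_right) (use zero in auto)
    then show ?thesis using ij by (simp add: chaos_var_def)
  qed
  have S: "\<bar>chaos_sum z l w\<bar> powr r = H ((w i)\<^sup>2 - (w j)\<^sup>2) ((w i)\<^sup>2 + (w j)\<^sup>2)" for w
  proof -
    have AB: "B * ((w i)\<^sup>2 - (w j)\<^sup>2) + A * ((w i)\<^sup>2 + (w j)\<^sup>2 - 2) = \<bar>l $ i\<bar> * ((w i)\<^sup>2 - 1) - \<bar>l $ j\<bar> * ((w j)\<^sup>2 - 1)"
      by (simp add: A_def B_def field_simps)
    consider "l $ i > 0" "l $ j < 0" | "l $ i < 0" "l $ j > 0" using neg by (auto simp: mult_less_0_iff)
    then have "\<bar>chaos_sum z l w\<bar> = \<bar>\<bar>l $ i\<bar> * ((w i)\<^sup>2 - 1) - \<bar>l $ j\<bar> * ((w j)\<^sup>2 - 1)\<bar>"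
      unfolding sum by cases (auto simp: abs_if algebra_simps)
    then show ?thesis by (simp add: H_def AB)
  qed
  have ui: "integrable ?G (\<lambda>w. (w i)\<^sup>2 * \<bar>chaos_sum z l w\<bar> powr r)" "integrable ?G (\<lambda>w. (w j)\<^sup>2 * \<bar>chaos_sum z l w\<bar> powr r)"
    using chaos_integrable(2)[OF le1, of r z i] chaos_integrable(2)[OF le1, of r z j] r ij by (auto simp: chaos_weight_def)
  have \<phi>eq: "(w i)\<^sup>2 * \<bar>chaos_sum z l w\<bar> powr r - (w j)\<^sup>2 * \<bar>chaos_sum z l w\<bar> powr r = \<phi> (w i) (w j)" for w
    by (simp add: \<phi>_def S left_diff_distrib)
  have diff: "chaos_weighted r z i l - chaos_weighted r z j l = (\<integral>w. \<phi> (w i) (w j) \<partial>?G)"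
    unfolding \<phi>eq[symmetric] using ui ij by (simp add: chaos_weighted_def chaos_weight_def)
  have int: "integrable ?G (\<lambda>w. \<phi> (w i) (w j))" unfolding \<phi>eq[symmetric] using ui by auto
  have int': "integrable ?G (\<lambda>w. \<phi> (w j) (w i))"
    and eq': "(\<integral>w. \<phi> (w j) (w i) \<partial>?G) = (\<integral>w. \<phi> (w i) (w j) \<partial>?G)"
    by (rule gauss_prod_pair_swap[OF _ ij(1) int]; simp)+
  \<comment> \<open>The exponentials cancel the factor \<open>exp (- (u + v) / 2)\<close> built into
    \<open>\<psi>\<close>, so \<open>\<zeta>\<close> is the plain symmetrised integrand under the
    Gaussian law, while \<open>\<psi>\<close> is integrated against Lebesgue measure.\<close>
  define \<zeta> where "\<zeta> x y = \<psi> (x\<^sup>2) (y\<^sup>2) * exp (x\<^sup>2 / 2) * exp (y\<^sup>2 / 2)" for x y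
  have \<zeta>eq: "\<phi> x y + \<phi> y x = \<zeta> x y" for x y
  proof -
    have e: "exp (- (x\<^sup>2 + y\<^sup>2) / 2) * exp (x\<^sup>2 / 2) * exp (y\<^sup>2 / 2) = 1"
      by (simp add: exp_add[symmetric] diff_divide_distrib)
    have "H (y\<^sup>2 - x\<^sup>2) (y\<^sup>2 + x\<^sup>2) = \<bar>B * (x\<^sup>2 - y\<^sup>2) - A * (x\<^sup>2 + y\<^sup>2 - 2)\<bar> powr r"
      unfolding H_def by (intro arg_cong[where f = "\<lambda>t. t powr r"]) (simp add: abs_if algebra_simps)
    then have "\<phi> x y + \<phi> y x = (x\<^sup>2 - y\<^sup>2) * (\<bar>B * (x\<^sup>2 - y\<^sup>2) + A * (x\<^sup>2 + y\<^sup>2 - 2)\<bar> powr r - \<bar>B * (x\<^sup>2 - y\<^sup>2) - A * (x\<^sup>2 + y\<^sup>2 - 2)\<bar> powr r)"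
      unfolding \<phi>_def by (simp add: H_def algebra_simps)
    also have "\<dots> = (x\<^sup>2 - y\<^sup>2) * (\<bar>B * (x\<^sup>2 - y\<^sup>2) + A * (x\<^sup>2 + y\<^sup>2 - 2)\<bar> powr r - \<bar>B * (x\<^sup>2 - y\<^sup>2) - A * (x\<^sup>2 + y\<^sup>2 - 2)\<bar> powr r)
      * (exp (- (x\<^sup>2 + y\<^sup>2) / 2) * exp (x\<^sup>2 / 2) * exp (y\<^sup>2 / 2))" unfolding e by simp
    also have "\<dots> = \<zeta> x y" by (simp only: \<zeta>_def \<psi>_def mult.assoc)
    finally show ?thesis .
  qed
  have \<zeta>int: "integrable ?G (\<lambda>w. \<zeta> (w i) (w j))"
    unfolding \<zeta>eq[symmetric] using int int' by auto
  have two: "2 * (chaos_weighted r z i l - chaos_weighted r z j l) = (\<integral>w. \<zeta> (w i) (w j) \<partial>?G)"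
    unfolding \<zeta>eq[symmetric] using int int' diff eq' by simp
  have \<zeta>m [measurable]: "case_prod \<zeta> \<in> borel_measurable (borel \<Otimes>\<^sub>M borel)"
    unfolding \<zeta>_def by measurable
  let ?neg = "(\<integral>\<^sup>+x. \<integral>\<^sup>+y. ennreal (- \<psi> (x\<^sup>2) (y\<^sup>2)) \<partial>lborel \<partial>lborel)" and ?pos = "(\<integral>\<^sup>+x. \<integral>\<^sup>+y. ennreal (\<psi> (x\<^sup>2) (y\<^sup>2)) \<partial>lborel \<partial>lborel)"
  have pos: "(\<integral>\<^sup>+w. ennreal (\<zeta> (w i) (w j)) \<partial>?G) = ennreal (1 / (2 * pi)) * ?pos"
    by (subst nn_integral_gauss_prod_pair[OF _ ij(1)], simp, subst nn_integral_std_normal_pair[symmetric]) (simp_all add: \<zeta>_def)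
  have negp: "(\<integral>\<^sup>+w. ennreal (- \<zeta> (w i) (w j)) \<partial>?G) = ennreal (1 / (2 * pi)) * ?neg"
    by (subst nn_integral_gauss_prod_pair[OF _ ij(1)], simp, subst nn_integral_std_normal_pair[symmetric]) (simp_all add: \<zeta>_def)
  have fin: "(\<integral>\<^sup>+w. ennreal (\<zeta> (w i) (w j)) \<partial>?G) < \<infinity>" "(\<integral>\<^sup>+w. ennreal (- \<zeta> (w i) (w j)) \<partial>?G) < \<infinity>"
    using \<zeta>int by (auto simp: real_integrable_def less_top)
  have "?neg < \<infinity>"
    using fin(2) unfolding negp by (auto simp: ennreal_mult_less_top)
  then have "?neg < ?pos"
    unfolding \<psi>_def by (rule symmetrised_pair_integral_less[OF r A B])
  then have "(\<integral>\<^sup>+w. ennreal (- \<zeta> (w i) (w j)) \<partial>?G) < (\<integral>\<^sup>+w. ennreal (\<zeta> (w i) (w j)) \<partial>?G)"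
    unfolding pos negp by (rule ennreal_mult_strict_left_mono) (auto simp: ennreal_zero_less_divide)
  then have "(\<integral>w. \<zeta> (w i) (w j) \<partial>?G) > 0"
    unfolding real_lebesgue_integral_def[OF \<zeta>int] using fin by (simp add: enn2real_less_iff less_top)
  then show ?thesis using two by simp
qed

section \<open>Maximisers on the unit sphere\<close>

lemma chaos_shifted_between:
  assumes l: "\<And>i. \<bar>l $ i\<bar> \<le> 1" and r: "r > 1" and 1: "\<bar>x\<bar> \<le> 1" "\<bar>y\<bar> \<le> 1"
    and between: "x < m \<and> m < y \<or> y < m \<and> m < x"
  shows "chaos_shifted r z l m < max (chaos_shifted r z l x) (chaos_shifted r z l y)"
proof -
  define v where "v = (m - x) / (y - x)"
  have v: "0 < v" "v < 1" using between by (auto simp: v_def field_simps)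
  have "v * (y - x) = m - x" using between by (auto simp: v_def)
  then have m: "m = (1 - v) * x + v * y" by (simp add: algebra_simps)
  have "chaos_shifted r z l m < (1 - v) * chaos_shifted r z l x + v * chaos_shifted r z l y"
    unfolding m using between by (intro chaos_shifted_strict_convex l r 1 v) auto
  also have "\<dots> \<le> max (chaos_shifted r z l x) (chaos_shifted r z l y)"
    using v by (intro convex_bound_le) auto
  finally show ?thesis .
qed

text \<open>Lets a strict inequality at the maximiser persist on an initial piece of a path.\<close>

lemma continuous_on_pos_initial_segment:
  fixes f :: "real \<Rightarrow> real"
  assumes "continuous_on {0..d} f" "f 0 > 0" "d > 0"
  obtains e where "0 < e" "e \<le> d" "\<And>t. 0 \<le> t \<Longrightarrow> t \<le> e \<Longrightarrow> f t > 0"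
proof -
  obtain b where b: "b > 0" "\<And>t. t \<in> {0..d} \<Longrightarrow> dist t 0 < b \<Longrightarrow> dist (f t) (f 0) < f 0"
    using assms unfolding continuous_on_iff by (meson atLeastAtMost_iff order_refl less_imp_le)
  have "f t > 0" if "0 \<le> t" "t \<le> min d (b / 2)" for t
    using b(2)[of t] that b(1) by (auto simp: dist_real_def abs_if split: if_splits)
  then show ?thesis using that[of "min d (b / 2)"] b(1) assms(3) by auto
qed

lemma sum_transfer:
  fixes f :: "'k::finite \<Rightarrow> real"
  assumes "i \<noteq> j"
  shows "(\<Sum>k\<in>UNIV. (if k = i then 1 else if k = j then - 1 else 0) * f k) = f i - f j"
proof -
  have "(\<Sum>k\<in>UNIV. (if k = i then 1 else if k = j then - 1 else 0) * f k)
    = (\<Sum>k\<in>UNIV. (if k = i then f k else 0) - (if k = j then f k else 0))"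
    using assms by (intro sum.cong) auto
  then show ?thesis by (simp add: sum_subtractf)
qed

text \<open>The bound on \<open>p\<close> makes the exponent \<open>p - 2\<close> exceed 1, where
  the shifted moment is strictly convex.\<close>

locale chaos_maximiser =
  fixes p :: real and z :: "'k::finite" and l :: "real^'k"
  assumes p: "p > 3" and norm1: "norm l = 1"
    and max: "\<And>l'. norm l' = 1 \<Longrightarrow> chaos_moment p z l' \<le> chaos_moment p z l"
begin

abbreviation u :: "'k \<Rightarrow> real^'k \<Rightarrow> real" where "u \<equiv> chaos_weighted (p - 2) z"
abbreviation U :: "real^'k \<Rightarrow> real \<Rightarrow> real" where "U \<equiv> chaos_shifted (p - 2) z"

lemma le1: "\<bar>l $ i\<bar> \<le> 1"
  by (rule abs_component_le_1[OF norm1])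

text \<open>Unlike \<open>sgn\<close> this is 1 at zero entries, since a path that leaves 0 needs a
  factor of modulus one.\<close>

definition sg :: "'k \<Rightarrow> real" where "sg i = (if l $ i < 0 then - 1 else 1)"

lemma sg: "\<bar>sg i\<bar> = 1" "sg i * \<bar>l $ i\<bar> = l $ i"
  by (auto simp: sg_def)

lemma norm_path:
  assumes s: "\<And>i. \<bar>s i\<bar> = 1" and c: "sum c UNIV = 0"
    and pos: "\<And>i t. c i \<noteq> 0 \<Longrightarrow> 0 < t \<Longrightarrow> t \<le> d \<Longrightarrow> (l $ i)\<^sup>2 + c i * t > 0" and t: "0 \<le> t" "t \<le> d"
  shows "norm (transport s c l t) = 1" "\<bar>transport s c l t $ i\<bar> \<le> 1"
proof -
  have "(l $ i)\<^sup>2 + c i * t \<ge> 0" for i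
    using pos[of i t] t by (cases "c i = 0"; cases "t = 0") auto
  then show "norm (transport s c l t) = 1" using norm_transport[OF s c] norm1 by simp
  then show "\<bar>transport s c l t $ i\<bar> \<le> 1" by (rule abs_component_le_1)
qed

lemma no_gain:
  assumes s: "\<And>i. \<bar>s i\<bar> = 1" "\<And>i. s i * \<bar>l $ i\<bar> = l $ i" and c: "sum c UNIV = 0" and d: "d > 0"
    and pos: "\<And>i t. c i \<noteq> 0 \<Longrightarrow> 0 < t \<Longrightarrow> t \<le> d \<Longrightarrow> (l $ i)\<^sup>2 + c i * t > 0"
    and gain: "\<And>t. 0 < t \<Longrightarrow> t < d \<Longrightarrow> (\<Sum>i\<in>UNIV. c i * u i (transport s c l t)) > 0"
  shows False
proof -
  have "chaos_moment p z l < chaos_moment p z (transport s c l d)"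
    by (rule chaos_moment_transport_less) (use assms p norm1 in auto)
  moreover have "norm (transport s c l d) = 1"
    using norm_path(1)[OF s(1) c pos] d by simp
  ultimately show False using max by fastforce
qed

definition transfer :: "'k \<Rightarrow> 'k \<Rightarrow> 'k \<Rightarrow> real" where
  "transfer i j k = (if k = i then 1 else if k = j then - 1 else 0)"

lemma transfer_simps:
  assumes "i \<noteq> j"
  shows "(\<Sum>k\<in>UNIV. transfer i j k * f k) = f i - f j" "sum (transfer i j) UNIV = 0"
  using sum_transfer[OF assms, of f] sum_transfer[OF assms, of "\<lambda>_. 1"] by (auto simp: transfer_def)

lemma transfer_pos:
  assumes "l $ j \<noteq> 0" "transfer i j k \<noteq> 0" "0 < t" "t \<le> (l $ j)\<^sup>2 / 2"
  shows "(l $ k)\<^sup>2 + transfer i j k * t > 0"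
proof (cases "k = i")
  case True
  then show ?thesis using assms by (simp add: transfer_def add_nonneg_pos)
next
  case False
  then have "k = j" "transfer i j k = - 1" using assms by (auto simp: transfer_def split: if_splits)
  moreover have "(l $ j)\<^sup>2 / 2 < (l $ j)\<^sup>2" using assms by simp
  ultimately show ?thesis using assms by simp
qed

lemma transfer_no_gain:
  assumes "i \<noteq> j" "l $ j \<noteq> 0" "0 < d" "d \<le> (l $ j)\<^sup>2 / 2"
    and gain: "\<And>t. 0 < t \<Longrightarrow> t < d \<Longrightarrow> u j (transport sg (transfer i j) l t) < u i (transport sg (transfer i j) l t)"
  shows False
proof (rule no_gain[OF sg transfer_simps(2)[OF assms(1)] assms(3)])
  show "(l $ k)\<^sup>2 + transfer i j k * t > 0" if "transfer i j k \<noteq> 0" "0 < t" "t \<le> d" for k t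
    using transfer_pos[OF assms(2) that(1,2)] that(3) assms(4) by simp
  show "(\<Sum>k\<in>UNIV. transfer i j k * u k (transport sg (transfer i j) l t)) > 0" if "0 < t" "t < d" for t
    using gain[OF that] by (simp add: transfer_simps(1)[OF assms(1)])
qed

lemma transfer_path_le1:
  assumes "i \<noteq> j" "l $ j \<noteq> 0" "0 \<le> t" "t \<le> (l $ j)\<^sup>2 / 2"
  shows "\<bar>transport sg (transfer i j) l t $ k\<bar> \<le> 1"
  by (rule norm_path(2)[OF sg(1) transfer_simps(2)[OF assms(1)] transfer_pos[OF assms(2)] assms(3,4)])

text \<open>The first-order condition: otherwise moving squared length from \<open>i\<close> to
  \<open>j\<close> would gain for a short while. Length can only be taken where there is some, so
  two nonzero entries have equal rates, whereas a zero entry merely has a rate no larger.\<close>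

lemma weighted_le:
  assumes i: "l $ i \<noteq> 0"
  shows "u j l \<le> u i l"
proof (rule ccontr)
  assume "\<not> u j l \<le> u i l"
  then have less: "u j l - u i l > 0" and ij: "j \<noteq> i" by auto
  let ?\<gamma> = "transport sg (transfer j i) l"
  have d: "(l $ i)\<^sup>2 / 2 > 0" using i by simp
  have "continuous_on {0..(l $ i)\<^sup>2 / 2} (\<lambda>t. u j (?\<gamma> t) - u i (?\<gamma> t))"
    using transfer_path_le1[OF ij i] p
    by (intro continuous_on_diff continuous_on_chaos_weighted continuous_on_transport) auto
  then obtain e where e: "0 < e" "e \<le> (l $ i)\<^sup>2 / 2" "\<And>t. 0 \<le> t \<Longrightarrow> t \<le> e \<Longrightarrow> u j (?\<gamma> t) - u i (?\<gamma> t) > 0"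
    by (rule continuous_on_pos_initial_segment) (use d less transport_0[OF sg(2)] in auto)
  show False
    by (rule transfer_no_gain[OF ij i e(1,2)]) (use e(3) in force)
qed

lemma weighted_eq_shifted: "i \<noteq> z \<Longrightarrow> (\<And>k. \<bar>l' $ k\<bar> \<le> 1) \<Longrightarrow> u i l' = U l' (l' $ i)"
  using chaos_weighted_eq_shifted[of l' "p - 2" i z] p by simp

lemma weighted_z: "(\<And>k. \<bar>l' $ k\<bar> \<le> 1) \<Longrightarrow> u z l' = U l' 0"
  using chaos_shifted_0[of l' "p - 2" z] p by simp

lemma between: "(\<And>k. \<bar>l' $ k\<bar> \<le> 1) \<Longrightarrow> \<bar>x\<bar> \<le> 1 \<Longrightarrow> \<bar>y\<bar> \<le> 1 \<Longrightarrow> x < m \<and> m < y \<or> y < m \<and> m < x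
    \<Longrightarrow> U l' m < max (U l' x) (U l' y)"
  by (rule chaos_shifted_between) (use p in auto)

text \<open>Equal entries have equal rates, so the gain only appears once they are pulled apart
  along the path. Since \<open>U\<close> at 0 does not exceed \<open>U\<close> at the common value
  \<open>a\<close>, strict convexity makes \<open>U\<close> increase from \<open>a\<close> outwards,
  and the entry that has grown then has the larger rate.\<close>

lemma distinct_components:
  assumes ij: "i \<noteq> j" "i \<noteq> z" "j \<noteq> z" and nz: "l $ j \<noteq> 0"
  shows "l $ i \<noteq> l $ j"
proof
  assume eq: "l $ i = l $ j"
  define a where "a = l $ j"
  have a: "a \<noteq> 0" "\<bar>a\<bar> \<le> 1" "\<bar>a / 2\<bar> \<le> 1" using nz le1[of j] by (auto simp: a_def)
  let ?\<gamma> = "transport sg (transfer i j) l"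
  have le: "U l 0 \<le> U l a"
    using weighted_le[OF nz, of z] weighted_z[OF le1] weighted_eq_shifted[OF ij(3) le1] by (simp add: a_def)
  \<comment> \<open>The point \<open>a / 2\<close> is a marker strictly inside: the gap between its
    value and that at \<open>a\<close> persists along the path, and the shrinking entry stays beyond
    it as long as \<open>t\<close> is below \<open>a\<^sup>2 / 2\<close>. Convexity on the three
    points \<open>a / 2\<close>, \<open>?l $ j\<close>, \<open>?l $ i\<close> then orders the
    rates.\<close>
  have "U l (a / 2) < max (U l 0) (U l a)"
    by (rule between) (use a le1 in auto)
  with le have gap: "U l a - U l (a / 2) > 0" by simp
  note le1' = transfer_path_le1[OF ij(1) nz]
  have "continuous_on {0..a\<^sup>2 / 2} (\<lambda>t. U (?\<gamma> t) (?\<gamma> t $ j) - U (?\<gamma> t) (a / 2))"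
    using le1' p a by (intro continuous_on_diff continuous_on_chaos_shifted continuous_on_transport continuous_intros)
      (auto simp: a_def)
  then obtain e where e: "0 < e" "e \<le> a\<^sup>2 / 2" "\<And>t. 0 \<le> t \<Longrightarrow> t \<le> e \<Longrightarrow> U (?\<gamma> t) (?\<gamma> t $ j) - U (?\<gamma> t) (a / 2) > 0"
    by (rule continuous_on_pos_initial_segment) (use gap a transport_0[OF sg(2)] in \<open>auto simp: a_def\<close>)
  show False
  proof (rule transfer_no_gain[OF ij(1) nz e(1) e(2)[unfolded a_def]])
    fix t assume t: "0 < t" "t < e"
    let ?l = "?\<gamma> t"
    have le1'': "\<bar>?l $ k\<bar> \<le> 1" for k using le1'[of t k] t e(2) by (simp add: a_def)
    have \<gamma>i: "?l $ i = sg j * sqrt (a\<^sup>2 + t)" and \<gamma>j: "?l $ j = sg j * sqrt (a\<^sup>2 - t)"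
      using eq ij(1) by (auto simp: transport_def transfer_def a_def sg_def)
    have lt: "t < a\<^sup>2 / 2" using t e(2) by simp
    have "\<bar>a\<bar> / 2 < sqrt (a\<^sup>2 - t)"
    proof (rule real_less_rsqrt)
      have "(\<bar>a\<bar> / 2)\<^sup>2 = a\<^sup>2 / 4" by (simp add: power_divide)
      moreover have "a\<^sup>2 > 0" using a by simp
      ultimately show "(\<bar>a\<bar> / 2)\<^sup>2 < a\<^sup>2 - t" using lt by linarith
    qed
    moreover have "sqrt (a\<^sup>2 - t) < sqrt (a\<^sup>2 + t)" using t by simp
    moreover have "a / 2 = sg j * (\<bar>a\<bar> / 2)" using sg(2)[of j] by (simp add: a_def)
    ultimately have "a / 2 < ?l $ j \<and> ?l $ j < ?l $ i \<or> ?l $ i < ?l $ j \<and> ?l $ j < a / 2"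
      unfolding \<gamma>i \<gamma>j by (auto simp: sg_def)
    then have "U ?l (?l $ j) < max (U ?l (a / 2)) (U ?l (?l $ i))"
      by (intro between le1'' a)
    moreover have "U ?l (a / 2) < U ?l (?l $ j)" using e(3)[of t] t by simp
    ultimately show "u j ?l < u i ?l"
      using weighted_eq_shifted[OF ij(2) le1''] weighted_eq_shifted[OF ij(3) le1''] by simp
  qed
qed

text \<open>If the Gaussian entry is nonzero, at most one other entry is, so among four indices two
  further ones are zero. Moving length from \<open>z\<close> equally into these two, with opposite
  signs, gains by strict convexity at 0.\<close>

lemma gaussian_component_zero:
  assumes card: "CARD('k) \<ge> 4"
  shows "l $ z = 0"
proof (rule ccontr)
  assume z: "l $ z \<noteq> 0"
  have eq: "U l (l $ k) = U l 0" if "k \<noteq> z" "l $ k \<noteq> 0" for k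
    using weighted_le[OF z, of k] weighted_le[OF that(2), of z] weighted_z[OF le1] weighted_eq_shifted[OF that(1) le1] by simp
  \<comment> \<open>A strictly convex function takes its value at 0 at most once more. Of the three
    points 0, \<open>l $ k\<close>, \<open>l $ k'\<close> the middle one would lie strictly below
    the common value; the cases say which point is in the middle.\<close>
  have unique: "k = k'" if k: "k \<noteq> z" "l $ k \<noteq> 0" "k' \<noteq> z" "l $ k' \<noteq> 0" for k k'
  proof (rule ccontr)
    assume "k \<noteq> k'"
    then have "l $ k \<noteq> l $ k'" using distinct_components k by blast
    then consider "l $ k < 0 \<and> 0 < l $ k' \<or> l $ k' < 0 \<and> 0 < l $ k"
      | "0 < l $ k \<and> l $ k < l $ k' \<or> l $ k' < l $ k \<and> l $ k < 0"
      | "0 < l $ k' \<and> l $ k' < l $ k \<or> l $ k < l $ k' \<and> l $ k' < 0"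
      using k(2,4) by linarith
    then show False
    proof cases
      case 1
      then have "U l 0 < max (U l (l $ k)) (U l (l $ k'))" by (intro between le1) auto
      then show False using eq[OF k(1,2)] eq[OF k(3,4)] by simp
    next
      case 2
      then have "U l (l $ k) < max (U l 0) (U l (l $ k'))" by (intro between le1) auto
      then show False using eq[OF k(1,2)] eq[OF k(3,4)] by simp
    next
      case 3
      then have "U l (l $ k') < max (U l 0) (U l (l $ k))" by (intro between le1) auto
      then show False using eq[OF k(1,2)] eq[OF k(3,4)] by simp
    qed
  qed
  define Z where "Z = {k. k \<noteq> z \<and> l $ k = 0}"
  have "card (insert z {k. k \<noteq> z \<and> l $ k \<noteq> 0}) \<le> 2"
  proof (cases "{k. k \<noteq> z \<and> l $ k \<noteq> 0} = {}")
    case False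
    then obtain k where "k \<noteq> z" "l $ k \<noteq> 0" by blast
    with unique have "{k. k \<noteq> z \<and> l $ k \<noteq> 0} \<subseteq> {k}" by blast
    then have "insert z {k. k \<noteq> z \<and> l $ k \<noteq> 0} \<subseteq> {z, k}" by blast
    from card_mono[OF _ this] show ?thesis by (rule order_trans) (auto simp: card_insert_if)
  next
    case True
    show ?thesis unfolding True by simp
  qed
  moreover have "card (UNIV :: 'k set) = card Z + card (insert z {k. k \<noteq> z \<and> l $ k \<noteq> 0})"
  proof -
    have "UNIV = Z \<union> insert z {k. k \<noteq> z \<and> l $ k \<noteq> 0}" by (auto simp: Z_def)
    moreover have "Z \<inter> insert z {k. k \<noteq> z \<and> l $ k \<noteq> 0} = {}" by (auto simp: Z_def)
    ultimately show ?thesis using card_Un_disjoint[of Z "insert z {k. k \<noteq> z \<and> l $ k \<noteq> 0}"] by simp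
  qed
  ultimately have "2 \<le> card Z" using card by simp
  then obtain i j where ij: "i \<in> Z" "j \<in> Z" "i \<noteq> j"
    by (metis card_le_Suc0_iff_eq finite numeral_2_eq_2 not_less_eq_eq)
  then have iz: "i \<noteq> z" "l $ i = 0" and jz: "j \<noteq> z" "l $ j = 0" by (auto simp: Z_def)
  \<comment> \<open>Each of \<open>i\<close> and \<open>j\<close> receives \<open>t\<close> and
    \<open>z\<close> loses \<open>2 * t\<close>; up to time \<open>(l $ z)\<^sup>2 / 4\<close> at
    least half of its squared length remains. The sign function below sends \<open>j\<close> to the
    negative side.\<close>
  define c where "c k = transfer i z k + transfer j z k" for k
  define s where "s k = (if k = j then - 1 else sg k)" for k
  have cs: "(\<Sum>k\<in>UNIV. c k * f k) = f i + f j - 2 * f z" for f :: "'k \<Rightarrow> real"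
    unfolding c_def distrib_right sum.distrib by (simp add: transfer_simps(1) iz jz)
  have c0: "sum c UNIV = 0"
    using cs[of "\<lambda>_. 1"] by simp
  have s1: "\<bar>s k\<bar> = 1" "s k * \<bar>l $ k\<bar> = l $ k" for k
    using sg jz by (auto simp: s_def)
  have cpos: "(l $ k)\<^sup>2 + c k * t > 0" if "c k \<noteq> 0" "0 < t" "t \<le> (l $ z)\<^sup>2 / 4" for k t
  proof (cases "k = z")
    case True
    have "(l $ z)\<^sup>2 > 0" using z by simp
    then show ?thesis using True that iz jz by (simp add: c_def transfer_def)
  next
    case False
    then have "c k > 0" using that(1) by (auto simp: c_def transfer_def split: if_splits)
    then show ?thesis using that(2) by (simp add: add_nonneg_pos)
  qed
  show False
  proof (rule no_gain[OF s1 c0 _ cpos])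
    show "0 < (l $ z)\<^sup>2 / 4" using z by simp
    fix t assume t: "0 < t" "t < (l $ z)\<^sup>2 / 4"
    let ?l = "transport s c l t"
    have le1': "\<bar>?l $ k\<bar> \<le> 1" for k
      by (rule norm_path(2)[OF s1(1) c0 cpos]) (use t in auto)
    have li: "?l $ i = sqrt t" and lj: "?l $ j = - sqrt t"
      using ij iz jz by (auto simp: transport_def c_def transfer_def s_def sg_def)
    have "U ?l ((1 - 1/2) * sqrt t + 1/2 * (- sqrt t)) < (1 - 1/2) * U ?l (sqrt t) + 1/2 * U ?l (- sqrt t)"
      by (rule chaos_shifted_strict_convex) (use le1' le1'[of i] t p in \<open>auto simp: li\<close>)
    then have "U ?l (?l $ i) + U ?l (?l $ j) - 2 * U ?l 0 > 0" by (simp add: li lj)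
    then show "(\<Sum>k\<in>UNIV. c k * u k ?l) > 0"
      unfolding cs by (simp add: weighted_eq_shifted[OF iz(1) le1'] weighted_eq_shifted[OF jz(1) le1'] weighted_z[OF le1'])
  qed
qed

text \<open>With equal signs, 0 and the two entries are three points on one side, and strict
  convexity puts \<open>U\<close> at the entry nearer to 0 strictly below the larger of its values
  at the other two. This contradicts equal values at the entries and a value at 0 that is no
  larger.\<close>

lemma opposite_signs:
  assumes "CARD('k) \<ge> 4" and ij: "i \<noteq> j" "l $ i \<noteq> 0" "l $ j \<noteq> 0"
  shows "l $ i * l $ j < 0"
proof (rule ccontr)
  assume "\<not> l $ i * l $ j < 0"
  then have same: "l $ i * l $ j > 0" using ij by (simp add: not_less le_less)
  have iz: "i \<noteq> z" and jz: "j \<noteq> z" using gaussian_component_zero[OF assms(1)] ij by auto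
  have "l $ i \<noteq> l $ j" using distinct_components ij iz jz by blast
  then have "l $ i < l $ j \<or> l $ j < l $ i" by linarith
  moreover have eq: "U l (l $ i) = U l (l $ j)" "U l 0 \<le> U l (l $ i)"
    using weighted_le[OF ij(2), of j] weighted_le[OF ij(3), of i] weighted_le[OF ij(2), of z]
      weighted_z[OF le1] weighted_eq_shifted[OF iz le1] weighted_eq_shifted[OF jz le1] by auto
  moreover have "0 < l $ i \<and> l $ i < l $ j \<or> l $ j < l $ i \<and> l $ i < 0 \<Longrightarrow> U l (l $ i) < max (U l 0) (U l (l $ j))"
    by (rule between) (use le1 in auto)
  moreover have "0 < l $ j \<and> l $ j < l $ i \<or> l $ i < l $ j \<and> l $ j < 0 \<Longrightarrow> U l (l $ j) < max (U l 0) (U l (l $ i))"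
    by (rule between) (use le1 in auto)
  moreover have "0 < l $ i \<and> 0 < l $ j \<or> l $ i < 0 \<and> l $ j < 0" using same by (auto simp: zero_less_mult_iff)
  ultimately show False by (auto simp: max_def split: if_splits)
qed

end

context chaos_maximiser begin

text \<open>Three nonzero entries cannot have pairwise opposite signs, so all other entries vanish
  and the planar comparison applies. Moving squared length from the smaller entry to the larger one
  gains at every positive time.\<close>

lemma not_mixed:
  assumes card: "CARD('k) \<ge> 4" and ij: "i \<noteq> j" "l $ i \<noteq> 0" "l $ j \<noteq> 0" and le: "\<bar>l $ j\<bar> \<le> \<bar>l $ i\<bar>"
  shows False
proof (rule transfer_no_gain[OF ij(1,3)])
  have lz: "l $ z = 0" by (rule gaussian_component_zero[OF card])
  have neg: "l $ i * l $ j < 0" by (rule opposite_signs[OF card ij])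
  have zero: "l $ k = 0" if "k \<noteq> i" "k \<noteq> j" for k
  proof (rule ccontr)
    assume "l $ k \<noteq> 0"
    then have "l $ i * l $ k < 0" "l $ j * l $ k < 0"
      using opposite_signs[OF card] that ij by metis+
    with neg show False by (auto simp: mult_less_0_iff)
  qed
  show d: "0 < (l $ j)\<^sup>2 / 2" using ij by simp
  fix t assume t: "0 < t" "t < (l $ j)\<^sup>2 / 2"
  let ?l = "transport sg (transfer i j) l t"
  have li: "?l $ i = sg i * sqrt ((l $ i)\<^sup>2 + t)" and lj: "?l $ j = sg j * sqrt ((l $ j)\<^sup>2 - t)"
    using ij(1) by (auto simp: transport_def transfer_def)
  have pos: "(l $ j)\<^sup>2 - t > 0" using t d by linarith
  show "u j ?l < u i ?l"
  proof (rule chaos_weighted_less_mixed)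
    show "1 < p - 2" using p by simp
    show "\<bar>?l $ k\<bar> \<le> 1" for k using transfer_path_le1[OF ij(1,3)] t by simp
    show "i \<noteq> j" "i \<noteq> z" "j \<noteq> z" using ij lz by auto
    show "?l $ k = 0" if "k \<noteq> i" "k \<noteq> j" for k using zero[OF that] that by (simp add: transport_def transfer_def)
    have "sg i * sg j < 0" using neg by (auto simp: sg_def mult_less_0_iff)
    moreover have "0 < sqrt ((l $ i)\<^sup>2 + t) * sqrt ((l $ j)\<^sup>2 - t)"
      using pos t by (simp add: add_nonneg_pos)
    ultimately have "(sg i * sg j) * (sqrt ((l $ i)\<^sup>2 + t) * sqrt ((l $ j)\<^sup>2 - t)) < 0"
      by (rule mult_neg_pos)
    then show "?l $ i * ?l $ j < 0" unfolding li lj by (simp add: mult_ac)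
    \<comment> \<open>Even entries of equal size at time 0 are strictly ordered for
      \<open>t > 0\<close>, which is all that is asked.\<close>
    have "(l $ j)\<^sup>2 \<le> (l $ i)\<^sup>2" using le by (simp add: abs_le_square_iff)
    then show "\<bar>?l $ j\<bar> < \<bar>?l $ i\<bar>" unfolding li lj abs_mult sg(1) using t pos by simp
  qed
qed simp

lemma single_component:
  assumes card: "CARD('k) \<ge> 4"
  obtains i where "i \<noteq> z" "\<bar>l $ i\<bar> = 1" "\<And>k. k \<noteq> i \<Longrightarrow> l $ k = 0"
proof -
  have "l \<noteq> 0" using norm1 by auto
  then obtain i where i: "l $ i \<noteq> 0" by (auto simp: vec_eq_iff)
  have zero: "l $ k = 0" if "k \<noteq> i" for k
    using not_mixed[OF card that[symmetric] i] not_mixed[OF card that _ i] by (cases "\<bar>l $ k\<bar> \<le> \<bar>l $ i\<bar>") auto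
  have "l = (l $ i) *\<^sub>R axis i 1" using zero by (auto simp: vec_eq_iff axis_def)
  then have "norm l = \<bar>l $ i\<bar> * 1" by (metis norm_scaleR norm_axis_1)
  then have "\<bar>l $ i\<bar> = 1" using norm1 by simp
  moreover have "i \<noteq> z" using i gaussian_component_zero[OF card] by auto
  ultimately show ?thesis using that zero by blast
qed

end

definition square_moment :: "real \<Rightarrow> real" where
  "square_moment p = (\<integral>x. \<bar>x\<^sup>2 - 1\<bar> powr p \<partial>std_normal)"

lemma integrable_square_moment:
  assumes "p \<ge> 0"
  shows "integrable std_normal (\<lambda>x. \<bar>x\<^sup>2 - 1\<bar> powr p)"
proof -
  obtain m :: nat where m: "p \<le> real m" using real_arch_simple by blast
  have "\<bar>x\<^sup>2 - 1\<bar> powr p \<le> (1 + x\<^sup>2) ^ m" for x :: real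
    by (rule powr_le_power_ceiling) (use assms m in \<open>auto simp: abs_le_iff\<close>)
  then show ?thesis
    by (intro Bochner_Integration.integrable_bound[OF integrable_std_normal_one_plus_square_power[of m]])
      (auto intro!: AE_I2 order_trans[OF _ abs_ge_self])
qed

lemma chaos_moment_single:
  fixes l :: "real^'k::finite"
  assumes i: "i \<noteq> z" and 1: "\<bar>l $ i\<bar> = 1" and zero: "\<And>k. k \<noteq> i \<Longrightarrow> l $ k = 0" and p: "p \<ge> 0"
  shows "chaos_moment p z l = square_moment p"
proof -
  have "chaos_sum z l w = (\<Sum>k\<in>{i}. l $ k * chaos_var z k (w k))" for w
    unfolding chaos_sum_def by (rule sum.mono_neutral_right) (use zero in auto)
  then have "\<bar>chaos_sum z l w\<bar> powr p = \<bar>(w i)\<^sup>2 - 1\<bar> powr p" for w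
    using i 1 by (simp add: chaos_var_def abs_mult)
  then show ?thesis unfolding chaos_moment_def square_moment_def
    using integrable_gauss_prod_component(2)[OF integrable_square_moment[OF p], of i] by simp
qed

text \<open>The description of maximisers is used twice: for one supplied by compactness, to find
  the value of the maximum, and for \<open>l\<close> itself when it attains that value.\<close>

theorem chaos_moment_le:
  fixes l :: "real^'k::finite"
  assumes p: "p > 3" and card: "CARD('k) \<ge> 4" and l: "norm l = 1"
  shows "chaos_moment p z l \<le> square_moment p"
    and "chaos_moment p z l = square_moment p \<Longrightarrow> \<exists>i. i \<noteq> z \<and> \<bar>l $ i\<bar> = 1 \<and> (\<forall>k. k \<noteq> i \<longrightarrow> l $ k = 0)"
proof -
  have "continuous_on (sphere 0 1 :: (real^'k) set) (\<lambda>l. chaos_moment p z l)"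
    using p by (intro continuous_on_chaos_moment abs_component_le_1) (auto intro: continuous_intros)
  moreover have "sphere 0 1 \<noteq> ({} :: (real^'k) set)" using l by (auto simp: set_eq_iff)
  ultimately obtain m :: "real^'k" where m: "norm m = 1" "\<And>l'. norm l' = 1 \<Longrightarrow> chaos_moment p z l' \<le> chaos_moment p z m"
    using continuous_attains_sup[of "sphere 0 1 :: (real^'k) set" "\<lambda>l. chaos_moment p z l"] by auto
  have max: "\<exists>i. i \<noteq> z \<and> \<bar>m $ i\<bar> = 1 \<and> (\<forall>k. k \<noteq> i \<longrightarrow> m $ k = 0)"
    if "norm m = 1" "\<And>l'. norm l' = 1 \<Longrightarrow> chaos_moment p z l' \<le> chaos_moment p z m" for m :: "real^'k"
  proof -
    interpret chaos_maximiser p z m by standard (use p that in auto)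
    show ?thesis by (rule single_component[OF card]) blast
  qed
  have val: "chaos_moment p z m = square_moment p"
    using max[OF m] chaos_moment_single[of _ z m p] p by auto
  show "chaos_moment p z l \<le> square_moment p" using m(2)[OF l] val by simp
  show "\<exists>i. i \<noteq> z \<and> \<bar>l $ i\<bar> = 1 \<and> (\<forall>k. k \<noteq> i \<longrightarrow> l $ k = 0)" if "chaos_moment p z l = square_moment p"
    using max[OF l] m(2) val that by simp
qed

section \<open>Diagonalisation of symmetric matrices\<close>

lemma symmetric_matrix_inner:
  fixes M :: "real^'n^'n"
  assumes "transpose M = M"
  shows "x \<bullet> (M *v y) = (M *v x) \<bullet> y"
  by (metis assms dot_lmul_matrix inner_commute transpose_matrix_vector)

text \<open>The form \<open>\<mu> * (y \<bullet> y) - y \<bullet> (M *v y)\<close> is positive semidefinite on \<open>V\<close> and vanishes at the maximiser \<open>x\<close> of the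
  Rayleigh quotient, hence \<open>x\<close> lies in its kernel.\<close>

lemma symmetric_matrix_eigenvector:
  fixes M :: "real^'n^'n"
  assumes sym: "transpose M = M" and V: "subspace V" "V \<noteq> {0}" and inv: "\<And>x. x \<in> V \<Longrightarrow> M *v x \<in> V"
  obtains x \<mu> where "x \<in> V" "norm x = 1" "M *v x = \<mu> *\<^sub>R x"
proof -
  let ?S = "V \<inter> sphere 0 1"
  obtain v where "v \<in> V" "v \<noteq> 0" using V subspace_0 by blast
  then have "v /\<^sub>R norm v \<in> ?S" using V by (auto intro: subspace_scale)
  moreover have "compact ?S"
    by (intro closed_Int_compact closed_subspace V) auto
  moreover have "continuous_on ?S (\<lambda>x. x \<bullet> (M *v x))"
    by (intro continuous_intros linear_continuous_on) (simp add: linear_linear)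
  ultimately obtain x where x: "x \<in> ?S" and max: "\<And>y. y \<in> ?S \<Longrightarrow> y \<bullet> (M *v y) \<le> x \<bullet> (M *v x)"
    using continuous_attains_sup[of ?S "\<lambda>x. x \<bullet> (M *v x)"] by blast
  define \<mu> where "\<mu> = x \<bullet> (M *v x)"
  have xx: "x \<bullet> x = 1" using x by (simp add: dot_square_norm)
  have psd: "y \<bullet> (M *v y) \<le> \<mu> * (y \<bullet> y)" if "y \<in> V" for y
  proof (cases "y = 0")
    case False
    let ?y = "y /\<^sub>R norm y"
    have "?y \<in> ?S" using that False V by (auto intro: subspace_scale)
    from max[OF this] have "(y \<bullet> (M *v y)) / (norm y)\<^sup>2 \<le> \<mu>"
      by (simp add: \<mu>_def matrix_vector_mult_scaleR power2_eq_square field_simps)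
    then show ?thesis using False by (simp add: field_simps dot_square_norm)
  qed simp
  define y where "y = \<mu> *\<^sub>R x - M *v x"
  have yV: "y \<in> V" unfolding y_def using x inv V by (auto intro: subspace_diff subspace_scale)
  define B where "B = \<mu> * (y \<bullet> y) - y \<bullet> (M *v y)"
  \<comment> \<open>Positive semidefiniteness at \<open>x + t *\<^sub>R y\<close>; the terms without
    \<open>t\<close> cancel by the choice of \<open>\<mu>\<close>.\<close>
  have key: "0 \<le> 2 * t * (y \<bullet> y) + t\<^sup>2 * B" for t
  proof -
    have "x + t *\<^sub>R y \<in> V" using x yV V by (auto intro: subspace_add subspace_scale)
    from psd[OF this] have "0 \<le> 2 * t * (\<mu> * (x \<bullet> y) - y \<bullet> (M *v x)) + t\<^sup>2 * B"
      using xx symmetric_matrix_inner[OF sym, of x y]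
      by (simp add: matrix_vector_right_distrib matrix_vector_mult_scaleR inner_add_left inner_add_right
          \<mu>_def[symmetric] B_def inner_commute power2_eq_square algebra_simps)
    also have "\<mu> * (x \<bullet> y) - y \<bullet> (M *v x) = y \<bullet> y"
    proof -
      have "y \<bullet> (\<mu> *\<^sub>R x - M *v x) = \<mu> * (x \<bullet> y) - y \<bullet> (M *v x)"
        by (simp add: inner_diff_right inner_commute)
      then show ?thesis by (simp only: y_def[symmetric])
    qed
    finally show ?thesis .
  qed
  have "y \<bullet> y = 0"
  proof (rule ccontr)
    assume "y \<bullet> y \<noteq> 0"
    then have pos: "y \<bullet> y > 0" by simp
    \<comment> \<open>Negative and so small that \<open>t * B\<close> is at most
      \<open>y \<bullet> y\<close> in absolute value; the linear term of \<open>key\<close> then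
      dominates and makes the expression negative.\<close>
    define t where "t = - (y \<bullet> y) / (\<bar>B\<bar> + 1)"
    have "t < 0" using pos by (simp add: t_def divide_neg_pos)
    have "t * B \<le> \<bar>t\<bar> * \<bar>B\<bar>" by (metis abs_ge_self abs_mult)
    also have "\<dots> \<le> y \<bullet> y" using pos by (simp add: t_def abs_div_pos field_simps)
    finally have "2 * (y \<bullet> y) + t * B > 0 \<or> t * B < 0 " using pos by linarith
    moreover have "t * B \<ge> - (y \<bullet> y)" using \<open>\<bar>t\<bar> * \<bar>B\<bar> \<le> y \<bullet> y\<close> abs_ge_minus_self[of "t * B"] by (simp add: abs_mult)
    ultimately have "2 * (y \<bullet> y) + t * B > 0" using pos by linarith
    then have "t * (2 * (y \<bullet> y) + t * B) < 0" using \<open>t < 0\<close> by (simp add: mult_neg_pos)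
    with key[of t] show False by (simp add: algebra_simps power2_eq_square)
  qed
  then have "M *v x = \<mu> *\<^sub>R x" by (simp add: y_def)
  with x that show ?thesis by auto
qed

text \<open>Symmetry makes the orthogonal complement of an eigenvector inside \<open>V\<close>
  invariant again, with dimension one less; the induction therefore runs over all invariant
  subspaces.\<close>

lemma symmetric_matrix_orthonormal_eigenvectors:
  fixes M :: "real^'n^'n"
  assumes sym: "transpose M = M"
  shows "subspace V \<Longrightarrow> (\<And>x. x \<in> V \<Longrightarrow> M *v x \<in> V) \<Longrightarrow>
    \<exists>B. B \<subseteq> V \<and> pairwise orthogonal B \<and> (\<forall>x\<in>B. norm x = 1 \<and> (\<exists>\<mu>. M *v x = \<mu> *\<^sub>R x)) \<and> card B = dim V"
proof (induction "dim V" arbitrary: V)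
  case 0
  then show ?case by (intro exI[of _ "{}"]) auto
next
  case (Suc d)
  have "V \<noteq> {0}" using Suc.hyps(2) by auto
  then obtain x \<mu> where x: "x \<in> V" "norm x = 1" "M *v x = \<mu> *\<^sub>R x"
    using symmetric_matrix_eigenvector[OF sym Suc.prems(1) _ Suc.prems(2)] by blast
  define W where "W = {y \<in> V. x \<bullet> y = 0}"
  have W: "subspace W"
    unfolding W_def using Suc.prems(1)
    by (auto simp: subspace_def inner_add_right)
  have inv: "M *v y \<in> W" if "y \<in> W" for y
    using that Suc.prems(2) x(3) symmetric_matrix_inner[OF sym, of x y] by (auto simp: W_def)
  have "dim {y \<in> V. \<forall>z\<in>span {x}. orthogonal z y} + dim (span {x}) = dim V"
    by (rule dim_subspace_orthogonal_to_vectors)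
      (use Suc.prems(1) x in \<open>auto intro: span_minimal simp: span_minimal\<close>)
  moreover have "{y \<in> V. \<forall>z\<in>span {x}. orthogonal z y} = W"
    by (auto simp: W_def orthogonal_def span_singleton)
  moreover have "dim (span {x}) = 1" using x(2) by (subst dim_span, subst dim_singleton) auto
  ultimately have "dim W = d" using Suc.hyps(2) by simp
  then obtain B where B: "B \<subseteq> W" "pairwise orthogonal B" "\<forall>x\<in>B. norm x = 1 \<and> (\<exists>\<mu>. M *v x = \<mu> *\<^sub>R x)" "card B = d"
    using Suc.hyps(1)[of W] W inv by blast
  have "x \<notin> B" using B(1) x(2) by (auto simp: W_def dot_square_norm)
  moreover have "finite B" using pairwise_orthogonal_imp_finite[OF B(2)] .
  moreover have "pairwise orthogonal (insert x B)"
    using B(1,2) by (auto simp: pairwise_insert W_def orthogonal_def inner_commute)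
  ultimately show ?case
    using B x Suc.hyps(2) by (intro exI[of _ "insert x B"]) (auto simp: W_def)
qed

theorem symmetric_matrix_diagonalization:
  fixes M :: "real^'n^'n"
  assumes sym: "transpose M = M"
  obtains Q l where "orthogonal_matrix Q" "M = transpose Q ** (\<chi> i j. if i = j then l $ i else 0) ** Q"
proof -
  obtain B where B: "pairwise orthogonal B" "\<forall>x\<in>B. norm x = 1 \<and> (\<exists>\<mu>. M *v x = \<mu> *\<^sub>R x)" "card B = CARD('n)"
    using symmetric_matrix_orthonormal_eigenvectors[OF sym, of UNIV] by auto
  have "finite B" using pairwise_orthogonal_imp_finite[OF B(1)] .
  then obtain v :: "'n \<Rightarrow> real^'n" where v: "bij_betw v UNIV B"
    using finite_same_card_bij[of "UNIV :: 'n set" B] B(3) by auto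
  then have vB: "v i \<in> B" for i by (auto simp: bij_betw_def)
  have "\<exists>\<mu>. M *v v i = \<mu> *\<^sub>R v i" for i using B(2) vB by blast
  then obtain l where l: "\<And>i. M *v v i = l i *\<^sub>R v i" by metis
  have on: "v i \<bullet> v j = (if i = j then 1 else 0)" for i j
  proof (cases "i = j")
    case False
    then have "v i \<noteq> v j" using v by (auto simp: bij_betw_def inj_on_def)
    then show ?thesis using B(1) vB False by (auto simp: pairwise_def orthogonal_def)
  qed (use B(2) vB in \<open>simp add: dot_square_norm\<close>)
  define Q :: "real^'n^'n" where "Q = (\<chi> i. v i)"
  define D :: "real^'n^'n" where "D = (\<chi> i j. if i = j then (vec_lambda l) $ i else 0)"
  have "(Q ** transpose Q) $ i $ j = (mat 1 :: real^'n^'n) $ i $ j" for i j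
  proof -
    have "(Q ** transpose Q) $ i $ j = v i \<bullet> v j"
      by (simp add: Q_def matrix_matrix_mult_def transpose_def inner_vec_def)
    then show ?thesis by (simp add: on mat_def)
  qed
  then have QQ: "Q ** transpose Q = mat 1" by (simp add: vec_eq_iff)
  then have "transpose Q ** Q = mat 1" by (simp add: matrix_left_right_inverse)
  with QQ have Q: "orthogonal_matrix Q" by (simp add: orthogonal_matrix_def)
  have "M ** transpose Q = transpose Q ** D"
  proof -
    have "(M ** transpose Q) $ i $ j = (transpose Q ** D) $ i $ j" for i j
    proof -
      have "(M ** transpose Q) $ i $ j = (M *v v j) $ i"
        by (simp add: Q_def matrix_matrix_mult_def transpose_def matrix_vector_mult_def)
      also have "\<dots> = l j * v j $ i" by (simp add: l)
      also have "\<dots> = (\<Sum>k\<in>UNIV. v k $ i * (if k = j then l k else 0))"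
        by (simp add: if_distrib[of "\<lambda>x. _ * x"] cong: if_cong)
      also have "\<dots> = (transpose Q ** D) $ i $ j"
        by (simp only: Q_def D_def matrix_matrix_mult_def transpose_def vec_lambda_beta)
      finally show ?thesis .
    qed
    then show ?thesis by (simp add: vec_eq_iff)
  qed
  then have "M ** (transpose Q ** Q) = transpose Q ** D ** Q"
    by (simp only: matrix_mul_assoc)
  then have "M = transpose Q ** D ** Q"
    by (simp add: \<open>transpose Q ** Q = mat 1\<close>)
  then show ?thesis using that[OF Q, of "vec_lambda l"] by (simp only: D_def)
qed

lemma rank_orthogonal_conjugate:
  fixes D :: "real^'n^'n"
  assumes "orthogonal_matrix Q"
  shows "rank (transpose Q ** D ** Q) = rank D"
proof (rule antisym)
  show "rank (transpose Q ** D ** Q) \<le> rank D"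
    using rank_mul_le_left[of "transpose Q ** D" Q] rank_mul_le_right[of "transpose Q" D] by linarith
  have "D = Q ** (transpose Q ** D ** Q) ** transpose Q"
  proof -
    have QQ: "Q ** transpose Q = mat 1" using assms by (simp add: orthogonal_matrix_def)
    have "Q ** (transpose Q ** D ** Q) ** transpose Q = (Q ** transpose Q) ** D ** (Q ** transpose Q)"
      by (simp only: matrix_mul_assoc)
    then show ?thesis by (simp add: QQ)
  qed
  then show "rank D \<le> rank (transpose Q ** D ** Q)"
    using rank_mul_le_left[of "Q ** (transpose Q ** D ** Q)" "transpose Q"]
      rank_mul_le_right[of Q "transpose Q ** D ** Q"] by simp
qed

lemma rank_diagonal:
  fixes l :: "real^'n"
  shows "rank (\<chi> i j. if i = j then l $ i else 0) = card {i. l $ i \<noteq> 0}"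
proof -
  let ?D = "\<chi> i j. if i = j then l $ i else 0"
  let ?N = "{i. l $ i \<noteq> 0}"
  have mul: "(?D *v x) $ i = l $ i * x $ i" for x i
    by (simp add: matrix_vector_mult_def if_distrib[of "\<lambda>x. x * _"] sum.delta cong: if_cong)
  have "range ((*v) ?D) = {x. \<forall>i. i \<notin> ?N \<longrightarrow> x $ i = 0}"
  proof (intro antisym subsetI)
    fix x :: "real^'n" assume x: "x \<in> {x. \<forall>i. i \<notin> ?N \<longrightarrow> x $ i = 0}"
    then have "?D *v (\<chi> i. x $ i / l $ i) = x" by (auto simp: vec_eq_iff mul)
    then show "x \<in> range ((*v) ?D)" by (rule range_eqI[OF sym])
  qed (auto simp: mul)
  then have "rank ?D = dim {x::real^'n. \<forall>i. i \<notin> ?N \<longrightarrow> x $ i = 0}" by (simp add: rank_dim_range)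
  also have "\<dots> = card ?N" by (simp only: dim_vec_eq[symmetric] dim_substandard_cart)
  finally show ?thesis .
qed

section \<open>Rotation invariance of the Gaussian law\<close>

lemma measurable_vec_lambda [measurable]: "vec_lambda \<in> measurable (PiM UNIV (\<lambda>_. borel)) (borel :: (real^'n) measure)"
  by (subst borel_measurable_euclidean_space) (auto simp: Basis_vec_def inner_axis)

lemma measurable_vec_lambda_lborel: "vec_lambda \<in> measurable (PiM UNIV (\<lambda>_. lborel)) (borel :: (real^'n) measure)"
  by (subst borel_measurable_euclidean_space) (auto simp: Basis_vec_def inner_axis)

lemma lborel_vec_lambda:
  "distr (PiM UNIV (\<lambda>_. lborel)) borel vec_lambda = (lborel :: (real^'n) measure)"
proof (rule lborel_eqI[symmetric])
  interpret product_sigma_finite "\<lambda>_ :: 'n. lborel :: real measure" by standard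
  note [measurable] = measurable_vec_lambda_lborel
  fix l u :: "real^'n" assume le: "\<And>b. b \<in> Basis \<Longrightarrow> l \<bullet> b \<le> u \<bullet> b"
  have le': "l $ i \<le> u $ i" for i
  proof -
    have "axis i 1 \<in> (Basis :: (real^'n) set)" by (simp add: axis_in_Basis_iff)
    from le[OF this] show ?thesis by (simp add: inner_axis)
  qed
  have "vec_lambda -` box l u \<inter> space (PiM UNIV (\<lambda>_. lborel)) = Pi\<^sub>E UNIV (\<lambda>i. {l $ i<..<u $ i})"
    by (auto simp: mem_box_cart space_PiM PiE_iff)
  then have "emeasure (distr (PiM UNIV (\<lambda>_. lborel)) borel vec_lambda) (box l u)
    = emeasure (PiM UNIV (\<lambda>_. lborel)) (Pi\<^sub>E UNIV (\<lambda>i. {l $ i<..<u $ i}))"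
    by (subst emeasure_distr) auto
  also have "\<dots> = (\<Prod>i\<in>UNIV. ennreal (u $ i - l $ i))"
    using le' by (subst emeasure_PiM) auto
  also have "\<dots> = ennreal (\<Prod>i\<in>UNIV. u $ i - l $ i)"
    using le' by (intro prod_ennreal) auto
  also have "(\<Prod>i\<in>UNIV. u $ i - l $ i) = (\<Prod>b\<in>Basis. (u - l) \<bullet> b)"
    by (simp add: Basis_vec_def Basis_real_def UNION_singleton_eq_range prod.reindex inj_on_def axis_eq_axis inner_axis)
  finally show "emeasure (distr (PiM UNIV (\<lambda>_. lborel)) borel vec_lambda) (box l u) = (\<Prod>b\<in>Basis. (u - l) \<bullet> b)" .
qed simp

lemma gauss_prod_eq_density:
  "(gauss_prod :: ('n::finite \<Rightarrow> real) measure) = density (PiM UNIV (\<lambda>_. lborel)) (\<lambda>w. ennreal (\<Prod>i\<in>UNIV. std_normal_density (w i)))"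
proof -
  interpret L: product_sigma_finite "\<lambda>_ :: 'n. lborel :: real measure" by standard
  interpret N: product_sigma_finite "\<lambda>_ :: 'n. std_normal" by standard
  have "density (PiM UNIV (\<lambda>_ :: 'n. lborel)) (\<lambda>w. ennreal (\<Prod>i\<in>UNIV. std_normal_density (w i))) = PiM UNIV (\<lambda>_. std_normal)"
  proof (rule N.PiM_eqI)
    show "sets (density (PiM UNIV (\<lambda>_ :: 'n. lborel)) (\<lambda>w. ennreal (\<Prod>i\<in>UNIV. std_normal_density (w i))))
      = sets (PiM UNIV (\<lambda>_. std_normal))"
      unfolding sets_density by (rule sets_PiM_cong) auto
    fix A :: "'n \<Rightarrow> real set" assume A: "\<And>i. i \<in> UNIV \<Longrightarrow> A i \<in> sets std_normal"
    then have A' [measurable]: "A i \<in> sets borel" for i by simp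
    have "emeasure (density (PiM UNIV (\<lambda>_ :: 'n. lborel)) (\<lambda>w. ennreal (\<Prod>i\<in>UNIV. std_normal_density (w i)))) (Pi\<^sub>E UNIV A)
      = (\<integral>\<^sup>+w. ennreal (\<Prod>i\<in>UNIV. std_normal_density (w i)) * indicator (Pi\<^sub>E UNIV A) w \<partial>PiM UNIV (\<lambda>_. lborel))"
      by (rule emeasure_density) (auto intro!: sets_PiM_I_finite)
    also have "\<dots> = (\<integral>\<^sup>+w. (\<Prod>i\<in>UNIV. ennreal (std_normal_density (w i)) * indicator (A i) (w i)) \<partial>PiM UNIV (\<lambda>_. lborel))"
    proof (intro nn_integral_cong)
      fix w :: "'n \<Rightarrow> real"
      have "indicator (Pi\<^sub>E UNIV A) w = (\<Prod>i\<in>UNIV. indicator (A i) (w i) :: ennreal)"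
      proof (cases "w \<in> Pi\<^sub>E UNIV A")
        case True
        then have "w i \<in> A i" for i by (auto simp: PiE_iff)
        then show ?thesis using True by simp
      next
        case False
        then obtain i where "w i \<notin> A i" by (auto simp: PiE_iff)
        then have "(\<Prod>i\<in>UNIV. indicator (A i) (w i) :: ennreal) = 0" by (intro prod_zero bexI[of _ i]) auto
        then show ?thesis using False by simp
      qed
      then show "ennreal (\<Prod>i\<in>UNIV. std_normal_density (w i)) * indicator (Pi\<^sub>E UNIV A) w
        = (\<Prod>i\<in>UNIV. ennreal (std_normal_density (w i)) * indicator (A i) (w i))"
        by (simp add: prod_ennreal[symmetric] prod.distrib)
    qed
    also have "\<dots> = (\<Prod>i\<in>UNIV. \<integral>\<^sup>+x. ennreal (std_normal_density x) * indicator (A i) x \<partial>lborel)"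
      by (rule L.product_nn_integral_prod) auto
    also have "\<dots> = (\<Prod>i\<in>UNIV. emeasure std_normal (A i))"
      by (simp add: emeasure_density)
    finally show "emeasure (density (PiM UNIV (\<lambda>_ :: 'n. lborel)) (\<lambda>w. ennreal (\<Prod>i\<in>UNIV. std_normal_density (w i)))) (Pi\<^sub>E UNIV A)
      = (\<Prod>i\<in>UNIV. emeasure std_normal (A i))" .
  qed simp
  then show ?thesis by (simp add: gauss_prod_def)
qed

lemma std_gaussian_density_prod:
  "std_gaussian_density (x :: real^'n) = (\<Prod>i\<in>UNIV. std_normal_density (x $ i))"
proof -
  have "(\<Prod>i\<in>UNIV. std_normal_density (x $ i)) = (1 / sqrt (2 * pi)) ^ CARD('n) * exp (\<Sum>i\<in>UNIV. - (x $ i)\<^sup>2 / 2)"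
    by (simp add: normal_density_def prod.distrib prod_dividef exp_sum power_one_over)
  also have "(\<Sum>i\<in>UNIV. - (x $ i)\<^sup>2 / 2) = - (norm x)\<^sup>2 / 2"
    by (simp add: norm_vec_def L2_set_def sum_nonneg sum_negf sum_divide_distrib[symmetric])
  also have "(1 / sqrt (2 * pi)) ^ CARD('n) = (2 * pi) powr (- real CARD('n) / 2)"
    by (simp add: powr_minus powr_half_sqrt[symmetric] powr_powr powr_realpow[symmetric] field_simps)
  finally show ?thesis by (simp add: std_gaussian_density_def)
qed

abbreviation std_gaussian :: "(real^'n) measure" where
  "std_gaussian \<equiv> density lborel (\<lambda>x. ennreal (std_gaussian_density x))"

text \<open>Bridge between the density given for \<open>G\<close> and the product space on which the
  moments are computed.\<close>

lemma std_gaussian_eq: "std_gaussian = distr (gauss_prod :: ('n::finite \<Rightarrow> real) measure) borel vec_lambda"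
proof -
  note m = measurable_vec_lambda_lborel
  have "std_gaussian = density (distr (PiM UNIV (\<lambda>_. lborel)) borel vec_lambda) (\<lambda>x :: real^'n. ennreal (std_gaussian_density x))"
    by (simp add: lborel_vec_lambda)
  also have "\<dots> = distr (density (PiM UNIV (\<lambda>_. lborel)) (\<lambda>w. ennreal (std_gaussian_density (vec_lambda w :: real^'n)))) borel vec_lambda"
    by (rule density_distr[OF _ m]) (unfold std_gaussian_density_def, measurable)
  finally show ?thesis by (simp add: std_gaussian_density_prod gauss_prod_eq_density)
qed

text \<open>The change of variables theorem for orthogonal maps is only available over well-ordered index types.\<close>

typedef 'a ordered_copy = "UNIV :: 'a set" by simp

instance ordered_copy :: (finite) finite
proof
  have eq: "(UNIV :: 'a ordered_copy set) = range Abs_ordered_copy"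
    by (metis Abs_ordered_copy_cases UNIV_eq_I rangeI)
  show "finite (UNIV :: 'a ordered_copy set)" by (subst eq) (rule finite_imageI, rule finite)
qed

instantiation ordered_copy :: (finite) wellorder
begin
definition less_eq_ordered_copy :: "'a ordered_copy \<Rightarrow> 'a ordered_copy \<Rightarrow> bool" where
  "x \<le> y \<longleftrightarrow> to_nat (Rep_ordered_copy x) \<le> to_nat (Rep_ordered_copy y)"
definition less_ordered_copy :: "'a ordered_copy \<Rightarrow> 'a ordered_copy \<Rightarrow> bool" where
  "x < y \<longleftrightarrow> to_nat (Rep_ordered_copy x) < to_nat (Rep_ordered_copy y)"
instance
proof
  fix P :: "'a ordered_copy \<Rightarrow> bool" and a :: "'a ordered_copy"
  assume step: "\<And>x. (\<And>y. y < x \<Longrightarrow> P y) \<Longrightarrow> P x"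
  show "P a"
  proof (induction a rule: measure_induct_rule[of "\<lambda>x. to_nat (Rep_ordered_copy x)"])
    case (less x)
    show ?case by (rule step, rule less) (simp add: less_ordered_copy_def)
  qed
qed (auto simp: less_eq_ordered_copy_def less_ordered_copy_def Rep_ordered_copy_inject)
end

lemma distr_lborel_orthogonal_ordered:
  fixes f :: "real^'m::{finite,wellorder} \<Rightarrow> real^'m::_"
  assumes f: "orthogonal_transformation f"
  shows "distr lborel borel f = lborel"
proof (rule lborel_eqI[symmetric])
  define g where "g = inv f"
  have g: "orthogonal_transformation g" unfolding g_def by (rule orthogonal_transformation_inv[OF f])
  have [measurable]: "f \<in> borel_measurable borel"
    using f by (intro borel_measurable_continuous_onI linear_continuous_on)
      (simp add: linear_linear orthogonal_transformation_linear)
  fix l u :: "(real, 'm) vec" assume le: "\<And>b. b \<in> Basis \<Longrightarrow> l \<bullet> b \<le> u \<bullet> b"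
  have vim: "f -` box l u = g ` box l u"
    unfolding g_def by (rule bij_vimage_eq_inv_image[OF orthogonal_transformation_bij[OF f]])
  have "emeasure (distr lborel borel f) (box l u) = emeasure lborel (f -` box l u)"
    by (subst emeasure_distr) auto
  also have "\<dots> = emeasure lebesgue (g ` box l u)"
  proof -
    have "f -` box l u \<in> sets lborel"
      using measurable_sets[of f borel borel "box l u"] by simp
    then show ?thesis unfolding vim[symmetric] by (simp add: emeasure_completion main_part_sets)
  qed
  also have "\<dots> = ennreal (measure lebesgue (g ` box l u))"
    using measurable_orthogonal_image[OF g, of "box l u"] by (intro emeasure_eq_measure2) auto
  also have "\<dots> = ennreal (measure lebesgue (box l u))"
    using measure_orthogonal_image[OF g, of "box l u"] by simp
  also have "\<dots> = (\<Prod>b\<in>Basis. (u - l) \<bullet> b)"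
    using le by (simp add: measure_completion measure_lborel_box_eq inner_diff_left)
  finally show "emeasure (distr lborel borel f) (box l u) = (\<Prod>b\<in>Basis. (u - l) \<bullet> b)" .
qed simp

lemma gauss_prod_reindex:
  fixes h :: "'m::finite \<Rightarrow> 'n::finite"
  assumes "inj h"
  shows "(\<lambda>w a. w (h a)) \<in> measurable gauss_prod gauss_prod"
    and "distr gauss_prod gauss_prod (\<lambda>w a. w (h a)) = gauss_prod"
proof -
  have "(\<lambda>w a. w (h a)) \<in> measurable (gauss_prod :: ('n \<Rightarrow> real) measure) (PiM UNIV (\<lambda>_. borel))"
    by (rule measurable_PiM_single') auto
  then show "(\<lambda>w a. w (h a)) \<in> measurable gauss_prod gauss_prod"
    by (simp cong: measurable_cong_sets[OF refl sets_gauss_prod])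
  show "distr gauss_prod gauss_prod (\<lambda>w a. w (h a)) = gauss_prod"
    using distr_PiM_reindex[of UNIV "\<lambda>_. std_normal" h UNIV] assms prob_space_std_normal
    by (simp add: gauss_prod_def restrict_def)
qed

lemma std_gaussian_orthogonal_ordered:
  fixes f :: "real^'m::{finite,wellorder} \<Rightarrow> real^'m::_"
  assumes f: "orthogonal_transformation f"
  shows "distr std_gaussian borel f = std_gaussian"
proof -
  have [measurable]: "f \<in> borel_measurable borel"
    using f by (intro borel_measurable_continuous_onI linear_continuous_on)
      (simp add: linear_linear orthogonal_transformation_linear)
  have [measurable]: "(\<lambda>x. ennreal (std_gaussian_density x)) \<in> borel_measurable (borel :: (real, 'm) vec measure)"
    unfolding std_gaussian_density_def by measurable
  have inv: "std_gaussian_density (f x) = std_gaussian_density x" for x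
    using orthogonal_transformation_norm[OF f] by (simp add: std_gaussian_density_def)
  have "distr std_gaussian borel f = distr (density lborel (\<lambda>x. ennreal (std_gaussian_density (f x)))) borel f"
    by (simp add: inv)
  also have "\<dots> = density (distr lborel borel f) (\<lambda>x. ennreal (std_gaussian_density x))"
    by (rule density_distr[symmetric]) auto
  finally show ?thesis by (simp add: distr_lborel_orthogonal_ordered[OF f])
qed

lemma std_gaussian_reindex:
  fixes h :: "'m::finite \<Rightarrow> 'n::finite"
  assumes h: "inj h"
  shows "distr std_gaussian borel (\<lambda>x. \<chi> a. x $ h a) = std_gaussian"
proof -
  note [measurable] = gauss_prod_reindex(1)[OF h]
  have [measurable]: "vec_lambda \<in> measurable gauss_prod (borel :: (real^'n) measure)"
    "vec_lambda \<in> measurable gauss_prod (borel :: (real^'m) measure)"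
    using measurable_vec_lambda by (simp_all cong: measurable_cong_sets[OF sets_gauss_prod refl])
  have [measurable]: "(\<lambda>x. \<chi> a. x $ h a) \<in> measurable (borel :: (real^'n) measure) (borel :: (real^'m) measure)"
    by (intro borel_measurable_continuous_onI continuous_intros continuous_on_vec_lambda)
  have "distr std_gaussian borel (\<lambda>x. \<chi> a. x $ h a)
    = distr gauss_prod borel ((\<lambda>x. \<chi> a. x $ h a) \<circ> (vec_lambda :: _ \<Rightarrow> real^'n))"
    unfolding std_gaussian_eq by (rule distr_distr) auto
  also have "(\<lambda>x. \<chi> a. x $ h a) \<circ> (vec_lambda :: _ \<Rightarrow> real^'n) = vec_lambda \<circ> (\<lambda>w a. w (h a))"
    by (auto simp: fun_eq_iff)
  also have "distr gauss_prod borel \<dots> = distr (distr gauss_prod gauss_prod (\<lambda>w a. w (h a))) borel vec_lambda"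
    by (rule distr_distr[symmetric]) auto
  finally show ?thesis unfolding gauss_prod_reindex(2)[OF h] std_gaussian_eq .
qed

text \<open>The map is conjugated by the relabelling \<open>J\<close> of the indices and its inverse
  \<open>K\<close>, which preserve norms and the Gaussian law, and the invariance is applied over
  the ordered copy.\<close>

lemma std_gaussian_orthogonal:
  fixes f :: "real^'n \<Rightarrow> real^'n"
  assumes f: "orthogonal_transformation f"
  shows "distr std_gaussian borel f = std_gaussian"
proof -
  define J :: "real^'n \<Rightarrow> real^'n ordered_copy" where "J x = (\<chi> a. x $ Rep_ordered_copy a)" for x
  define K :: "real^'n ordered_copy \<Rightarrow> real^'n" where "K y = (\<chi> i. y $ Abs_ordered_copy i)" for y
  have JK: "K (J x) = x" for x
    by (simp add: J_def K_def vec_eq_iff Abs_ordered_copy_inverse)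
  have injR: "inj (Rep_ordered_copy :: 'n ordered_copy \<Rightarrow> 'n)" by (simp add: inj_def Rep_ordered_copy_inject)
  have injA: "inj (Abs_ordered_copy :: 'n \<Rightarrow> 'n ordered_copy)" by (simp add: inj_def Abs_ordered_copy_inject)
  have linJ: "linear J" and linK: "linear K" by (auto simp: linear_iff J_def K_def vec_eq_iff)
  have bijA: "bij (Abs_ordered_copy :: 'n \<Rightarrow> 'n ordered_copy)"
    using injA by (auto simp: bij_def surj_def) (metis Abs_ordered_copy_cases)
  have normK: "norm (K y) = norm y" for y
    unfolding norm_vec_def L2_set_def K_def
    using sum.reindex_bij_betw[OF bijA, of "\<lambda>a. (norm (y $ a))\<^sup>2"] by simp
  have normJ: "norm (J x) = norm x" for x using normK[of "J x"] by (simp add: JK)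
  have f': "orthogonal_transformation (J \<circ> f \<circ> K)"
    using f linJ linK normJ normK unfolding orthogonal_transformation
    by (auto intro: linear_compose)
  have m: "linear h \<Longrightarrow> h \<in> borel_measurable borel" for h :: "'x::euclidean_space \<Rightarrow> 'y::euclidean_space"
    by (intro borel_measurable_continuous_onI linear_continuous_on) (simp add: linear_linear)
  have [measurable]: "J \<in> borel_measurable borel" "K \<in> borel_measurable borel" "f \<in> borel_measurable borel"
    "(J \<circ> f \<circ> K) \<in> borel_measurable borel"
    using m[OF linJ] m[OF linK] m[OF orthogonal_transformation_linear[OF f]] m[OF orthogonal_transformation_linear[OF f']] .
  have "f = K \<circ> ((J \<circ> f \<circ> K) \<circ> J)" by (simp add: fun_eq_iff JK)
  then have "distr std_gaussian borel f = distr std_gaussian borel (K \<circ> ((J \<circ> f \<circ> K) \<circ> J))" by simp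
  also have "\<dots> = distr (distr (distr std_gaussian borel J) borel (J \<circ> f \<circ> K)) borel K"
    by (subst distr_distr, simp, simp, subst distr_distr, simp, simp) (simp only: comp_assoc)
  also have "distr std_gaussian borel J = std_gaussian"
    unfolding J_def by (rule std_gaussian_reindex[OF injR])
  also have "distr std_gaussian borel (J \<circ> f \<circ> K) = std_gaussian"
    by (rule std_gaussian_orthogonal_ordered[OF f'])
  also have "distr std_gaussian borel K = std_gaussian"
    unfolding K_def by (rule std_gaussian_reindex[OF injA])
  finally show ?thesis .
qed

section \<open>Quadratic forms of Gaussian vectors\<close>

text \<open>The coefficients are extended by zeros to \<open>'n + bool option\<close>:
  \<open>Inr None\<close> is the Gaussian coordinate and the two remaining new indices are spare, so
  there are at least four coordinates even when \<open>'n\<close> has one element.\<close>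

lemma square_sum_moment:
  fixes l :: "real^'n"
  assumes p: "p > 3" and l: "norm l = 1"
  shows "integrable gauss_prod (\<lambda>w. \<bar>\<Sum>i\<in>UNIV. l $ i * ((w i)\<^sup>2 - 1)\<bar> powr p)" (is "integrable _ ?T")
    and "(\<integral>w. \<bar>\<Sum>i\<in>UNIV. l $ i * ((w i)\<^sup>2 - 1)\<bar> powr p \<partial>gauss_prod) \<le> square_moment p"
    and "(\<integral>w. \<bar>\<Sum>i\<in>UNIV. l $ i * ((w i)\<^sup>2 - 1)\<bar> powr p \<partial>gauss_prod) = square_moment p
      \<longleftrightarrow> card {i. l $ i \<noteq> 0} = 1"
proof -
  define z :: "'n + bool option" where "z = Inr None"
  define L :: "real^('n + bool option)" where "L = (\<chi> k. case k of Inl i \<Rightarrow> l $ i | Inr _ \<Rightarrow> 0)"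
  have inj: "inj (Inl :: 'n \<Rightarrow> 'n + bool option)" by simp
  note [measurable] = gauss_prod_reindex(1)[OF inj]
  have card: "CARD('n + bool option) \<ge> 4"
    using zero_less_card_finite[where 'a = 'n] by (simp add: card_UNIV_sum card_UNIV_option)
  have sum: "(\<Sum>k\<in>UNIV. f k) = (\<Sum>i\<in>UNIV. f (Inl i))"
    if "\<And>y. f (Inr y) = 0" for f :: "'n + bool option \<Rightarrow> real"
    unfolding UNIV_Plus_UNIV[symmetric] by (subst sum.Plus) (auto simp: that)
  have L: "norm L = 1"
    using l unfolding norm_vec_def L2_set_def by (subst sum) (simp_all add: L_def)
  have S: "chaos_sum z L w = (\<Sum>i\<in>UNIV. l $ i * ((w (Inl i))\<^sup>2 - 1))" for w
    unfolding chaos_sum_def by (subst sum) (simp_all add: L_def z_def chaos_var_def)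
  have Tm [measurable]: "?T \<in> borel_measurable gauss_prod" by measurable
  have int: "integrable gauss_prod (\<lambda>w. ?T (\<lambda>a. w (Inl a :: 'n + bool option)))"
    unfolding S[symmetric] by (rule chaos_integrable(1)) (use abs_component_le_1[OF L] p in auto)
  show "integrable gauss_prod ?T"
    by (subst gauss_prod_reindex(2)[OF inj, symmetric], subst integrable_distr_eq) (use int in auto)
  have moment: "(\<integral>w. ?T w \<partial>gauss_prod) = chaos_moment p z L"
    unfolding chaos_moment_def S
    by (subst gauss_prod_reindex(2)[OF inj, symmetric], subst integral_distr) auto
  show "(\<integral>w. ?T w \<partial>gauss_prod) \<le> square_moment p"
    unfolding moment by (rule chaos_moment_le(1)[OF p card L])
  show "(\<integral>w. ?T w \<partial>gauss_prod) = square_moment p \<longleftrightarrow> card {i. l $ i \<noteq> 0} = 1"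
    unfolding moment
  proof
    assume "chaos_moment p z L = square_moment p"
    from chaos_moment_le(2)[OF p card L this]
    obtain k where k: "k \<noteq> z" "\<bar>L $ k\<bar> = 1" "\<And>k'. k' \<noteq> k \<Longrightarrow> L $ k' = 0" by blast
    then obtain i where i: "k = Inl i" by (cases k) (auto simp: L_def)
    have "{j. l $ j \<noteq> 0} = {i}"
    proof -
      have "l $ j = 0" if "j \<noteq> i" for j using k(3)[of "Inl j"] that by (simp add: i L_def)
      moreover have "l $ i \<noteq> 0" using k(2) by (auto simp: i L_def)
      ultimately show ?thesis by auto
    qed
    then show "card {i. l $ i \<noteq> 0} = 1" by simp
  next
    assume "card {i. l $ i \<noteq> 0} = 1"
    then obtain i where i: "{i. l $ i \<noteq> 0} = {i}" by (auto simp: card_1_singleton_iff)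
    have zero: "L $ k = 0" if "k \<noteq> Inl i" for k
      using i that by (cases k) (auto simp: L_def)
    have "L = (L $ Inl i) *\<^sub>R axis (Inl i) 1" using zero by (auto simp: vec_eq_iff axis_def)
    then have "norm L = \<bar>L $ Inl i\<bar> * 1" by (metis norm_scaleR norm_axis_1)
    then show "chaos_moment p z L = square_moment p"
      using L zero p by (intro chaos_moment_single[of "Inl i"]) (auto simp: z_def)
  qed
qed

lemma diagonal_matrix_vector_mult:
  fixes l :: "real^'n"
  shows "((\<chi> i j. if i = j then l $ i else 0) *v x) $ i = l $ i * x $ i"
  by (simp add: matrix_vector_mult_def if_distrib[of "\<lambda>x. x * _"] sum.delta cong: if_cong)

lemma trace_diagonal_square:
  fixes l :: "real^'n"
  defines "D \<equiv> \<chi> i j. if i = j then l $ i else 0"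
  shows "trace D = (\<Sum>i\<in>UNIV. l $ i)" "trace (D ** D) = (norm l)\<^sup>2"
proof -
  show "trace D = (\<Sum>i\<in>UNIV. l $ i)" by (simp add: trace_def D_def)
  have "(D ** D) $ i $ i = (l $ i)\<^sup>2" for i
    by (simp add: matrix_matrix_mult_def D_def if_distrib[of "\<lambda>x. x * _"] sum.delta power2_eq_square cong: if_cong)
  then show "trace (D ** D) = (norm l)\<^sup>2" by (simp add: trace_def norm_vec_def L2_set_def sum_nonneg)
qed

text \<open>Trace, trace of the square and rank are invariant under orthogonal conjugation, and the
  Gaussian law is invariant under the rotation, so everything can be read off the eigenvalues
  \<open>l\<close>.\<close>

lemma quadratic_form_law:
  fixes M :: "real^'n^'n"
  assumes sym: "transpose M = M"
  obtains l :: "real^'n" where "trace M = (\<Sum>i\<in>UNIV. l $ i)" "frobenius_norm M = norm l" "rank M = card {i. l $ i \<noteq> 0}"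
    "distr std_gaussian borel (\<lambda>x. x \<bullet> (M *v x)) = distr gauss_prod borel (\<lambda>w. \<Sum>i\<in>UNIV. l $ i * (w i)\<^sup>2)"
proof -
  obtain Q :: "real^'n^'n" and l :: "real^'n" where Q: "orthogonal_matrix Q"
    and M: "M = transpose Q ** (\<chi> i j. if i = j then l $ i else 0) ** Q"
    by (rule symmetric_matrix_diagonalization[OF sym])
  define D :: "real^'n^'n" where "D = (\<chi> i j. if i = j then l $ i else 0)"
  have MD: "M = transpose Q ** D ** Q" unfolding M D_def ..
  have QQ: "Q ** transpose Q = mat 1" using Q by (simp add: orthogonal_matrix_def)
  have conj: "trace (transpose Q ** C ** Q) = trace C" for C :: "real^'n^'n"
  proof -
    have "trace (transpose Q ** (C ** Q)) = trace ((C ** Q) ** transpose Q)" by (rule trace_mul_sym)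
    also have "(C ** Q) ** transpose Q = C" unfolding matrix_mul_assoc[symmetric] QQ by (rule matrix_mul_rid)
    finally show ?thesis unfolding matrix_mul_assoc .
  qed
  have tr: "trace M = (\<Sum>i\<in>UNIV. l $ i)"
    unfolding MD conj D_def by (rule trace_diagonal_square(1))
  have "M ** M = transpose Q ** (D ** (Q ** transpose Q) ** D) ** Q"
    unfolding MD by (simp only: matrix_mul_assoc)
  then have "M ** M = transpose Q ** (D ** D) ** Q" unfolding QQ by (simp only: matrix_mul_rid)
  then have "trace (M ** M) = (norm l)\<^sup>2"
    using conj[of "D ** D"] trace_diagonal_square(2)[of l] by (simp only: D_def)
  then have frob: "frobenius_norm M = norm l" by (simp add: frobenius_norm_def)
  have rank: "rank M = card {i. l $ i \<noteq> 0}"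
    unfolding MD rank_orthogonal_conjugate[OF Q] D_def by (rule rank_diagonal)
  define q where "q y = (\<Sum>i\<in>UNIV. l $ i * (y $ i)\<^sup>2)" for y :: "real^'n"
  have form: "x \<bullet> (M *v x) = q (Q *v x)" for x
  proof -
    have "x \<bullet> (M *v x) = x \<bullet> (transpose Q *v (D *v (Q *v x)))"
      unfolding MD by (simp only: matrix_vector_mul_assoc matrix_mul_assoc)
    also have "\<dots> = (Q *v x) \<bullet> (D *v (Q *v x))"
      by (metis dot_lmul_matrix transpose_matrix_vector transpose_transpose)
    also have "\<dots> = q (Q *v x)"
      by (simp add: inner_vec_def D_def diagonal_matrix_vector_mult q_def power2_eq_square mult_ac)
    finally show ?thesis .
  qed
  have [measurable]: "q \<in> borel_measurable borel"
    unfolding q_def by (intro borel_measurable_continuous_onI continuous_intros)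
  have [measurable]: "(*v) Q \<in> borel_measurable borel"
    by (intro borel_measurable_continuous_onI linear_continuous_on) (simp add: linear_linear)
  have [measurable]: "vec_lambda \<in> measurable gauss_prod (borel :: (real^'n) measure)"
    using measurable_vec_lambda by (simp cong: measurable_cong_sets[OF sets_gauss_prod refl])
  have "distr std_gaussian borel (\<lambda>x. x \<bullet> (M *v x)) = distr std_gaussian borel (q \<circ> (*v) Q)"
    by (simp add: form comp_def)
  also have "\<dots> = distr (distr std_gaussian borel ((*v) Q)) borel q"
    by (rule distr_distr[symmetric]) auto
  also have "distr std_gaussian borel ((*v) Q) = std_gaussian"
    using Q by (intro std_gaussian_orthogonal) (simp add: orthogonal_transformation_matrix)
  also have "distr std_gaussian borel q = distr gauss_prod borel (q \<circ> vec_lambda)"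
    unfolding std_gaussian_eq by (rule distr_distr) auto
  also have "q \<circ> vec_lambda = (\<lambda>w. \<Sum>i\<in>UNIV. l $ i * (w i)\<^sup>2)"
    by (simp add: q_def comp_def)
  finally show ?thesis using that[OF tr frob rank] by blast
qed

section \<open>From laws to norms of random variables and the sharp constant\<close>

lemma distributed_integral_distr:
  fixes \<phi> :: "'b \<Rightarrow> real"
  assumes X: "distributed P N X f" and \<phi>: "\<phi> \<in> borel_measurable N"
  shows "integrable P (\<lambda>w. \<phi> (X w)) \<longleftrightarrow> integrable (density N f) \<phi>"
    and "(\<integral>w. \<phi> (X w) \<partial>P) = (\<integral>x. \<phi> x \<partial>density N f)"
proof -
  note m = distributed_measurable[OF X] and d = distributed_distr_eq_density[OF X]
  show "integrable P (\<lambda>w. \<phi> (X w)) \<longleftrightarrow> integrable (density N f) \<phi>"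
    unfolding d[symmetric] by (rule integrable_distr_eq[symmetric, OF m \<phi>])
  show "(\<integral>w. \<phi> (X w) \<partial>P) = (\<integral>x. \<phi> x \<partial>density N f)"
    unfolding d[symmetric] by (rule integral_distr[symmetric, OF m \<phi>])
qed

lemma square_moment_eq:
  "square_moment p = 1 / sqrt (2 * pi) *
    (LBINT x:{0<..}. \<bar>x - 1\<bar> powr p * x powr (- 1 / 2) * exp (- x / 2))"
proof -
  have "square_moment p = (\<integral>t. 1 / sqrt (2 * pi) * (\<bar>t - 1\<bar> powr p * t powr (- 1 / 2) * exp (- t / 2)) * indicator {0<..} t \<partial>lborel)"
    unfolding square_moment_def
    by (subst (1 2) integral_eq_nn_integral)
      (auto simp: nn_integral_std_normal_square[of "\<lambda>t. \<bar>t - 1\<bar> powr p"])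
  also have "\<dots> = (\<integral>t. 1 / sqrt (2 * pi) * (indicator {0<..} t *\<^sub>R (\<bar>t - 1\<bar> powr p * t powr (- 1 / 2) * exp (- t / 2))) \<partial>lborel)"
    by (intro Bochner_Integration.integral_cong) auto
  also have "\<dots> = 1 / sqrt (2 * pi) * (LBINT x:{0<..}. \<bar>x - 1\<bar> powr p * x powr (- 1 / 2) * exp (- x / 2))"
    unfolding set_lebesgue_integral_def by (rule Bochner_Integration.integral_mult_right_zero)
  finally show ?thesis .
qed

lemma quadratic_form_moment:
  fixes M :: "real^'n^'n" and G :: "'a \<Rightarrow> real^'n"
  assumes p: "p > 3" and G: "distributed P lborel G std_gaussian_density"
    and sym: "transpose M = M" and nz: "M \<noteq> 0"
  shows "integrable P (\<lambda>\<omega>. \<bar>G \<omega> \<bullet> (M *v G \<omega>) - trace M\<bar> powr p)"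
    and "Lp_norm P p (\<lambda>\<omega>. G \<omega> \<bullet> (M *v G \<omega>) - trace M) \<le> square_moment p powr (1 / p) * frobenius_norm M"
    and "Lp_norm P p (\<lambda>\<omega>. G \<omega> \<bullet> (M *v G \<omega>) - trace M) = square_moment p powr (1 / p) * frobenius_norm M
      \<longleftrightarrow> rank M = 1"
proof -
  obtain l :: "real^'n" where tr: "trace M = (\<Sum>i\<in>UNIV. l $ i)" and frob: "frobenius_norm M = norm l"
    and rank: "rank M = card {i. l $ i \<noteq> 0}"
    and law: "distr std_gaussian borel (\<lambda>x. x \<bullet> (M *v x)) = distr gauss_prod borel (\<lambda>w. \<Sum>i\<in>UNIV. l $ i * (w i)\<^sup>2)"
    by (rule quadratic_form_law[OF sym])
  have "rank M \<noteq> 0" using nz by (simp add: rank_eq_0)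
  then have "l \<noteq> 0" using rank by auto
  define n where "n = norm l"
  have n: "n > 0" using \<open>l \<noteq> 0\<close> by (simp add: n_def)
  \<comment> \<open>Normalising to the unit sphere: the form scales by \<open>n\<close> and its
    moment by \<open>n powr p\<close>, while the support, hence the rank, is unchanged.\<close>
  define k where "k = l /\<^sub>R n"
  have k: "norm k = 1" using n by (simp add: k_def n_def)
  have supp: "{i. k $ i \<noteq> 0} = {i. l $ i \<noteq> 0}" using n by (simp add: k_def)
  define T where "T w = \<bar>\<Sum>i\<in>UNIV. k $ i * ((w i)\<^sup>2 - 1)\<bar> powr p" for w :: "'n \<Rightarrow> real"
  define F where "F = (\<integral>w. T w \<partial>gauss_prod)"
  note T = square_sum_moment[OF p k, folded T_def, folded F_def, unfolded supp, folded rank]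
  have Tl: "\<bar>(\<Sum>i\<in>UNIV. l $ i * (w i)\<^sup>2) - trace M\<bar> powr p = n powr p * T w" for w
  proof -
    have "(\<Sum>i\<in>UNIV. l $ i * (w i)\<^sup>2) - trace M = n * (\<Sum>i\<in>UNIV. k $ i * ((w i)\<^sup>2 - 1))"
    proof -
      have nk: "n * k $ i = l $ i" for i using n by (simp add: k_def)
      have "n * (\<Sum>i\<in>UNIV. k $ i * ((w i)\<^sup>2 - 1)) = (\<Sum>i\<in>UNIV. l $ i * ((w i)\<^sup>2 - 1))"
        by (simp only: sum_distrib_left mult.assoc[symmetric] nk)
      then show ?thesis by (simp add: tr right_diff_distrib sum_subtractf)
    qed
    then show ?thesis using n by (simp add: T_def abs_mult powr_mult)
  qed
  define \<phi> where "\<phi> t = \<bar>t - trace M\<bar> powr p" for t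
  have [measurable]: "\<phi> \<in> borel_measurable borel" unfolding \<phi>_def by measurable
  have [measurable]: "(\<lambda>x. x \<bullet> (M *v x)) \<in> borel_measurable (borel :: (real^'n) measure)"
    by (intro borel_measurable_continuous_onI continuous_intros linear_continuous_on) (simp add: linear_linear)
  have [measurable]: "(\<lambda>w. \<Sum>i\<in>UNIV. l $ i * (w i)\<^sup>2) \<in> borel_measurable gauss_prod" by measurable
  have Tl': "\<phi> (\<Sum>i\<in>UNIV. l $ i * (w i)\<^sup>2) = n powr p * T w" for w unfolding \<phi>_def by (rule Tl)
  have "integrable P (\<lambda>\<omega>. \<phi> (G \<omega> \<bullet> (M *v G \<omega>))) \<longleftrightarrow> integrable std_gaussian (\<lambda>x. \<phi> (x \<bullet> (M *v x)))"
    by (rule distributed_integral_distr(1)[OF G]) simp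
  also have "\<dots> \<longleftrightarrow> integrable (distr std_gaussian borel (\<lambda>x. x \<bullet> (M *v x))) \<phi>"
    by (rule integrable_distr_eq[symmetric]) auto
  also have "\<dots> \<longleftrightarrow> integrable gauss_prod (\<lambda>w. \<phi> (\<Sum>i\<in>UNIV. l $ i * (w i)\<^sup>2))"
    unfolding law by (rule integrable_distr_eq) auto
  finally show "integrable P (\<lambda>\<omega>. \<bar>G \<omega> \<bullet> (M *v G \<omega>) - trace M\<bar> powr p)"
    unfolding Tl' unfolding \<phi>_def using T(1) by simp
  have "(\<integral>\<omega>. \<phi> (G \<omega> \<bullet> (M *v G \<omega>)) \<partial>P) = (\<integral>x. \<phi> (x \<bullet> (M *v x)) \<partial>std_gaussian)"
    by (rule distributed_integral_distr(2)[OF G]) simp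
  also have "\<dots> = (\<integral>t. \<phi> t \<partial>distr std_gaussian borel (\<lambda>x. x \<bullet> (M *v x)))"
    by (rule integral_distr[symmetric]) auto
  also have "\<dots> = (\<integral>w. \<phi> (\<Sum>i\<in>UNIV. l $ i * (w i)\<^sup>2) \<partial>gauss_prod)"
    unfolding law by (rule integral_distr) auto
  also have "\<dots> = n powr p * F" unfolding Tl' F_def by simp
  finally have mom: "(\<integral>\<omega>. \<bar>G \<omega> \<bullet> (M *v G \<omega>) - trace M\<bar> powr p \<partial>P) = n powr p * F" unfolding \<phi>_def .
  have F0: "F \<ge> 0" unfolding F_def T_def by (intro Bochner_Integration.integral_nonneg) simp
  have Lp: "Lp_norm P p (\<lambda>\<omega>. G \<omega> \<bullet> (M *v G \<omega>) - trace M) = n * F powr (1 / p)"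
    unfolding Lp_norm_def mom using n p F0 by (simp add: powr_mult powr_powr)
  have le: "F powr (1 / p) \<le> square_moment p powr (1 / p)"
    using T(2) F0 p by (intro powr_mono2) auto
  show "Lp_norm P p (\<lambda>\<omega>. G \<omega> \<bullet> (M *v G \<omega>) - trace M) \<le> square_moment p powr (1 / p) * frobenius_norm M"
    unfolding Lp frob n_def[symmetric] using le n by (simp add: mult.commute)
  have "F powr (1 / p) = square_moment p powr (1 / p) \<longleftrightarrow> F = square_moment p"
    using powr_less_mono2[of "1 / p" F "square_moment p"] T(2) F0 p by (auto simp: le_less)
  then show "Lp_norm P p (\<lambda>\<omega>. G \<omega> \<bullet> (M *v G \<omega>) - trace M) = square_moment p powr (1 / p) * frobenius_norm M
      \<longleftrightarrow> rank M = 1"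
    unfolding Lp frob n_def[symmetric] using n T(3) by (auto simp: mult.commute)
qed

text \<open>The witness for sharpness: at rank one the bound is attained, and norm 1 makes any
  admissible constant directly comparable.\<close>

lemma rank_one_symmetric_matrix_exists:
  obtains M :: "real^'n^'n" where "transpose M = M" "M \<noteq> 0" "rank M = 1" "frobenius_norm M = 1"
proof -
  obtain i :: 'n where True by simp
  define l :: "real^'n" where "l = axis i 1"
  define M :: "real^'n^'n" where "M = (\<chi> i j. if i = j then l $ i else 0)"
  have "{j. l $ j \<noteq> 0} = {i}" by (auto simp: l_def axis_def)
  then have "rank M = 1" unfolding M_def rank_diagonal by simp
  moreover have "M \<noteq> 0" using calculation by auto
  moreover have "transpose M = M" by (auto simp: M_def transpose_def vec_eq_iff)
  moreover have "frobenius_norm M = 1"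
    unfolding frobenius_norm_def M_def trace_diagonal_square(2) by (simp add: l_def norm_axis_1)
  ultimately show ?thesis using that by blast
qed

theorem theorem1p1:
  fixes p :: real
    and P :: "'a measure" and G :: "'a \<Rightarrow> real ^ 'n"
    and Q :: "'b measure" and g :: "'b \<Rightarrow> real"
  assumes "p \<ge> 4"
    and "prob_space P" and "distributed P lborel G std_gaussian_density"
    and "prob_space Q" and "distributed Q lborel g std_normal_density"
  shows "integrable Q (\<lambda>\<omega>. \<bar>(g \<omega>)\<^sup>2 - 1\<bar> powr p)
    \<and> (\<forall>M :: real ^ 'n ^ 'n. transpose M = M \<and> M \<noteq> 0 \<longrightarrow>
         integrable P (\<lambda>\<omega>. \<bar>G \<omega> \<bullet> (M *v G \<omega>) - trace M\<bar> powr p)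
         \<and> Lp_norm P p (\<lambda>\<omega>. G \<omega> \<bullet> (M *v G \<omega>) - trace M)
             \<le> Lp_norm Q p (\<lambda>\<omega>. (g \<omega>)\<^sup>2 - 1) * frobenius_norm M
         \<and> (Lp_norm P p (\<lambda>\<omega>. G \<omega> \<bullet> (M *v G \<omega>) - trace M)
               = Lp_norm Q p (\<lambda>\<omega>. (g \<omega>)\<^sup>2 - 1) * frobenius_norm M
             \<longleftrightarrow> rank M = 1))
    \<and> (\<forall>c :: real.
         (\<forall>M :: real ^ 'n ^ 'n. transpose M = M \<and> M \<noteq> 0 \<longrightarrow>
            Lp_norm P p (\<lambda>\<omega>. G \<omega> \<bullet> (M *v G \<omega>) - trace M) \<le> c * frobenius_norm M)
         \<longrightarrow> Lp_norm Q p (\<lambda>\<omega>. (g \<omega>)\<^sup>2 - 1) \<le> c)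
    \<and> Lp_norm Q p (\<lambda>\<omega>. (g \<omega>)\<^sup>2 - 1) =
        (1 / sqrt (2 * pi) *
          (LBINT x:{0<..}. \<bar>x - 1\<bar> powr p * x powr (- 1 / 2) * exp (- x / 2))) powr (1 / p)"
proof -
  have p: "p > 3" using assms(1) by simp
  have int: "integrable Q (\<lambda>\<omega>. \<bar>(g \<omega>)\<^sup>2 - 1\<bar> powr p)"
    using p by (subst distributed_integral_distr(1)[OF assms(5), of "\<lambda>x. \<bar>x\<^sup>2 - 1\<bar> powr p"]) (auto intro: integrable_square_moment)
  have Q: "Lp_norm Q p (\<lambda>\<omega>. (g \<omega>)\<^sup>2 - 1) = square_moment p powr (1 / p)"
    unfolding Lp_norm_def square_moment_def
    by (subst distributed_integral_distr(2)[OF assms(5), of "\<lambda>x. \<bar>x\<^sup>2 - 1\<bar> powr p"]) auto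
  note M = quadratic_form_moment[OF p assms(3)]
  have sharp: "square_moment p powr (1 / p) \<le> c"
    if "\<And>M :: real ^ 'n ^ 'n. transpose M = M \<and> M \<noteq> 0 \<Longrightarrow>
      Lp_norm P p (\<lambda>\<omega>. G \<omega> \<bullet> (M *v G \<omega>) - trace M) \<le> c * frobenius_norm M" for c
  proof -
    obtain M :: "real^'n^'n" where 1: "transpose M = M" "M \<noteq> 0" "rank M = 1" "frobenius_norm M = 1"
      by (rule rank_one_symmetric_matrix_exists)
    with M(3)[OF 1(1,2)] that[of M] show ?thesis by simp
  qed
  show ?thesis
    unfolding Q using int M sharp square_moment_eq[of p] by auto
qed

end
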